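(* Let $d\ge 1$ and let $\Delta$ be a connected combinatorial manifold of dimension $d$. Then there is a strongly connected simplicial map from $\Delta$ to the simplicial sphere $S_d=\{S\subseteq\{1,\dots,d+2\}:|S|\le d+1\}$. In particular, $$\operatorname{elocr}(\Delta)\ge d.$$
   Context: A simplicial complex $\Delta$ on a finite vertex set $V(\Delta)$ is a family of subsets of $V(\Delta)$ (called faces) that is closed under taking subsets and contains all singletons; its edges are its two-element faces. $|\Delta|$ denotes its topological realization. The link of a vertex $i$ is $\operatorname{lk}_i(\Delta)=\{F\in\Delta:i\notin F,\ F\cup\{i\}\in\Delta\}$. $\Delta$ is a combinatorial manifold of dimension $d$ if for each vertex $i$ the realization of $\operatorname{lk}_i(\Delta)$ is homeomorphic to a sphere of dimension $d-1$, and $|\Delta|$ is a (closed) topological manifold. A simplicial map $\phi:\Delta\to\Gamma$ is a map $V(\Delta)\to V(\Gamma)$ taking faces to faces; it is surjective if every face of $\Gamma$ is the image $\phi(T)$ of some face $T\in\Delta$. A surjective simplicial map is strongly connected if: (1) whenever $a,b\in V(\Delta)$ and $\phi(a)=\phi(b)=c\in V(\Gamma)$, there is a sequence $a=x_1,x_2,\dots,x_k=b$ in $V(\Delta)$ with $\phi(x_i)=c$ for all $i$ and $\{x_i,x_{i+1}\}\in\Delta$ for each $1\le i\le k-1$; (2) whenever $a,b$ are edges of $\Delta$ and $\phi(a)=\phi(b)=c$ is an edge of $\Gamma$, there is a sequence of edges $a=e_1,e_2,\dots,e_k=b$ of $\Delta$ with $\phi(e_i)=c$ for all $i$, and $e_i\cup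 e_{i+1}\in\Delta$ and $e_i\cap e_{i+1}\ne\varnothing$ for each $1\le i\le k-1$. Let $I(\Delta)\subseteq\mathbb{R}[x_i:i\in V(\Delta)]$ be the ideal generated by the monomials $\prod_{i\in S}x_i$ with $S\subseteq V(\Delta)$, $S\notin\Delta$, and let $R_m(\Delta)$ be the degree $m$ homogeneous part of $\mathbb{R}[x_i:i\in V(\Delta)]/I(\Delta)$. Elements of $R_m(\Delta)$ are regarded as functions on $\bigcup_{F\in\Delta}\operatorname{span}\{e_i:i\in F\}\subseteq\mathbb{R}^{V(\Delta)}$. Let $\mathcal{P}(\Delta)\subseteq R_2(\Delta)$ be the convex cone of quadratic forms that are nonnegative on this union, and $\Sigma(\Delta)\subseteq\mathcal{P}(\Delta)$ the cone of sums of squares of elements of $R_1(\Delta)$. A nonzero element $x$ of a convex cone $C$ spans an extreme ray if there are no linearly independent $y,z\in C$ with $x=y+z$. The rank of a sum-of-squares form is the least $k$ such that it is a sum of $k$ squares of linear forms. For $q\in\mathcal{P}(\Delta)$ the local rank is $\operatorname{locr}(q)=\max_{F\in\Delta}\operatorname{rank}(q|_{\operatorname{span}\{e_i:i\in F\}})$. A complex is chordal if it is the clique complex (faces are the vertex sets of cliques) of a chordal graph, i.e. a graph with no induced cycle of length at least 4. The extreme local rank $\operatorname{elocr}(\Delta)$ is the maximum of $\operatorname{locr}(q)$ over those $q\in\mathcal{P}(\Delta)\setminus\Sigma(\Delta)$ which span an extreme ray of $\mathcal{P}(\Delta)$; it is defined to be $0$ if $\Delta$ is chordal. It is a known result (from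 the literature) that $\operatorname{elocr}(S_d)=d$. *)

theory Defs
  imports
    "HOL-Analysis.Analysis"
    "HOL-Algebra.QuotRing"
    "HOL-Library.Poly_Mapping"
begin

section \<open>Simplicial complexes\<close>

text \<open>A complex is given by its set of faces. Since all singletons of vertices are faces,
  the vertex set is the union of the faces.\<close>

definition is_complex :: "'v set set \<Rightarrow> bool" where
  "is_complex D \<longleftrightarrow> finite (\<Union>D) \<and> (\<forall>F\<in>D. \<forall>G. G \<subseteq> F \<longrightarrow> G \<in> D)"

definition vertices :: "'v set set \<Rightarrow> 'v set" where
  "vertices D = \<Union>D"

definition edges :: "'v set set \<Rightarrow> 'v set set" where
  "edges D = {e \<in> D. card e = 2}"

definition link :: "'v set set \<Rightarrow> 'v \<Rightarrow> 'v set set" where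
  "link D i = {F \<in> D. i \<notin> F \<and> insert i F \<in> D}"

text \<open>Barycentric coordinates. Points are functions on the whole type that vanish outside the
  vertex set, the convention also used by \<^const>\<open>Euclidean_space\<close> and \<^const>\<open>nsphere\<close>.\<close>

definition realization :: "'v set set \<Rightarrow> ('v \<Rightarrow> real) topology" where
  "realization D = subtopology (powertop_real UNIV)
     {x. (\<forall>i. 0 \<le> x i) \<and> {i. x i \<noteq> 0} \<in> D \<and> (\<Sum>i\<in>vertices D. x i) = 1}"

definition closed_manifold :: "nat \<Rightarrow> 'a topology \<Rightarrow> bool" where
  "closed_manifold n X \<longleftrightarrow>
     Hausdorff_space X \<and> second_countable X \<and> compact_space X \<and>
     (\<forall>p\<in>topspace X. \<exists>U W. openin X U \<and> p \<in> U \<and> openin (Euclidean_space n) W \<and>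
        subtopology X U homeomorphic_space subtopology (Euclidean_space n) W)"

text \<open>Used for \<open>d \<ge> 1\<close> only, so that the subtraction is not truncated; \<open>nsphere 0\<close> is a pair
  of points.\<close>

definition combinatorial_manifold :: "nat \<Rightarrow> 'v set set \<Rightarrow> bool" where
  "combinatorial_manifold d D \<longleftrightarrow> is_complex D \<and>
     (\<forall>i\<in>vertices D. realization (link D i) homeomorphic_space nsphere (d - 1)) \<and>
     closed_manifold d (realization D)"

text \<open>\<^const>\<open>connected_space\<close> holds for the empty space, which is not regarded as connected here.\<close>

definition connected_complex :: "'v set set \<Rightarrow> bool" where
  "connected_complex D \<longleftrightarrow> vertices D \<noteq> {} \<and> connected_space (realization D)"

definition simplicial_sphere :: "nat \<Rightarrow> nat set set" where
  "simplicial_sphere d = {S. S \<subseteq> {1..d + 2} \<and> card S \<le> d + 1}"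

section \<open>Strongly connected simplicial maps\<close>

definition simplicial_map :: "'v set set \<Rightarrow> 'w set set \<Rightarrow> ('v \<Rightarrow> 'w) \<Rightarrow> bool" where
  "simplicial_map D G \<phi> \<longleftrightarrow> \<phi> ` vertices D \<subseteq> vertices G \<and> (\<forall>F\<in>D. \<phi> ` F \<in> G)"

definition surjective_simplicial_map :: "'v set set \<Rightarrow> 'w set set \<Rightarrow> ('v \<Rightarrow> 'w) \<Rightarrow> bool" where
  "surjective_simplicial_map D G \<phi> \<longleftrightarrow> simplicial_map D G \<phi> \<and> (\<forall>S\<in>G. \<exists>T\<in>D. \<phi> ` T = S)"

definition strongly_connected_map :: "'v set set \<Rightarrow> 'w set set \<Rightarrow> ('v \<Rightarrow> 'w) \<Rightarrow> bool" where
  "strongly_connected_map D G \<phi> \<longleftrightarrow> surjective_simplicial_map D G \<phi> \<and>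
     (\<forall>a\<in>vertices D. \<forall>b\<in>vertices D. \<forall>c\<in>vertices G. \<phi> a = c \<and> \<phi> b = c \<longrightarrow>
        (\<exists>xs. xs \<noteq> [] \<and> hd xs = a \<and> last xs = b \<and> set xs \<subseteq> vertices D \<and>
           (\<forall>x\<in>set xs. \<phi> x = c) \<and>
           (\<forall>i. Suc i < length xs \<longrightarrow> {xs ! i, xs ! Suc i} \<in> D))) \<and>
     (\<forall>a\<in>edges D. \<forall>b\<in>edges D. \<forall>c\<in>edges G. \<phi> ` a = c \<and> \<phi> ` b = c \<longrightarrow>
        (\<exists>es. es \<noteq> [] \<and> hd es = a \<and> last es = b \<and> set es \<subseteq> edges D \<and>
           (\<forall>e\<in>set es. \<phi> ` e = c) \<and>
           (\<forall>i. Suc i < length es \<longrightarrow>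
              es ! i \<union> es ! Suc i \<in> D \<and> es ! i \<inter> es ! Suc i \<noteq> {})))"

section \<open>The ring of a complex\<close>

text \<open>A polynomial maps monomials (finitely supported exponent functions) to coefficients.\<close>

type_synonym 'v rpoly = "('v \<Rightarrow>\<^sub>0 nat) \<Rightarrow>\<^sub>0 real"

definition var :: "'v \<Rightarrow> 'v rpoly" where
  "var i = Poly_Mapping.single (Poly_Mapping.single i 1) 1"

definition const_poly :: "real \<Rightarrow> 'v rpoly" where
  "const_poly c = Poly_Mapping.single 0 c"

definition poly_eval :: "'v rpoly \<Rightarrow> ('v \<Rightarrow> real) \<Rightarrow> real" where
  "poly_eval p x = (\<Sum>m\<in>Poly_Mapping.keys p. Poly_Mapping.lookup p m *
     (\<Prod>i\<in>Poly_Mapping.keys m. x i ^ Poly_Mapping.lookup m i))"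

definition homogeneous :: "nat \<Rightarrow> 'v rpoly \<Rightarrow> bool" where
  "homogeneous k p \<longleftrightarrow> (\<forall>m\<in>Poly_Mapping.keys p.
     (\<Sum>i\<in>Poly_Mapping.keys m. Poly_Mapping.lookup m i) = k)"

definition poly_ring :: "'v set \<Rightarrow> 'v rpoly ring" where
  "poly_ring V = \<lparr>carrier = {p. \<forall>m\<in>Poly_Mapping.keys p. Poly_Mapping.keys m \<subseteq> V},
     mult = (*), one = 1, zero = 0, add = (+)\<rparr>"

definition sr_ideal :: "'v set set \<Rightarrow> 'v rpoly set" where
  "sr_ideal D = genideal (poly_ring (vertices D))
     {(\<Prod>i\<in>S. var i) | S. S \<subseteq> vertices D \<and> S \<notin> D}"

definition sr_ring :: "'v set set \<Rightarrow> 'v rpoly set ring" where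
  "sr_ring D = poly_ring (vertices D) Quot sr_ideal D"

definition sr_class :: "'v set set \<Rightarrow> 'v rpoly \<Rightarrow> 'v rpoly set" where
  "sr_class D p = sr_ideal D +>\<^bsub>poly_ring (vertices D)\<^esub> p"

definition sr_part :: "nat \<Rightarrow> 'v set set \<Rightarrow> 'v rpoly set set" where
  "sr_part k D = {sr_class D p | p. p \<in> carrier (poly_ring (vertices D)) \<and> homogeneous k p}"

definition sr_scale :: "'v set set \<Rightarrow> real \<Rightarrow> 'v rpoly set \<Rightarrow> 'v rpoly set" where
  "sr_scale D c q = sr_class D (const_poly c) \<otimes>\<^bsub>sr_ring D\<^esub> q"

text \<open>The span of the coordinate vectors \<open>e\<^sub>i\<close>, \<open>i \<in> F\<close>.\<close>

definition coord_span :: "'v set \<Rightarrow> ('v \<Rightarrow> real) set" where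
  "coord_span F = {x. \<forall>i. i \<notin> F \<longrightarrow> x i = 0}"

text \<open>All polynomials in \<^term>\<open>sr_ideal D\<close> vanish on the union of the coordinate subspaces of the
  faces, so on this union the value below does not depend on the chosen representative. It is
  meaningless elsewhere.\<close>

definition sr_eval :: "'v rpoly set \<Rightarrow> ('v \<Rightarrow> real) \<Rightarrow> real" where
  "sr_eval q x = poly_eval (SOME p. p \<in> q) x"

section \<open>Nonnegative quadratic forms, sums of squares and extreme rays\<close>

definition nonneg_cone :: "'v set set \<Rightarrow> 'v rpoly set set" where
  "nonneg_cone D = {q \<in> sr_part 2 D. \<forall>x \<in> (\<Union>F\<in>D. coord_span F). 0 \<le> sr_eval q x}"

definition sos_cone :: "'v set set \<Rightarrow> 'v rpoly set set" where
  "sos_cone D = {(\<Oplus>\<^bsub>sr_ring D\<^esub> j\<in>{..<k}. l j \<otimes>\<^bsub>sr_ring D\<^esub> l j) | (k::nat) l.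
     \<forall>j<k. l j \<in> sr_part 1 D}"

definition sr_lin_indep :: "'v set set \<Rightarrow> 'v rpoly set \<Rightarrow> 'v rpoly set \<Rightarrow> bool" where
  "sr_lin_indep D y z \<longleftrightarrow>
     (\<forall>a b. sr_scale D a y \<oplus>\<^bsub>sr_ring D\<^esub> sr_scale D b z = \<zero>\<^bsub>sr_ring D\<^esub> \<longrightarrow> a = 0 \<and> b = 0)"

definition spans_extreme_ray :: "'v set set \<Rightarrow> 'v rpoly set set \<Rightarrow> 'v rpoly set \<Rightarrow> bool" where
  "spans_extreme_ray D C q \<longleftrightarrow> q \<in> C \<and> q \<noteq> \<zero>\<^bsub>sr_ring D\<^esub> \<and>
     \<not> (\<exists>y\<in>C. \<exists>z\<in>C. sr_lin_indep D y z \<and> q = y \<oplus>\<^bsub>sr_ring D\<^esub> z)"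

definition sos_rank :: "'v set \<Rightarrow> (('v \<Rightarrow> real) \<Rightarrow> real) \<Rightarrow> nat" where
  "sos_rank F f = (LEAST k. \<exists>a :: nat \<Rightarrow> 'v \<Rightarrow> real.
     \<forall>x\<in>coord_span F. f x = (\<Sum>j<k. (\<Sum>i\<in>F. a j i * x i)\<^sup>2))"

text \<open>Every nonnegative quadratic form on \<^term>\<open>coord_span F\<close> is a sum of squares of linear forms,
  so the least number exists for \<^term>\<open>q \<in> nonneg_cone D\<close>.\<close>

definition locr :: "'v set set \<Rightarrow> 'v rpoly set \<Rightarrow> nat" where
  "locr D q = Max ((\<lambda>F. sos_rank F (sr_eval q)) ` D)"

section \<open>Chordal complexes and the extreme local rank\<close>

definition induced_cycle :: "'v set set \<Rightarrow> 'v list \<Rightarrow> bool" where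
  "induced_cycle E vs \<longleftrightarrow> distinct vs \<and> length vs \<ge> 3 \<and>
     (\<forall>i j. i < j \<and> j < length vs \<longrightarrow>
        ({vs ! i, vs ! j} \<in> E \<longleftrightarrow> j = Suc i \<or> i = 0 \<and> j = length vs - 1))"

definition chordal_graph :: "'v set \<Rightarrow> 'v set set \<Rightarrow> bool" where
  "chordal_graph V E \<longleftrightarrow> (\<forall>e\<in>E. e \<subseteq> V \<and> card e = 2) \<and>
     \<not> (\<exists>vs. set vs \<subseteq> V \<and> length vs \<ge> 4 \<and> induced_cycle E vs)"

definition clique_complex :: "'v set \<Rightarrow> 'v set set \<Rightarrow> 'v set set" where
  "clique_complex V E = {S. S \<subseteq> V \<and> (\<forall>u\<in>S. \<forall>v\<in>S. u \<noteq> v \<longrightarrow> {u, v} \<in> E)}"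

definition chordal_complex :: "'v set set \<Rightarrow> bool" where
  "chordal_complex D \<longleftrightarrow> (\<exists>E. chordal_graph (vertices D) E \<and> D = clique_complex (vertices D) E)"

definition elocr :: "'v set set \<Rightarrow> nat" where
  "elocr D = (if chordal_complex D then 0
     else Max {locr D q | q. q \<in> nonneg_cone D - sos_cone D \<and> spans_extreme_ray D (nonneg_cone D) q})"

end

(*
Let F be a facet of \<Delta>. Send the vertices of F bijectively to 1, ..., d + 1 and all other
vertices to d + 2. Everything about this map reduces to the links: the cone over a complex L whose
realization is a (d - 1)-sphere is homeomorphic to R^d, so invariance of domain shows that faces of L
have at most d vertices and that every face with fewer vertices has extensions in two directions, and
the complement of the orthant of a facet is connected because complements of homeomorphic closed
subsets of R^d have equally many components. For the fibre over d + 2 a path through F is rerouted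
through the links of vertices of F; when d = 1 these are pairs of points and a parity count is used.

The form (d + 1) \<Sum> y_i^2 - (\<Sum> y_i)^2 on d + 2 variables is not a sum of squares, but positive
semidefinite of rank d on each d + 1 of the variables. A form between 0 and its pullback Q along a
strongly connected map vanishes wherever Q does on a face; strong connectedness makes its coefficients
constant on the fibres, and the all-one kernel vectors on facets then force it to be a multiple of Q.
So Q spans an extreme ray. Finally \<Delta> is not chordal, since the link of a simplicial vertex
would be a simplex.
*)
theory Submission
  imports Defs "HOL-Homology.Homology"
begin

text \<open>The fibres over \<open>1, ..., d + 1\<close> are single vertices, so the path conditions
  only concern \<open>d + 2\<close> and the edges \<open>{j, d + 2}\<close>. The latter all contain
  the vertex over \<open>j\<close>, and a single link settles them. For the fibre over
  \<open>d + 2\<close> there is no Euclidean model of the whole complex. Hence connectedness off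
  \<open>F\<close> is pieced together from the links of the vertices of \<open>F\<close>, and
  \<open>d = 1\<close>, where an edge has no third vertex through which two links could be compared,
  needs an argument of its own. The factor \<open>d + 1\<close> is the one for which the form in
  \<open>d + 1\<close> variables is half the sum of \<open>(y_i - y_j)^2\<close> over all ordered
  pairs; in \<open>d + 2\<close> variables its value at the all-one vector is
  \<open>-(d + 2)\<close>. If the pullback were a sum of squares, the vectors of coefficients
  belonging to two adjacent vertices of a fibre would have distance \<open>0\<close>. So the vectors
  would descend to \<open>1, ..., d + 2\<close> with Gram matrix \<open>sphere_matrix d\<close>,
  against that negative value.\<close>

section \<open>Cones over spherical complexes\<close>

text \<open>The bound of the coordinates by the gauge \<open>N\<close> makes the radial extension of a continuous map between
  the sections \<open>N = 1\<close> continuous at the apex.\<close>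

definition conic_gauge :: "('a \<Rightarrow> real) set \<Rightarrow> (('a \<Rightarrow> real) \<Rightarrow> real) \<Rightarrow> bool" where
  "conic_gauge C N \<longleftrightarrow> (\<lambda>i. 0) \<in> C \<and> continuous_on C N \<and>
     (\<forall>x\<in>C. \<forall>c\<ge>0. (\<lambda>i. c * x i) \<in> C \<and> N (\<lambda>i. c * x i) = c * N x) \<and>
     (\<forall>x\<in>C. \<forall>i. \<bar>x i\<bar> \<le> N x)"

text \<open>At the apex the division yields the zero function, where nothing is known about
  \<open>f\<close>; the factor \<open>N x = 0\<close> makes the value \<open>0\<close> all the
  same.\<close>

definition radial_extension ::
    "(('a \<Rightarrow> real) \<Rightarrow> real) \<Rightarrow> (('a \<Rightarrow> real) \<Rightarrow> 'b \<Rightarrow> real) \<Rightarrow> ('a \<Rightarrow> real) \<Rightarrow> 'b \<Rightarrow> real" where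
  "radial_extension N f x = (\<lambda>i. N x * f (\<lambda>j. x j / N x) i)"

lemma conic_gaugeI:
  assumes "(\<lambda>i. 0) \<in> C" "continuous_on C N"
    and "\<And>x c. x \<in> C \<Longrightarrow> c \<ge> 0 \<Longrightarrow> (\<lambda>i. c * x i) \<in> C \<and> N (\<lambda>i. c * x i) = c * N x"
    and "\<And>x i. x \<in> C \<Longrightarrow> \<bar>x i\<bar> \<le> N x"
  shows "conic_gauge C N"
  using assms unfolding conic_gauge_def by blast

lemma conic_nonneg:
  assumes "conic_gauge C N" "x \<in> C"
  shows "0 \<le> N x"
  using assms unfolding conic_gauge_def by (meson abs_ge_zero order_trans)

lemma conic_zero:
  assumes "conic_gauge C N"
  shows "(\<lambda>i. 0) \<in> C" "N (\<lambda>i. 0) = 0"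
proof -
  show *: "(\<lambda>i. 0) \<in> C"
    using assms by (simp add: conic_gauge_def)
  have "N (\<lambda>i. c * (\<lambda>i. 0) i) = c * N (\<lambda>i. 0)" if "c \<ge> 0" for c
    using assms * that unfolding conic_gauge_def by fast
  from this[of 0] show "N (\<lambda>i. 0) = 0"
    by simp
qed

lemma conic_eq_zero:
  assumes "conic_gauge C N" "x \<in> C" "N x = 0"
  shows "x = (\<lambda>i. 0)"
  using assms unfolding conic_gauge_def by (metis abs_le_zero_iff)

lemma conic_normalize:
  assumes "conic_gauge C N" "x \<in> C" "N x \<noteq> 0"
  shows "(\<lambda>j. x j / N x) \<in> {x \<in> C. N x = 1}"
proof -
  have *: "(\<lambda>i. c * x i) \<in> C" "N (\<lambda>i. c * x i) = c * N x" if "c \<ge> 0" for c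
    using assms(1,2) that unfolding conic_gauge_def by blast+
  have "0 \<le> inverse (N x)"
    using conic_nonneg[OF assms(1,2)] by simp
  from *[OF this] show ?thesis
    using assms(3) by (simp add: field_simps)
qed

text \<open>Away from the apex the map is composed of continuous ones on the relatively open set
  where \<open>N\<close> is nonzero. At the apex, the values of \<open>f\<close> have coordinates
  bounded by \<open>1\<close>, so those of the extension are bounded by \<open>N\<close>, which
  tends to \<open>0\<close>.\<close>

lemma continuous_on_radial_extension:
  assumes C: "conic_gauge C N" and D: "conic_gauge D M"
    and f: "continuous_on {x \<in> C. N x = 1} f" "f ` {x \<in> C. N x = 1} \<subseteq> {x \<in> D. M x = 1}"
  shows "continuous_on C (radial_extension N f)"
proof (rule continuous_on_coordinatewise_then_product)
  fix i
  have N: "continuous_on C N"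
    using C by (simp add: conic_gauge_def)
  show "continuous_on C (\<lambda>x. radial_extension N f x i)"
    unfolding continuous_on_def
  proof
    fix x assume x: "x \<in> C"
    show "((\<lambda>x. radial_extension N f x i) \<longlongrightarrow> radial_extension N f x i) (at x within C)"
    proof (cases "N x = 0")
      case True
      have bound: "\<bar>radial_extension N f y i\<bar> \<le> N y" if "y \<in> C" for y
      proof (cases "N y = 0")
        case False
        have "f (\<lambda>j. y j / N y) \<in> {x \<in> D. M x = 1}"
          using f(2) conic_normalize[OF C that False] by blast
        then have "\<bar>f (\<lambda>j. y j / N y) i\<bar> \<le> 1"
          using D unfolding conic_gauge_def by force
        then show ?thesis
          using conic_nonneg[OF C that]
          by (simp add: radial_extension_def abs_mult mult_left_le)
      qed (simp add: radial_extension_def)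
      have "(N \<longlongrightarrow> 0) (at x within C)"
        using N x True unfolding continuous_on_def by metis
      moreover have "\<forall>\<^sub>F y in at x within C. norm (radial_extension N f y i) \<le> N y"
        using bound by (simp add: eventually_at_filter)
      ultimately have "((\<lambda>y. radial_extension N f y i) \<longlongrightarrow> 0) (at x within C)"
        by (rule Lim_null_comparison[rotated])
      then show ?thesis
        using True by (simp add: radial_extension_def)
    next
      case False
      define B where "B = {y \<in> C. N y \<noteq> 0}"
      have "openin (top_of_set C) (C \<inter> N -` (- {0}))"
        using N by (intro continuous_openin_preimage_gen) auto
      moreover have "C \<inter> N -` (- {0}) = B"
        by (auto simp: B_def)
      ultimately obtain U where U: "open U" "B = C \<inter> U"
        by (auto simp: openin_open)
      have "continuous_on B (\<lambda>y. f (\<lambda>j. y j / N y))"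
      proof (rule continuous_on_compose2[OF f(1)])
        show "continuous_on B (\<lambda>y j. y j / N y)"
        proof (rule continuous_on_coordinatewise_then_product)
          fix j
          show "continuous_on B (\<lambda>y. y j / N y)"
            by (intro continuous_on_divide continuous_on_subset[OF N]
                continuous_on_subset[OF continuous_on_product_coordinates]) (auto simp: B_def)
        qed
        show "(\<lambda>y j. y j / N y) ` B \<subseteq> {x \<in> C. N x = 1}"
          using conic_normalize[OF C] unfolding B_def by blast
      qed
      then have "continuous_on B (\<lambda>y. f (\<lambda>j. y j / N y) i)"
        by (rule continuous_on_product_then_coordinatewise)
      moreover have "continuous_on B N"
        using N by (rule continuous_on_subset) (auto simp: B_def)
      ultimately have "continuous_on B (\<lambda>y. radial_extension N f y i)"
        unfolding radial_extension_def by (rule continuous_on_mult[rotated])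
      then have "((\<lambda>y. radial_extension N f y i) \<longlongrightarrow> radial_extension N f x i) (at x within B)"
        using x False unfolding continuous_on_def by (simp add: B_def)
      moreover have "at x within C = at x within B"
        by (rule at_within_nhd[of x U]) (use U x False in \<open>auto simp: B_def\<close>)
      ultimately show ?thesis
        by simp
    qed
  qed
qed

lemma radial_extension_in:
  assumes C: "conic_gauge C N" and D: "conic_gauge D M"
    and f: "f ` {x \<in> C. N x = 1} \<subseteq> {x \<in> D. M x = 1}" and x: "x \<in> C"
  shows "radial_extension N f x \<in> D \<and> M (radial_extension N f x) = N x"
proof (cases "N x = 0")
  case True
  show ?thesis
    using conic_zero[OF D] True by (simp add: radial_extension_def)
next
  case False
  have "f (\<lambda>j. x j / N x) \<in> {x \<in> D. M x = 1}"
    using f conic_normalize[OF C x False] by blast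
  then show ?thesis
    using D conic_nonneg[OF C x] unfolding conic_gauge_def radial_extension_def by auto
qed

lemma radial_extension_inverse:
  assumes C: "conic_gauge C N" and D: "conic_gauge D M"
    and f: "f ` {x \<in> C. N x = 1} \<subseteq> {x \<in> D. M x = 1}"
    and gf: "\<And>x. x \<in> C \<Longrightarrow> N x = 1 \<Longrightarrow> g (f x) = x" and x: "x \<in> C"
  shows "radial_extension M g (radial_extension N f x) = x"
proof (cases "N x = 0")
  case True
  then show ?thesis
    using radial_extension_in[OF C D f x] conic_eq_zero[OF C x]
    by (simp add: radial_extension_def)
next
  case False
  have "M (radial_extension N f x) = N x"
    using radial_extension_in[OF C D f x] by blast
  moreover have "(\<lambda>j. radial_extension N f x j / N x) = f (\<lambda>j. x j / N x)"
    using False by (auto simp: radial_extension_def)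
  moreover have "g (f (\<lambda>j. x j / N x)) = (\<lambda>j. x j / N x)"
    using gf conic_normalize[OF C x False] by blast
  ultimately show ?thesis
    using False by (simp add: radial_extension_def[of M])
qed

text \<open>Used with the coordinate sum on the cone over a link and the Euclidean norm on R^d: the
  sections are then the realization of the link and the unit sphere.\<close>

lemma homeomorphic_conic:
  assumes C: "conic_gauge C N" and D: "conic_gauge D M"
    and hom: "top_of_set {x \<in> C. N x = 1} homeomorphic_space top_of_set {x \<in> D. M x = 1}"
  shows "top_of_set C homeomorphic_space top_of_set D"
proof -
  obtain f g where fg: "homeomorphic_maps (top_of_set {x \<in> C. N x = 1}) (top_of_set {x \<in> D. M x = 1}) f g"
    using hom unfolding homeomorphic_space_def by blast
  have f: "continuous_on {x \<in> C. N x = 1} f" "f ` {x \<in> C. N x = 1} \<subseteq> {x \<in> D. M x = 1}"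
    and g: "continuous_on {x \<in> D. M x = 1} g" "g ` {x \<in> D. M x = 1} \<subseteq> {x \<in> C. N x = 1}"
    and gf: "\<And>x. x \<in> C \<Longrightarrow> N x = 1 \<Longrightarrow> g (f x) = x"
    and fg: "\<And>x. x \<in> D \<Longrightarrow> M x = 1 \<Longrightarrow> f (g x) = x"
    using fg by (auto simp: homeomorphic_maps_def continuous_map_in_subtopology continuous_map_subtopology_eu)
  have "homeomorphic_maps (top_of_set C) (top_of_set D) (radial_extension N f) (radial_extension M g)"
    unfolding homeomorphic_maps_def continuous_map_in_subtopology continuous_map_subtopology_eu
    using continuous_on_radial_extension[OF C D f] continuous_on_radial_extension[OF D C g]
      radial_extension_in[OF C D f(2)] radial_extension_in[OF D C g(2)]
      radial_extension_inverse[OF C D f(2) gf] radial_extension_inverse[OF D C g(2) fg]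
    by auto
  then show ?thesis
    unfolding homeomorphic_space_def by blast
qed

text \<open>The cone over \<open>realization D\<close> with apex \<open>0\<close>: the coordinates
  are no longer required to add up to \<open>1\<close>.\<close>

definition nonneg_span :: "'v set set \<Rightarrow> ('v \<Rightarrow> real) set" where
  "nonneg_span D = {x. (\<forall>i. 0 \<le> x i) \<and> {i. x i \<noteq> 0} \<in> D}"

lemma realization_eq:
  "realization D = top_of_set {x \<in> nonneg_span D. sum x (vertices D) = 1}"
  unfolding realization_def nonneg_span_def euclidean_product_topology
  by (simp add: conj_assoc)

lemma continuous_on_sum_coordinates:
  "continuous_on S (\<lambda>x::'a \<Rightarrow> real. sum x A)"
  by (intro continuous_on_sum continuous_on_subset[OF continuous_on_product_coordinates]) auto

lemma conic_nonneg_span: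
  assumes "is_complex D" "D \<noteq> {}"
  shows "conic_gauge (nonneg_span D) (\<lambda>x. sum x (vertices D))"
proof (rule conic_gaugeI)
  have fin: "finite (vertices D)" and sub: "\<And>F G. F \<in> D \<Longrightarrow> G \<subseteq> F \<Longrightarrow> G \<in> D"
    using assms by (auto simp: is_complex_def vertices_def)
  show "(\<lambda>i. 0) \<in> nonneg_span D"
    using assms(2) sub by (simp add: nonneg_span_def) blast
  show "continuous_on (nonneg_span D) (\<lambda>x. sum x (vertices D))"
    by (rule continuous_on_sum_coordinates)
  fix x assume x: "x \<in> nonneg_span D"
  show "\<bar>x i\<bar> \<le> sum x (vertices D)" for i
  proof (cases "i \<in> vertices D")
    case True
    then show ?thesis
      using x fin member_le_sum[of i "vertices D" x] by (simp add: nonneg_span_def)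
  next
    case False
    then have "x i = 0"
      using x by (auto simp: nonneg_span_def vertices_def)
    moreover have "0 \<le> sum x (vertices D)"
      using x by (intro sum_nonneg) (simp add: nonneg_span_def)
    ultimately show ?thesis
      by simp
  qed
  fix c :: real assume c: "c \<ge> 0"
  have "{i. c * x i \<noteq> 0} \<in> D"
    by (rule sub[of "{i. x i \<noteq> 0}"]) (use x in \<open>auto simp: nonneg_span_def\<close>)
  then have "(\<lambda>i. c * x i) \<in> nonneg_span D"
    using x c by (simp add: nonneg_span_def)
  moreover have "(\<Sum>i\<in>vertices D. c * x i) = c * sum x (vertices D)"
    by (rule sum_distrib_left[symmetric])
  ultimately show "(\<lambda>i. c * x i) \<in> nonneg_span D \<and>
      (\<Sum>i\<in>vertices D. c * x i) = c * sum x (vertices D)"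
    by blast
qed

lemma Euclidean_space_eq: "Euclidean_space n = top_of_set {x. \<forall>i\<ge>n. x i = 0}"
  by (simp add: Euclidean_space_def euclidean_product_topology)

lemma conic_Euclidean_space:
  "conic_gauge {x :: nat \<Rightarrow> real. \<forall>i\<ge>n. x i = 0} (\<lambda>x. sqrt (\<Sum>i<n. (x i)\<^sup>2))"
proof (rule conic_gaugeI)
  show "continuous_on S (\<lambda>x::nat \<Rightarrow> real. sqrt (\<Sum>i<n. (x i)\<^sup>2))" for S
    by (intro continuous_on_real_sqrt continuous_on_sum continuous_on_power
        continuous_on_subset[OF continuous_on_product_coordinates] subset_UNIV)
  fix x :: "nat \<Rightarrow> real" assume x: "x \<in> {x. \<forall>i\<ge>n. x i = 0}"
  show "\<bar>x i\<bar> \<le> sqrt (\<Sum>i<n. (x i)\<^sup>2)" for i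
  proof (cases "i < n")
    case True
    then have "(x i)\<^sup>2 \<le> (\<Sum>i<n. (x i)\<^sup>2)"
      by (intro member_le_sum) auto
    then show ?thesis
      using real_le_rsqrt[of "\<bar>x i\<bar>"] by simp
  qed (use x in \<open>simp add: sum_nonneg\<close>)
  fix c :: real assume c: "c \<ge> 0"
  have "sqrt (\<Sum>i<n. (c * x i)\<^sup>2) = c * sqrt (\<Sum>i<n. (x i)\<^sup>2)"
    using c by (simp add: power_mult_distrib sum_distrib_left[symmetric] real_sqrt_mult)
  moreover have "(\<lambda>i. c * x i) \<in> {x. \<forall>i\<ge>n. x i = 0}"
    using x by simp
  ultimately show "(\<lambda>i. c * x i) \<in> {x. \<forall>i\<ge>n. x i = 0} \<and>
      sqrt (\<Sum>i<n. (c * x i)\<^sup>2) = c * sqrt (\<Sum>i<n. (x i)\<^sup>2)"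
    by blast
qed simp

lemma nsphere_eq:
  assumes "d \<ge> 1"
  shows "nsphere (d - 1) = top_of_set {x \<in> {x. \<forall>i\<ge>d. x i = 0}. sqrt (\<Sum>i<d. (x i)\<^sup>2) = 1}"
proof -
  have "{..d - 1} = {..<d}"
    using assms by auto
  moreover have "(\<forall>i>d - 1. x i = 0) \<longleftrightarrow> (\<forall>i\<ge>d. x i = 0)" for x :: "nat \<Rightarrow> real"
    using assms by (metis One_nat_def Suc_le_eq Suc_pred)
  ultimately have "{x. (\<Sum>i\<le>d - 1. (x i)\<^sup>2) = 1 \<and> (\<forall>i>d - 1. x i = 0)} =
      {x :: nat \<Rightarrow> real. (\<forall>i\<ge>d. x i = 0) \<and> sqrt (\<Sum>i<d. (x i)\<^sup>2) = 1}"
    by auto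
  then show ?thesis
    unfolding nsphere euclidean_product_topology by simp
qed

lemma nonneg_span_homeomorphic_Euclidean_space:
  assumes "is_complex D" "d \<ge> 1" "realization D homeomorphic_space nsphere (d - 1)"
  shows "top_of_set (nonneg_span D) homeomorphic_space Euclidean_space d"
proof -
  \<comment> \<open>The apex belongs to the cone only if \<open>D\<close> has a face; this follows
    because the sphere is not empty.\<close>
  have "realization D \<noteq> trivial_topology"
    using homeomorphic_empty_space[OF assms(3)] nonempty_nsphere[of "d - 1"] by simp
  then have "topspace (realization D) \<noteq> {}"
    by simp
  then have "D \<noteq> {}"
    unfolding realization_eq nonneg_span_def by force
  moreover have "top_of_set {x \<in> nonneg_span D. sum x (vertices D) = 1} homeomorphic_space
      top_of_set {x \<in> {x. \<forall>i\<ge>d. x i = 0}. sqrt (\<Sum>i<d. (x i)\<^sup>2) = 1}"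
    using assms(3) by (simp only: realization_eq nsphere_eq[OF assms(2)])
  ultimately show ?thesis
    unfolding Euclidean_space_eq
    using homeomorphic_conic[OF conic_nonneg_span[OF assms(1)] conic_Euclidean_space] by blast
qed

text \<open>The way openness is exploited below: a set on which coordinate \<open>j\<close> is
  constantly \<open>0\<close>, or is \<open>0\<close> somewhere and never negative, cannot be
  open.\<close>

lemma openin_Euclidean_space_perturb:
  assumes V: "openin (Euclidean_space n) V" and y: "y \<in> V" and j: "j < n"
  obtains t where "t > 0" "y(j := y j - t) \<in> V"
proof -
  define E where "E = {x :: nat \<Rightarrow> real. \<forall>i\<ge>n. x i = 0}"
  have V: "openin (top_of_set E) V"
    using V by (simp add: Euclidean_space_eq E_def)
  define p where "p = (\<lambda>t i. if i = j then y j - t else y i)"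
  have "continuous_on UNIV p"
  proof (rule continuous_on_coordinatewise_then_product)
    show "continuous_on UNIV (\<lambda>t. p t i)" for i
      by (cases "i = j") (auto simp: p_def intro!: continuous_on_diff)
  qed
  moreover have "p ` UNIV \<subseteq> E"
    using openin_imp_subset[OF V] y j by (auto simp: p_def E_def)
  ultimately have "open (p -` V)"
    using continuous_openin_preimage[of UNIV p E V] V by auto
  moreover have "p 0 = y"
    by (auto simp: p_def)
  ultimately obtain e where "e > 0" "ball 0 e \<subseteq> p -` V"
    using y by (metis open_contains_ball vimageI)
  then have "e / 2 > 0" "p (e / 2) \<in> V"
    by (auto simp: subset_iff)
  moreover have "p (e / 2) = y(j := y j - e / 2)"
    by (auto simp: p_def)
  ultimately show ?thesis
    using that by metis
qed

text \<open>The inverse \<open>k\<close> of the homeomorphism pulls \<open>U\<close> back to an open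
  set of Euclidean space, and invariance of domain applies to the composite of \<open>e\<close> and
  \<open>k\<close> there.\<close>

lemma invariance_of_domain_locally_Euclidean:
  assumes hom: "top_of_set C homeomorphic_space Euclidean_space n"
    and U: "openin (top_of_set C) U" and e: "continuous_on U e" "inj_on e U"
    and e_in: "\<And>x i. x \<in> U \<Longrightarrow> i \<ge> n \<Longrightarrow> e x i = 0"
  shows "openin (Euclidean_space n) (e ` U)"
proof -
  define E where "E = {x :: nat \<Rightarrow> real. \<forall>i\<ge>n. x i = 0}"
  obtain h k where "homeomorphic_maps (top_of_set C) (top_of_set E) h k"
    using hom unfolding homeomorphic_space_def Euclidean_space_eq E_def by blast
  then have h: "continuous_on C h" "h ` C \<subseteq> E" and k: "continuous_on E k" "k ` E \<subseteq> C"
    and kh: "\<And>x. x \<in> C \<Longrightarrow> k (h x) = x" and hk: "\<And>y. y \<in> E \<Longrightarrow> h (k y) = y"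
    by (auto simp: homeomorphic_maps_def continuous_map_in_subtopology continuous_map_subtopology_eu)
  have UC: "U \<subseteq> C"
    using U by (rule openin_imp_subset)
  define W where "W = E \<inter> k -` U"
  have W: "openin (top_of_set E) W"
    unfolding W_def using k U by (intro continuous_openin_preimage) auto
  have img: "(e \<circ> k) ` W = e ` U"
  proof
    show "e ` U \<subseteq> (e \<circ> k) ` W"
    proof
      fix z assume "z \<in> e ` U"
      then obtain x where x: "x \<in> U" "z = e x"
        by blast
      then have "h x \<in> W" "k (h x) = x"
        using UC h(2) kh by (auto simp: W_def)
      then show "z \<in> (e \<circ> k) ` W"
        using x by force
    qed
  qed (auto simp: W_def)
  have cont: "continuous_on W (e \<circ> k)"
    by (intro continuous_on_compose continuous_on_subset[OF k(1)] continuous_on_subset[OF e(1)])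
      (auto simp: W_def)
  have inj: "inj_on (e \<circ> k) W"
  proof (rule comp_inj_on)
    show "inj_on k W"
      using hk by (intro inj_on_inverseI[of _ h]) (auto simp: W_def)
    show "inj_on e (k ` W)"
      using e(2) by (rule inj_on_subset) (auto simp: W_def)
  qed
  have "W \<subseteq> E"
    by (auto simp: W_def)
  then have "subtopology (top_of_set E) W = top_of_set W"
    by (simp add: subtopology_subtopology inf.absorb2)
  then have "continuous_map (subtopology (top_of_set E) W) (top_of_set E) (e \<circ> k)"
    using cont e_in by (auto simp: continuous_map_in_subtopology continuous_map_subtopology_eu E_def W_def)
  then have "openin (Euclidean_space n) ((e \<circ> k) ` W)"
    using W inj unfolding E_def Euclidean_space_eq[symmetric]
    by (intro invariance_of_domain_Euclidean_space)
  then show ?thesis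
    unfolding img .
qed

definition coord_list :: "nat \<Rightarrow> (nat \<Rightarrow> 'v) \<Rightarrow> ('v \<Rightarrow> real) \<Rightarrow> nat \<Rightarrow> real" where
  "coord_list n b x = (\<lambda>j. if j < n then x (b j) else 0)"

lemma continuous_on_coord_list: "continuous_on S (coord_list n b)"
  unfolding coord_list_def
proof (rule continuous_on_coordinatewise_then_product)
  show "continuous_on S (\<lambda>x. if j < n then x (b j) else 0)" for j
    by (cases "j < n") (auto intro: continuous_on_subset[OF continuous_on_product_coordinates])
qed

lemma inj_on_coord_list:
  assumes "b ` {..<n} = F" and "\<And>x. x \<in> U \<Longrightarrow> {i. x i \<noteq> 0} \<subseteq> F"
  shows "inj_on (coord_list n b) U"
proof (rule inj_onI)
  fix x y assume x: "x \<in> U" and y: "y \<in> U" and eq: "coord_list n b x = coord_list n b y"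
  show "x = y"
  proof
    fix i
    show "x i = y i"
    proof (cases "i \<in> F")
      case True
      then obtain j where "j < n" "i = b j"
        using assms(1) by blast
      then show ?thesis
        using fun_cong[OF eq, of j] by (simp add: coord_list_def)
    next
      case False
      then have "x i = 0" "y i = 0"
        using assms(2)[OF x] assms(2)[OF y] by blast+
      then show ?thesis
        by simp
    qed
  qed
qed

lemma openin_positive_on:
  fixes S :: "('a \<Rightarrow> real) set"
  assumes "finite R"
  shows "openin (top_of_set S) {x \<in> S. \<forall>i\<in>R. 0 < x i}"
proof -
  have "open {x :: 'a \<Rightarrow> real. \<forall>i\<in>R. x i \<in> {0<..}}"
    by (rule product_topology_basis'[OF assms]) auto
  then show ?thesis
    by (auto simp: openin_open Int_def)
qed

lemma openin_positive_on_Union: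
  fixes S :: "('a \<Rightarrow> real) set"
  shows "openin (top_of_set S) {x \<in> S. \<exists>i\<in>A. 0 < x i}"
proof -
  have "{x \<in> S. \<exists>i\<in>A. 0 < x i} = (\<Union>i\<in>A. {x \<in> S. \<forall>i\<in>{i}. 0 < x i})"
    by auto
  then show ?thesis
    using openin_positive_on[of "{_}" S] by auto
qed

section \<open>Sizes and extensions of faces when the cone is Euclidean\<close>

locale finite_complex =
  fixes D :: "'v set set"
  assumes complex: "is_complex D"
begin

lemma finite_vertices: "finite (vertices D)"
  using complex by (simp add: is_complex_def vertices_def)

lemma subface: "F \<in> D \<Longrightarrow> G \<subseteq> F \<Longrightarrow> G \<in> D"
  using complex by (auto simp: is_complex_def)

lemma face_subset: "F \<in> D \<Longrightarrow> F \<subseteq> vertices D"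
  by (auto simp: vertices_def)

lemma finite_face: "F \<in> D \<Longrightarrow> finite F"
  using face_subset finite_vertices finite_subset by blast

lemma finite_faces: "finite D"
  using finite_subset[of D "Pow (vertices D)"] finite_vertices face_subset by blast

end

locale Euclidean_cone = finite_complex D for D :: "'v set set" +
  fixes d :: nat
  assumes hom: "top_of_set (nonneg_span D) homeomorphic_space Euclidean_space d"
begin

text \<open>A face with \<open>n > d\<close> vertices would put the positive orthant of R^n into the
  cone and thus into R^d, viewed inside R^n. Invariance of domain makes the image open in R^n,
  although its coordinate number \<open>d\<close> (counted from \<open>0\<close>) is constantly
  \<open>0\<close>.\<close>

lemma card_face_le:
  assumes F: "F \<in> D"
  shows "card F \<le> d"
proof (rule ccontr)
  assume "\<not> card F \<le> d"
  define n where "n = card F"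
  have "d < n"
    using \<open>\<not> card F \<le> d\<close> by (simp add: n_def)
  obtain b where b: "bij_betw b F {..<n}"
    using finite_face[OF F] ex_bij_betw_finite_nat unfolding n_def atLeast0LessThan by blast
  obtain h k where "homeomorphic_maps (top_of_set (nonneg_span D)) (Euclidean_space d) h k"
    using hom unfolding homeomorphic_space_def by blast
  then have h: "continuous_on (nonneg_span D) h" and h_in: "\<And>x i. x \<in> nonneg_span D \<Longrightarrow> i \<ge> d \<Longrightarrow> h x i = 0"
    and kh: "\<And>x. x \<in> nonneg_span D \<Longrightarrow> k (h x) = x"
    by (auto simp: homeomorphic_maps_def Euclidean_space_eq continuous_map_in_subtopology continuous_map_subtopology_eu)
  define V where "V = {y :: nat \<Rightarrow> real. (\<forall>i\<ge>n. y i = 0) \<and> (\<forall>i<n. 0 < y i)}"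
  define e where "e = (\<lambda>y i. if i \<in> F then y (b i) else (0::real))"
  have e_in: "e y \<in> nonneg_span D" if "y \<in> V" for y
  proof -
    have "{i. e y i \<noteq> 0} \<subseteq> F"
      by (auto simp: e_def)
    moreover have "0 \<le> e y i" for i
      using that b by (auto simp: e_def V_def bij_betw_def intro!: less_imp_le)
    ultimately show ?thesis
      using subface[OF F] by (auto simp: nonneg_span_def)
  qed
  have "openin (Euclidean_space n) {x \<in> {x. \<forall>i\<ge>n. x i = 0}. \<forall>i\<in>{..<n}. 0 < x i}"
    unfolding Euclidean_space_eq by (rule openin_positive_on) simp
  then have V: "openin (Euclidean_space n) V"
    by (simp add: V_def Ball_def)
  \<comment> \<open>Here R^n itself takes the place of the cone.\<close>
  have "openin (Euclidean_space n) ((h \<circ> e) ` V)"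
  proof (rule invariance_of_domain_locally_Euclidean[of "{x. \<forall>i\<ge>n. x i = 0}"])
    show "top_of_set {x :: nat \<Rightarrow> real. \<forall>i\<ge>n. x i = 0} homeomorphic_space Euclidean_space n"
      by (simp add: Euclidean_space_eq)
    show "openin (top_of_set {x. \<forall>i\<ge>n. x i = 0}) V"
      using V by (simp add: Euclidean_space_eq)
    show "continuous_on V (h \<circ> e)"
    proof (rule continuous_on_compose)
      show "continuous_on V e"
      proof (rule continuous_on_coordinatewise_then_product)
        show "continuous_on V (\<lambda>x. e x i)" for i
          by (cases "i \<in> F")
            (auto simp: e_def intro: continuous_on_subset[OF continuous_on_product_coordinates])
      qed
      show "continuous_on (e ` V) h"
        using e_in by (intro continuous_on_subset[OF h]) auto
    qed
    show "inj_on (h \<circ> e) V"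
    proof (rule comp_inj_on)
      show "inj_on e V"
      proof (rule inj_onI)
        fix y z assume yz: "y \<in> V" "z \<in> V" "e y = e z"
        have "y j = z j" if "j < n" for j
        proof -
          have "j \<in> b ` F"
            using b that by (simp add: bij_betw_def)
          then obtain i where "i \<in> F" "b i = j"
            by blast
          then show ?thesis
            using fun_cong[OF yz(3), of i] by (simp add: e_def)
        qed
        moreover have "y j = z j" if "\<not> j < n" for j
          using yz(1,2) that by (simp add: V_def)
        ultimately show "y = z"
          by blast
      qed
      show "inj_on h (e ` V)"
        using kh e_in by (intro inj_on_inverseI[of _ k]) auto
    qed
    show "(h \<circ> e) x i = 0" if "x \<in> V" "i \<ge> n" for x i
      using that h_in[OF e_in] \<open>d < n\<close> by auto
  qed
  moreover define y0 :: "nat \<Rightarrow> real" where "y0 = (\<lambda>i. if i < n then 1 else 0)"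
  then have y0: "y0 \<in> V"
    by (simp add: V_def)
  ultimately obtain t where t: "t > 0" "(h (e y0))(d := h (e y0) d - t) \<in> (h \<circ> e) ` V"
    using openin_Euclidean_space_perturb[of n "(h \<circ> e) ` V" "h (e y0)" d] \<open>d < n\<close> by auto
  then obtain y where y: "y \<in> V" "(h (e y0))(d := h (e y0) d - t) = h (e y)"
    by auto
  then have "h (e y) d = h (e y0) d - t"
    by (metis fun_upd_same)
  then show False
    using h_in[OF e_in[OF y0], of d] h_in[OF e_in[OF y(1)], of d] t(1) by simp
qed

text \<open>If the faces around \<open>R\<close> have all their vertices in \<open>R \<union> {u}\<close>, then
  near the relative interior of \<open>R\<close> the cone embeds into Euclidean space with an image that
  contains a point with coordinate \<open>0\<close> in a direction in which no negative value is attained.\<close>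

lemma ex_face_insert:
  assumes "R \<in> D" "card R < d" "u \<notin> R"
  obtains w where "w \<notin> R" "w \<noteq> u" "insert w R \<in> D"
proof -
  have False if none: "\<And>w. w \<notin> R \<Longrightarrow> w \<noteq> u \<Longrightarrow> insert w R \<notin> D"
  proof -
    define F where "F = insert u R"
    define m where "m = card R"
    have fin: "finite R"
      using finite_face assms(1) by blast
    obtain b0 where b0: "bij_betw b0 {..<m} R"
      using ex_bij_betw_nat_finite[OF fin] unfolding m_def atLeast0LessThan by blast
    \<comment> \<open>The coordinates below \<open>m\<close> belong to \<open>R\<close>, and
      coordinate \<open>m\<close> is the direction of \<open>u\<close>; because
      \<open>m < d\<close>, this direction is available in R^d.\<close>
    define b where "b = (\<lambda>j. if j < m then b0 j else u)"
    have img: "b ` {..<Suc m} = F"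
      using b0 by (auto simp: lessThan_Suc F_def b_def bij_betw_def)
    define U where "U = {x \<in> nonneg_span D. \<forall>i\<in>R. 0 < x i}"
    have U: "openin (top_of_set (nonneg_span D)) U"
      unfolding U_def by (rule openin_positive_on[OF fin])
    have supp: "{i. x i \<noteq> 0} \<subseteq> F" if "x \<in> U" for x
    proof
      fix w assume w: "w \<in> {i. x i \<noteq> 0}"
      have "{i. x i \<noteq> 0} \<in> D" "R \<subseteq> {i. x i \<noteq> 0}"
        using that by (auto simp: U_def nonneg_span_def)
      then have "insert w R \<in> D"
        using w subface by (metis insert_subset)
      then show "w \<in> F"
        using none by (auto simp: F_def)
    qed
    have m: "m < d"
      using assms by (simp add: m_def)
    have op: "openin (Euclidean_space d) (coord_list (Suc m) b ` U)"
    proof (rule invariance_of_domain_locally_Euclidean[OF hom U continuous_on_coord_list])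
      show "inj_on (coord_list (Suc m) b) U"
        using img supp by (rule inj_on_coord_list)
      show "coord_list (Suc m) b x i = 0" if "d \<le> i" for x i
        using that m by (simp add: coord_list_def)
    qed
    define x0 where "x0 = (\<lambda>i. if i \<in> R then 1 else 0 :: real)"
    have "x0 \<in> U"
      using assms(1) by (auto simp: x0_def U_def nonneg_span_def)
    then obtain t where t: "t > 0"
        "(coord_list (Suc m) b x0)(m := coord_list (Suc m) b x0 m - t) \<in> coord_list (Suc m) b ` U"
      using openin_Euclidean_space_perturb[OF op _ m] by blast
    then obtain x where "x \<in> U" "coord_list (Suc m) b x m = coord_list (Suc m) b x0 m - t"
      by (metis fun_upd_same imageE)
    then have "x u = - t"
      using assms(3) by (simp add: coord_list_def b_def x0_def)
    moreover have "x u \<ge> 0"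
      using \<open>x \<in> U\<close> by (simp add: U_def nonneg_span_def)
    ultimately show False
      using t by simp
  qed
  then show ?thesis
    using that by blast
qed

end

section \<open>Connectedness of vertex graphs\<close>

definition adj :: "'v set set \<Rightarrow> 'v set \<Rightarrow> ('v \<times> 'v) set" where
  "adj D A = {(a, b). a \<in> A \<and> b \<in> A \<and> {a, b} \<in> D}"

definition graph_connected :: "'v set set \<Rightarrow> 'v set \<Rightarrow> bool" where
  "graph_connected D A \<longleftrightarrow> (\<forall>a\<in>A. \<forall>b\<in>A. (a, b) \<in> (adj D A)\<^sup>*)"

lemma graph_connectedI:
  assumes "\<And>B. B \<subseteq> A \<Longrightarrow> B \<noteq> {} \<Longrightarrow> B \<noteq> A \<Longrightarrow> \<exists>a\<in>B. \<exists>b\<in>A - B. {a, b} \<in> D"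
  shows "graph_connected D A"
  unfolding graph_connected_def
proof (intro ballI)
  fix a b assume a: "a \<in> A" and b: "b \<in> A"
  define B where "B = {x \<in> A. (a, x) \<in> (adj D A)\<^sup>*}"
  have "B = A"
  proof (rule ccontr)
    assume "B \<noteq> A"
    moreover have "B \<subseteq> A" "B \<noteq> {}"
      using a by (auto simp: B_def)
    ultimately obtain x y where "x \<in> B" "y \<in> A - B" "{x, y} \<in> D"
      using assms[of B] by blast
    then have "(a, x) \<in> (adj D A)\<^sup>*" "(x, y) \<in> adj D A" "y \<notin> B" "y \<in> A"
      by (auto simp: B_def adj_def)
    then show False
      unfolding B_def by (auto intro: rtrancl.rtrancl_into_rtrancl)
  qed
  then show "(a, b) \<in> (adj D A)\<^sup>*"
    using b by (auto simp: B_def)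
qed

text \<open>A partition of \<open>A\<close> without edges between its parts yields a separation of \<open>S\<close>, since
  the support of a point is a face.\<close>

lemma graph_connected_if_connected:
  assumes D: "is_complex D" and S: "S \<subseteq> nonneg_span D" "connected S"
    and meets: "\<And>x. x \<in> S \<Longrightarrow> \<exists>i\<in>A. 0 < x i"
    and vertex: "\<And>a. a \<in> A \<Longrightarrow> (\<lambda>i. if i = a then 1 else 0) \<in> S"
  shows "graph_connected D A"
proof (rule graph_connectedI, rule ccontr)
  fix B assume B: "B \<subseteq> A" "B \<noteq> {}" "B \<noteq> A" and no: "\<not> (\<exists>a\<in>B. \<exists>b\<in>A - B. {a, b} \<in> D)"
  define P where "P = {x \<in> S. \<exists>i\<in>B. 0 < x i}"
  define Q where "Q = {x \<in> S. \<exists>i\<in>A - B. 0 < x i}"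
  have "openin (top_of_set S) P" "openin (top_of_set S) Q"
    unfolding P_def Q_def by (rule openin_positive_on_Union)+
  moreover have "S \<subseteq> P \<union> Q"
    using meets by (auto simp: P_def Q_def)
  moreover have "P \<inter> Q = {}"
  proof (rule ccontr)
    assume "P \<inter> Q \<noteq> {}"
    then obtain x a b where x: "x \<in> S" "a \<in> B" "b \<in> A - B" "0 < x a" "0 < x b"
      by (auto simp: P_def Q_def)
    then have "{i. x i \<noteq> 0} \<in> D"
      using S(1) by (auto simp: nonneg_span_def)
    moreover have "{a, b} \<subseteq> {i. x i \<noteq> 0}"
      using x by auto
    ultimately have "{a, b} \<in> D"
      using D by (auto simp: is_complex_def)
    then show False
      using no x by blast
  qed
  moreover have "P \<noteq> {}" "Q \<noteq> {}"
  proof -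
    obtain a b where ab: "a \<in> B" "b \<in> A - B"
      using B by blast
    then have "(\<lambda>i. if i = a then 1 else 0) \<in> P"
      using vertex[of a] B(1) by (auto simp: P_def)
    moreover have "(\<lambda>i. if i = b then 1 else 0) \<in> Q"
      using vertex[of b] ab by (auto simp: Q_def)
    ultimately show "P \<noteq> {}" "Q \<noteq> {}"
      by blast+
  qed
  ultimately show False
    using S(2) unfolding connected_openin by blast
qed

lemma vertex_in_nonneg_span:
  assumes "is_complex D" "a \<in> vertices D"
  shows "(\<lambda>i. if i = a then 1 else 0) \<in> nonneg_span D"
proof -
  obtain F where "F \<in> D" "a \<in> F"
    using assms(2) by (auto simp: vertices_def)
  then have "{a} \<in> D"
    using assms(1) by (auto simp: is_complex_def)
  then show ?thesis
    by (auto simp: nonneg_span_def)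
qed

lemma graph_connected_vertices:
  assumes "is_complex D" "connected_space (realization D)"
  shows "graph_connected D (vertices D)"
proof (rule graph_connected_if_connected[OF assms(1)])
  have fin: "finite (vertices D)"
    using assms(1) by (simp add: is_complex_def vertices_def)
  show "{x \<in> nonneg_span D. sum x (vertices D) = 1} \<subseteq> nonneg_span D"
    by blast
  show "connected {x \<in> nonneg_span D. sum x (vertices D) = 1}"
    using assms(2) unfolding realization_eq by (simp add: connectedin_def flip: connectedin_iff_connected)
  show "\<exists>i\<in>vertices D. 0 < x i" if "x \<in> {x \<in> nonneg_span D. sum x (vertices D) = 1}" for x
  proof (rule ccontr)
    assume "\<not> ?thesis"
    then have "sum x (vertices D) \<le> 0"
      by (intro sum_nonpos) (auto simp: not_less)
    then show False
      using that by simp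
  qed
  show "(\<lambda>i. if i = a then 1 else 0) \<in> {x \<in> nonneg_span D. sum x (vertices D) = 1}"
    if "a \<in> vertices D" for a
    using vertex_in_nonneg_span[OF assms(1) that] that fin by simp
qed

text \<open>The set is star-shaped about the point \<open>p\<close> with coordinates
  \<open>-1\<close>: on the segment to \<open>p\<close> a negative coordinate stays negative. For
  \<open>n = 0\<close> the set is empty.\<close>

lemma connected_Euclidean_minus_orthant:
  "connected ({x :: nat \<Rightarrow> real. \<forall>i\<ge>n. x i = 0} - {x. \<forall>i. 0 \<le> x i})" (is "connected ?X")
proof -
  define p :: "nat \<Rightarrow> real" where "p = (\<lambda>i. if i < n then - 1 else 0)"
  define g where "g = (\<lambda>y t i. (1 - t) * y i + t * p i)"
  have cont: "continuous_on {0..1} (g y)" for y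
  proof (rule continuous_on_coordinatewise_then_product)
    show "continuous_on {0..1} (\<lambda>t. g y t i)" for i
      unfolding g_def by (intro continuous_on_add continuous_on_mult continuous_on_diff
          continuous_on_const continuous_on_id)
  qed
  have sub: "g y ` {0..1} \<subseteq> ?X" if y: "y \<in> ?X" for y
  proof
    fix z assume "z \<in> g y ` {0..1}"
    then obtain t where t: "0 \<le> t" "t \<le> 1" and z: "z = g y t"
      by auto
    obtain i where i: "y i < 0"
      using y by (auto simp: not_le)
    have "i < n"
      using i y by (metis (mono_tags) DiffD1 less_irrefl mem_Collect_eq not_le)
    then have zi: "z i = (1 - t) * y i - t"
      by (simp add: z g_def p_def)
    have "z i < 0"
    proof (cases "t = 0")
      case False
      have "(1 - t) * y i \<le> 0"
        using t i by (intro mult_nonneg_nonpos) auto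
      then show ?thesis
        using False t zi by simp
    qed (use i zi in simp)
    moreover have "\<forall>i\<ge>n. z i = 0"
      using y by (simp add: z g_def p_def)
    ultimately show "z \<in> ?X"
      using not_le by blast
  qed
  have "?X = (\<Union>y\<in>?X. g y ` {0..1})"
  proof
    show "?X \<subseteq> (\<Union>y\<in>?X. g y ` {0..1})"
    proof
      fix y assume "y \<in> ?X"
      moreover have "g y 0 = y"
        by (simp add: g_def)
      then have "y \<in> g y ` {0..1}"
        by (metis atLeastAtMost_iff imageI order_refl zero_le_one)
      ultimately show "y \<in> (\<Union>y\<in>?X. g y ` {0..1})"
        by blast
    qed
  qed (use sub in blast)
  moreover have "connected (\<Union>((\<lambda>y. g y ` {0..1}) ` ?X))"
  proof (rule connected_Union)
    show "connected s" if "s \<in> (\<lambda>y. g y ` {0..1}) ` ?X" for s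
      using that connected_continuous_image[OF cont] by auto
    have "g y 1 = p" for y
      by (simp add: g_def)
    then have "p \<in> g y ` {0..1}" for y
      by (metis atLeastAtMost_iff imageI order_refl zero_le_one)
    then show "\<Inter>((\<lambda>y. g y ` {0..1}) ` ?X) \<noteq> {}"
      by blast
  qed
  ultimately show ?thesis
    by simp
qed

lemma closed_vanishing: "closed {x :: 'a \<Rightarrow> real. \<forall>i. P i \<longrightarrow> x i = 0}"
proof -
  have "closed {x :: 'a \<Rightarrow> real. x i = 0}" for i
    by (intro closed_Collect_eq continuous_on_product_coordinates continuous_on_const)
  then have "closed {x :: 'a \<Rightarrow> real. P i \<longrightarrow> x i = 0}" for i
    by (cases "P i") auto
  then show ?thesis
    by (rule closed_Collect_all)
qed

lemma closed_nonneg: "closed {x :: 'a \<Rightarrow> real. \<forall>i. 0 \<le> x i}"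
  by (intro closed_Collect_all closed_Collect_le continuous_on_product_coordinates continuous_on_const)

context Euclidean_cone
begin

lemma homeomorphic_orthant:
  assumes F: "F \<in> D" "card F = d"
  shows "top_of_set ({x :: nat \<Rightarrow> real. \<forall>i\<ge>d. x i = 0} \<inter> {x. \<forall>i. 0 \<le> x i}) homeomorphic_space
         top_of_set {x \<in> nonneg_span D. \<forall>i. i \<notin> F \<longrightarrow> x i = 0}"
    (is "top_of_set ?T homeomorphic_space top_of_set ?O")
proof -
  obtain b where b: "bij_betw b {..<d} F"
    using ex_bij_betw_nat_finite[OF finite_face[OF F(1)]] F(2) unfolding atLeast0LessThan by blast
  define c where "c = inv_into {..<d} b"
  have bc: "b (c i) = i" "c i < d" if "i \<in> F" for i
    using b that bij_betw_inv_into_right[OF b] bij_betwE[OF bij_betw_inv_into[OF b]]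
    by (auto simp: c_def)
  have cb: "c (b j) = j" "b j \<in> F" if "j < d" for j
    using that b bij_betw_inv_into_left[OF b] by (auto simp: c_def bij_betw_def)
  define e where "e = (\<lambda>(y :: nat \<Rightarrow> real) i. if i \<in> F then y (c i) else 0)"
  have cont: "continuous_on S e" for S
  proof (rule continuous_on_coordinatewise_then_product)
    show "continuous_on S (\<lambda>x. e x i)" for i
      by (cases "i \<in> F")
        (auto simp: e_def intro: continuous_on_subset[OF continuous_on_product_coordinates])
  qed
  have e_in: "e y \<in> ?O" if "y \<in> ?T" for y
  proof -
    have "{i. e y i \<noteq> 0} \<subseteq> F"
      by (auto simp: e_def)
    then have "{i. e y i \<noteq> 0} \<in> D"
      using subface[OF F(1)] by blast
    then show ?thesis
      using that by (auto simp: nonneg_span_def e_def)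
  qed
  have c_in: "coord_list d b x \<in> ?T" if "x \<in> ?O" for x
    using that by (auto simp: coord_list_def nonneg_span_def)
  have ec: "e (coord_list d b x) = x" if "x \<in> ?O" for x
    using that bc by (auto simp: e_def coord_list_def)
  have ce: "coord_list d b (e y) = y" if "y \<in> ?T" for y
    using that cb by (auto simp: e_def coord_list_def)
  have "homeomorphic_maps (top_of_set ?T) (top_of_set ?O) e (coord_list d b)"
    unfolding homeomorphic_maps_def continuous_map_in_subtopology continuous_map_subtopology_eu
    using cont continuous_on_coord_list e_in c_in ec ce by auto
  then show ?thesis
    unfolding homeomorphic_space_def by blast
qed

text \<open>The homeomorphism \<open>h\<close> may embed the orthant \<open>P\<close> of
  \<open>F\<close> wildly into R^d, so its complement is not examined directly. Since
  \<open>F\<close> has \<open>d\<close> vertices, \<open>P\<close> is homeomorphic to the standard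
  orthant \<open>T\<close>, and \<open>connected_in_Euclidean_complements\<close> compares the two
  complements. A point of the cone is off \<open>P\<close> exactly if it is positive at a vertex off
  \<open>F\<close>, which leads back to the graph.\<close>

lemma graph_connected_minus_facet:
  assumes F: "F \<in> D" "card F = d"
  shows "graph_connected D (vertices D - F)"
proof (rule graph_connected_if_connected[OF complex])
  define E where "E = {x :: nat \<Rightarrow> real. \<forall>i\<ge>d. x i = 0}"
  define T where "T = E \<inter> {x. \<forall>i. 0 \<le> x i}"
  define P where "P = {x \<in> nonneg_span D. \<forall>i. i \<notin> F \<longrightarrow> x i = 0}"
  have T: "closedin (top_of_set E) T"
    unfolding T_def by (rule closedin_closed_Int[OF closed_nonneg])
  have "closedin (top_of_set (nonneg_span D)) (nonneg_span D \<inter> {x. \<forall>i. i \<notin> F \<longrightarrow> x i = 0})"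
    by (rule closedin_closed_Int[OF closed_vanishing])
  moreover have "P = nonneg_span D \<inter> {x. \<forall>i. i \<notin> F \<longrightarrow> x i = 0}"
    by (auto simp: P_def)
  ultimately have P: "closedin (top_of_set (nonneg_span D)) P"
    by simp
  obtain h k where "homeomorphic_maps (top_of_set (nonneg_span D)) (top_of_set E) h k"
    using hom unfolding homeomorphic_space_def Euclidean_space_eq E_def by blast
  then have h: "continuous_on (nonneg_span D) h" "h ` nonneg_span D \<subseteq> E"
    and k: "continuous_on E k" "k ` E \<subseteq> nonneg_span D"
    and kh: "\<And>x. x \<in> nonneg_span D \<Longrightarrow> k (h x) = x" and hk: "\<And>y. y \<in> E \<Longrightarrow> h (k y) = y"
    by (auto simp: homeomorphic_maps_def continuous_map_in_subtopology continuous_map_subtopology_eu)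
  have PC: "P \<subseteq> nonneg_span D"
    by (auto simp: P_def)
  have hP: "h ` P = E \<inter> k -` P"
  proof
    show "h ` P \<subseteq> E \<inter> k -` P"
      using PC h(2) kh by (auto simp: subset_iff image_iff)
    show "E \<inter> k -` P \<subseteq> h ` P"
      using hk by (metis IntE image_eqI subsetI vimageE)
  qed
  have "closedin (top_of_set E) (h ` P)"
    unfolding hP by (rule continuous_closedin_preimage_gen[OF k(1) _ P]) (use k(2) in auto)
  moreover have "homeomorphic_maps (top_of_set P) (top_of_set (h ` P)) h k"
    unfolding homeomorphic_maps_def continuous_map_in_subtopology continuous_map_subtopology_eu
    using continuous_on_subset[OF h(1) PC] continuous_on_subset[OF k(1), of "h ` P"] hP kh hk PC
    by auto
  then have "top_of_set P homeomorphic_space top_of_set (h ` P)"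
    unfolding homeomorphic_space_def by blast
  then have "top_of_set T homeomorphic_space top_of_set (h ` P)"
    unfolding T_def E_def P_def by (rule homeomorphic_space_trans[OF homeomorphic_orthant[OF F]])
  moreover have "T \<subseteq> E" "h ` P \<subseteq> E"
    using hP by (auto simp: T_def)
  ultimately have "connectedin (top_of_set E) (topspace (top_of_set E) - T) \<longleftrightarrow>
      connectedin (top_of_set E) (topspace (top_of_set E) - h ` P)"
    using T unfolding E_def Euclidean_space_eq[symmetric]
    by (intro connected_in_Euclidean_complements)
      (auto simp: Euclidean_space_eq subtopology_subtopology inf.absorb2)
  moreover have "E - T = E - {x. \<forall>i. 0 \<le> x i}"
    by (auto simp: T_def)
  ultimately have "connected (E - h ` P)"
    using connected_Euclidean_minus_orthant[of d] unfolding E_def[symmetric]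
    by (auto simp: connectedin_subtopology)
  then have "connected (k ` (E - h ` P))"
    using k(1) by (intro connected_continuous_image) (auto intro: continuous_on_subset)
  moreover have "k ` (E - h ` P) = nonneg_span D - P"
  proof
    show "k ` (E - h ` P) \<subseteq> nonneg_span D - P"
      using k(2) hP by auto
    show "nonneg_span D - P \<subseteq> k ` (E - h ` P)"
    proof
      fix x assume x: "x \<in> nonneg_span D - P"
      then have "h x \<in> E - h ` P" "k (h x) = x"
        using h(2) kh hP by auto
      then show "x \<in> k ` (E - h ` P)"
        by (metis imageI)
    qed
  qed
  ultimately show "connected (nonneg_span D - P)"
    by simp
  show "nonneg_span D - P \<subseteq> nonneg_span D"
    by blast
  show "\<exists>i\<in>vertices D - F. 0 < x i" if x: "x \<in> nonneg_span D - P" for x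
  proof -
    obtain i where i: "i \<notin> F" "x i \<noteq> 0"
      using x by (auto simp: P_def)
    have "0 \<le> x i" "{i. x i \<noteq> 0} \<in> D"
      using x by (auto simp: nonneg_span_def)
    then have "i \<in> vertices D" "0 < x i"
      using i by (auto simp: vertices_def order_le_less intro!: bexI[of _ "{i. x i \<noteq> 0}"])
    then show ?thesis
      using i by blast
  qed
  show "(\<lambda>i. if i = a then 1 else 0) \<in> nonneg_span D - P" if "a \<in> vertices D - F" for a
    using vertex_in_nonneg_span[OF complex, of a] that by (auto simp: P_def)
qed

end

section \<open>Reachability and parity in graphs\<close>

lemma graph_connectedD:
  assumes "graph_connected D A" "B \<subseteq> A" "a \<in> B" "b \<in> A - B"
  shows "\<exists>x\<in>B. \<exists>y\<in>A - B. {x, y} \<in> D"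
proof (rule ccontr)
  assume no: "\<not> ?thesis"
  have "(a, b) \<in> (adj D A)\<^sup>*"
    using assms unfolding graph_connected_def by blast
  then have "b \<in> B"
  proof (induction rule: rtrancl_induct)
    case base
    then show ?case
      using assms(3) .
  next
    case (step y z)
    then show ?case
      using no by (auto simp: adj_def)
  qed
  then show False
    using assms(4) by blast
qed

lemma sym_adj: "sym (adj D A)"
  by (auto simp: adj_def sym_def insert_commute)

text \<open>\<open>strongly_connected_map\<close> asks for lists. Reachability of the entries from
  \<open>a\<close> is recorded because it carries invariants, such as membership in a fibre, over to
  them.\<close>

lemma rtrancl_imp_path:
  assumes "(a, b) \<in> r\<^sup>*"
  shows "\<exists>xs. xs \<noteq> [] \<and> hd xs = a \<and> last xs = b \<and> (\<forall>x\<in>set xs. (a, x) \<in> r\<^sup>*) \<and>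
     (\<forall>i. Suc i < length xs \<longrightarrow> (xs ! i, xs ! Suc i) \<in> r)"
  using assms
proof (induction rule: rtrancl_induct)
  case base
  show ?case
    by (rule exI[of _ "[a]"]) simp
next
  case (step y z)
  then obtain xs where xs: "xs \<noteq> []" "hd xs = a" "last xs = y" "\<forall>x\<in>set xs. (a, x) \<in> r\<^sup>*"
      "\<forall>i. Suc i < length xs \<longrightarrow> (xs ! i, xs ! Suc i) \<in> r"
    by blast
  have "((xs @ [z]) ! i, (xs @ [z]) ! Suc i) \<in> r" if i: "Suc i < length (xs @ [z])" for i
  proof (cases "Suc i < length xs")
    case True
    then show ?thesis
      using xs(5) by (simp add: nth_append)
  next
    case False
    then have "i = length xs - 1" "i < length xs"
      using i xs(1) by auto
    then have "(xs @ [z]) ! i = y" "(xs @ [z]) ! Suc i = z"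
      using xs(1,3) False by (auto simp: nth_append last_conv_nth less_Suc_eq)
    then show ?thesis
      using step(2) by simp
  qed
  moreover have "(a, z) \<in> r\<^sup>*"
    using step(1,2) by (rule rtrancl.rtrancl_into_rtrancl)
  ultimately show ?case
    using xs by (intro exI[of _ "xs @ [z]"]) auto
qed

text \<open>The pairs \<open>(x, y)\<close> and \<open>(y, x)\<close> are removed together;
  irreflexivity makes them distinct. This is the parity behind the handshaking argument for
  \<open>d = 1\<close>.\<close>

lemma even_card_symmetric_relation:
  assumes "finite P" "sym P" "irrefl P"
  shows "even (card P)"
  using assms
proof (induction P rule: finite_psubset_induct)
  case (psubset P)
  show ?case
  proof (cases "P = {}")
    case False
    then obtain x y where xy: "(x, y) \<in> P"
      by auto
    then have yx: "(y, x) \<in> P" "x \<noteq> y"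
      using psubset.prems by (auto simp: sym_def irrefl_def)
    define Q where "Q = P - {(x, y), (y, x)}"
    have "Q \<subset> P" "sym Q" "irrefl Q"
      using xy psubset.prems by (auto simp: Q_def sym_def irrefl_def)
    then have "even (card Q)"
      using psubset.IH by blast
    moreover have "P = Q \<union> {(x, y), (y, x)}" "Q \<inter> {(x, y), (y, x)} = {}" "finite Q"
      using xy yx psubset.hyps by (auto simp: Q_def)
    then have "card P = card Q + card {(x, y), (y, x)}"
      by (metis card_Un_disjoint finite.emptyI finite.insertI)
    ultimately show ?thesis
      using yx(2) by simp
  qed simp
qed

section \<open>Links and facets in a combinatorial manifold\<close>

lemma is_complex_link: "is_complex D \<Longrightarrow> is_complex (link D i)"
  unfolding is_complex_def link_def
  by (auto intro: finite_subset[of _ "\<Union>D"]) (meson insert_mono)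

lemma vertices_link:
  assumes "is_complex D"
  shows "vertices (link D i) = {v. v \<noteq> i \<and> {i, v} \<in> D}"
proof -
  have "\<exists>F\<in>link D i. v \<in> F" if "v \<noteq> i" "{i, v} \<in> D" for v
    using that assms by (intro bexI[of _ "{v}"]) (auto simp: link_def is_complex_def)
  moreover have "{i, v} \<in> D" if "F \<in> link D i" "v \<in> F" for v F
  proof -
    have "insert i F \<in> D" "{i, v} \<subseteq> insert i F"
      using that by (auto simp: link_def)
    then show ?thesis
      using assms unfolding is_complex_def by blast
  qed
  ultimately show ?thesis
    by (auto simp: vertices_def link_def)
qed

lemma Euclidean_cone_link:
  assumes "d \<ge> 1" "combinatorial_manifold d D" "i \<in> vertices D"
  shows "Euclidean_cone (link D i) d"
proof
  show "is_complex (link D i)"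
    using assms(2) is_complex_link by (auto simp: combinatorial_manifold_def)
  then show "top_of_set (nonneg_span (link D i)) homeomorphic_space Euclidean_space d"
    using assms by (intro nonneg_span_homeomorphic_Euclidean_space) (auto simp: combinatorial_manifold_def)
qed

locale spherical_links = finite_complex D for D :: "'v set set" +
  fixes d :: nat
  assumes d: "d \<ge> 1"
    and links: "\<And>i. i \<in> vertices D \<Longrightarrow> Euclidean_cone (link D i) d"
    and connected: "graph_connected D (vertices D)" and nonempty: "vertices D \<noteq> {}"
begin

lemma face_minus_link:
  assumes "F \<in> D" "i \<in> F"
  shows "F - {i} \<in> link D i" "i \<in> vertices D" "card (F - {i}) = card F - 1" "card F \<ge> 1"
proof -
  show "F - {i} \<in> link D i"
    using assms subface[OF assms(1), of "F - {i}"] by (simp add: link_def insert_absorb)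
  show "i \<in> vertices D" "card (F - {i}) = card F - 1" "card F \<ge> 1"
    using assms face_subset finite_face[OF assms(1)] by (auto simp: Suc_le_eq card_gt_0_iff)
qed

lemma card_face_le:
  assumes F: "F \<in> D"
  shows "card F \<le> d + 1"
proof (cases "F = {}")
  case False
  then obtain i where "i \<in> F"
    by blast
  from face_minus_link[OF F this] show ?thesis
    using Euclidean_cone.card_face_le[OF links, of i "F - {i}"] by simp
qed simp

text \<open>The vertex \<open>i\<close> gives access to a link, in which \<open>F - {i}\<close> has
  fewer than \<open>d\<close> vertices. The direction \<open>u\<close> is to be avoided; the choice
  \<open>u = i\<close> avoids nothing, since \<open>i\<close> is not a vertex of its own
  link.\<close>

lemma ex_face_insert:
  assumes F: "F \<in> D" "i \<in> F" "card F \<le> d" "u \<notin> F - {i}"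
  obtains w where "w \<notin> F" "w \<noteq> u" "insert w F \<in> D"
proof -
  note l = face_minus_link[OF F(1,2)]
  obtain w where w: "w \<notin> F - {i}" "w \<noteq> u" "insert w (F - {i}) \<in> link D i"
  proof (rule Euclidean_cone.ex_face_insert[OF links[OF l(2)] l(1) _ F(4)])
    show "card (F - {i}) < d"
      using l(3,4) F(3) by linarith
  qed
  have "w \<noteq> i"
    using w(3) by (auto simp: link_def)
  moreover have "insert w F = insert i (insert w (F - {i}))"
    using F(2) by auto
  then have "insert w F \<in> D"
    using w(3) by (simp add: link_def)
  ultimately show ?thesis
    using that w by blast
qed

lemma ex_facet: "\<exists>F\<in>D. card F = d + 1"
proof -
  obtain v where "v \<in> vertices D"
    using nonempty by blast
  then obtain G where G: "G \<in> D" "v \<in> G"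
    by (auto simp: vertices_def)
  have "Max (card ` D) \<in> card ` D"
    using finite_faces G(1) by (intro Max_in) auto
  then obtain F where F: "F \<in> D" "card F = Max (card ` D)"
    by auto
  then have F: "F \<in> D" "\<And>G. G \<in> D \<Longrightarrow> card G \<le> card F"
    using finite_faces by auto
  have "card F \<noteq> 0"
    using F(2)[OF G(1)] G(2) card_gt_0_iff[of G] finite_face[OF G(1)] by auto
  then obtain i where i: "i \<in> F"
    by fastforce
  have "card F = d + 1"
  proof (rule ccontr)
    assume "card F \<noteq> d + 1"
    then have "card F \<le> d"
      using card_face_le[OF F(1)] by simp
    then obtain w where "w \<notin> F" "insert w F \<in> D"
      using ex_face_insert[OF F(1) i, of i] by auto
    then show False
      using F(2)[of "insert w F"] finite_face[OF F(1)] by simp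
  qed
  then show ?thesis
    using F(1) by blast
qed

text \<open>The ridge \<open>F - {u}\<close> is nonempty because \<open>d >= 1\<close>, so it can be
  extended in the link of one of its vertices. Excluding \<open>u\<close> gives the vertex on the
  other side of the ridge.\<close>

lemma ex_adjacent_facet:
  assumes F: "F \<in> D" "card F = d + 1" and u: "u \<in> F"
  obtains w where "w \<notin> F" "insert w (F - {u}) \<in> D"
proof -
  have card: "card (F - {u}) = d"
    using F(2) u finite_face[OF F(1)] by simp
  then have "F - {u} \<noteq> {}"
    using d by (metis card.empty not_one_le_zero)
  then obtain i where i: "i \<in> F - {u}"
    by blast
  obtain w where "w \<notin> F - {u}" "w \<noteq> u" "insert w (F - {u}) \<in> D"
    using ex_face_insert[OF subface[OF F(1)] i, of u] card by auto
  then show ?thesis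
    using that by blast
qed

lemma link_graph_connected:
  assumes F: "F \<in> D" "card F = d + 1" and u: "u \<in> F"
  shows "graph_connected (link D u) (vertices (link D u) - F)"
proof -
  note l = face_minus_link[OF F(1) u]
  have "graph_connected (link D u) (vertices (link D u) - (F - {u}))"
    using Euclidean_cone.graph_connected_minus_facet[OF links[OF l(2)] l(1)] l(3) F(2) by simp
  moreover have "vertices (link D u) - (F - {u}) = vertices (link D u) - F"
    by (auto simp: vertices_link[OF complex])
  ultimately show ?thesis
    by simp
qed

text \<open>\<open>x\<close> and \<open>y\<close> are two extensions of the empty face of the link.
  Off \<open>x\<close> the link is still connected, so a third vertex would be joined there to
  another one, giving a face with two vertices where at most \<open>d = 1\<close> are
  possible.\<close>

lemma two_neighbors:
  assumes "d = 1" "v \<in> vertices D"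
  obtains x y where "x \<noteq> y" "vertices (link D v) = {x, y}"
proof -
  interpret L: Euclidean_cone "link D v" d
    using assms(2) by (rule links)
  have "{v} \<in> D"
    using assms(2) subface by (auto simp: vertices_def)
  then have "{} \<in> link D v"
    using subface[of "{v}" "{}"] by (simp add: link_def)
  then obtain x where x: "insert x {} \<in> link D v"
    using L.ex_face_insert[of "{}" v] assms(1) by auto
  obtain y where y: "y \<noteq> x" "insert y {} \<in> link D v"
    using L.ex_face_insert[OF \<open>{} \<in> link D v\<close>, of x] assms(1) by auto
  have con: "graph_connected (link D v) (vertices (link D v) - {x})"
    using x assms(1) by (intro L.graph_connected_minus_facet) auto
  have "z = y" if "z \<in> vertices (link D v)" "z \<noteq> x" for z
  proof (rule ccontr)
    assume zy: "z \<noteq> y"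
    have "y \<in> vertices (link D v)"
      using y by (auto simp: vertices_def)
    then have "\<exists>a\<in>{z}. \<exists>b\<in>vertices (link D v) - {x} - {z}. {a, b} \<in> link D v"
      using that zy y(1) by (intro graph_connectedD[OF con, of "{z}" z y]) auto
    then obtain a b where "a \<in> {z}" "b \<in> vertices (link D v) - {x} - {z}" "{a, b} \<in> link D v"
      by blast
    then show False
      using L.card_face_le[of "{a, b}"] assms(1) by auto
  qed
  moreover have "{x, y} \<subseteq> vertices (link D v)"
    using x y by (auto simp: vertices_def)
  ultimately have "vertices (link D v) = {x, y}"
    by auto
  then show ?thesis
    using that y(1) by metis
qed

end

section \<open>The map to the simplicial sphere\<close>

context spherical_links
begin

lemma neighbors_outside_facet_connected:
  assumes F: "F \<in> D" "card F = d + 1" and u: "u \<in> F"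
    and w: "w \<in> vertices (link D u) - F" "w' \<in> vertices (link D u) - F"
  shows "(w, w') \<in> (adj D (vertices D - F))\<^sup>*"
proof -
  have "adj (link D u) (vertices (link D u) - F) \<subseteq> adj D (vertices D - F)"
    by (auto simp: adj_def link_def vertices_def)
  moreover have "(w, w') \<in> (adj (link D u) (vertices (link D u) - F))\<^sup>*"
    using link_graph_connected[OF F u] w by (simp add: graph_connected_def)
  ultimately show ?thesis
    using rtrancl_mono by blast
qed

text \<open>Handshaking: were the component of \<open>w\<close> not to contain \<open>w'\<close>, all its vertices except
  \<open>w\<close> would have degree two in it, and \<open>w\<close> would have degree one.\<close>

lemma one_dimensional_connected_minus_edge:
  assumes d1: "d = 1" and F: "{u, u'} \<in> D" "u \<noteq> u'"
    and w: "w \<in> vertices (link D u) - {u, u'}" "w' \<in> vertices (link D u') - {u, u'}"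
  shows "(w, w') \<in> (adj D (vertices D - {u, u'}))\<^sup>*"
proof (rule ccontr)
  define r where "r = adj D (vertices D - {u, u'})"
  define C where "C = {x. (w, x) \<in> r\<^sup>*}"
  define P where "P = {(x, y). x \<in> C \<and> y \<in> vertices (link D x) \<and> y \<in> C}"
  assume "(w, w') \<notin> (adj D (vertices D - {u, u'}))\<^sup>*"
  then have w': "w' \<notin> C"
    by (simp add: C_def r_def)
  have lk: "y \<in> vertices (link D x) \<longleftrightarrow> y \<noteq> x \<and> {x, y} \<in> D" for x y
    by (simp add: vertices_link[OF complex])
  have in_V: "x \<in> vertices D" "y \<in> vertices D" if "{x, y} \<in> D" for x y
    using that by (auto simp: vertices_def)
  have wV: "w \<in> vertices D - {u, u'}"
    using w in_V by (auto simp: lk)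
  have CV: "C \<subseteq> vertices D - {u, u'}"
  proof
    fix x assume "x \<in> C"
    then have "(w, x) \<in> r\<^sup>*"
      by (simp add: C_def)
    then show "x \<in> vertices D - {u, u'}"
      using wV by (induction rule: rtrancl_induct) (auto simp: r_def adj_def)
  qed
  have wC: "w \<in> C"
    by (simp add: C_def)
  have finC: "finite C"
    using CV finite_vertices finite_subset by blast
  have closed: "y \<in> C" if "x \<in> C" "y \<in> vertices (link D x)" "y \<notin> {u, u'}" for x y
  proof -
    have "{x, y} \<in> D"
      using that(2) by (simp add: lk)
    then have "(x, y) \<in> r"
      using that CV in_V(2) by (auto simp: r_def adj_def)
    then show ?thesis
      using that(1) by (auto simp: C_def intro: rtrancl.rtrancl_into_rtrancl)
  qed
  have nu: "vertices (link D u) = {u', w}"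
  proof -
    obtain x y where "vertices (link D u) = {x, y}"
      using two_neighbors[OF d1 in_V(1)[OF F(1)]] .
    moreover have "u' \<in> vertices (link D u)" "w \<in> vertices (link D u)" "w \<noteq> u'"
      using F w by (auto simp: lk)
    ultimately show ?thesis
      by auto
  qed
  have nu': "vertices (link D u') = {u, w'}"
  proof -
    obtain x y where "vertices (link D u') = {x, y}"
      using two_neighbors[OF d1 in_V(2)[OF F(1)]] .
    moreover have "u \<in> vertices (link D u')" "w' \<in> vertices (link D u')" "w' \<noteq> u"
      using F w by (auto simp: lk insert_commute)
    ultimately show ?thesis
      by auto
  qed
  have sym: "y \<in> vertices (link D x) \<longleftrightarrow> x \<in> vertices (link D y)" for x y
    by (auto simp: lk insert_commute)
  \<comment> \<open>Edges leaving \<open>C\<close> can only end in \<open>u\<close> or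
    \<open>u'\<close>. The only neighbour of \<open>u\<close> besides \<open>u'\<close> is
    \<open>w\<close>, and the only neighbour of \<open>u'\<close> besides \<open>u\<close> is
    \<open>w'\<close>, which is not in \<open>C\<close>. So the edge from \<open>w\<close> to
    \<open>u\<close> is the only exit.\<close>
  have u_nbr: "c = w" if "c \<in> C" "u \<in> vertices (link D c)" for c
    using that nu sym CV by blast
  have u'_nbr: False if "c \<in> C" "u' \<in> vertices (link D c)" for c
    using that nu' sym CV w' by blast
  have deg: "card {y \<in> C. y \<in> vertices (link D c)} = (if c = w then 1 else 2)" if c: "c \<in> C" for c
  proof -
    obtain x y where xy: "x \<noteq> y" "vertices (link D c) = {x, y}"
      using two_neighbors[OF d1, of c] c CV by blast
    show ?thesis
    proof (cases "c = w")
      case True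
      have "u = x \<or> u = y"
        using xy(2) w(1) sym True by blast
      then have "\<exists>z. z \<noteq> u \<and> vertices (link D c) = {u, z}"
        using xy by (metis insert_commute)
      then obtain z where z: "z \<noteq> u" "vertices (link D c) = {u, z}"
        by blast
      then have "z \<in> C"
        using closed[OF c, of z] u'_nbr[OF c] by auto
      then have "{y \<in> C. y \<in> vertices (link D c)} = {z}"
        using z CV by auto
      then show ?thesis
        using True by simp
    next
      case False
      have "x \<in> C" "y \<in> C"
        using closed[OF c, of x] closed[OF c, of y] u_nbr[OF c] u'_nbr[OF c] False xy(2) by auto
      then have "{y \<in> C. y \<in> vertices (link D c)} = {x, y}"
        using xy(2) by auto
      then show ?thesis
        using xy(1) False by simp
    qed
  qed
  have "P = (SIGMA c:C. {y \<in> C. y \<in> vertices (link D c)})"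
    by (auto simp: P_def)
  then have "card P = (\<Sum>c\<in>C. card {y \<in> C. y \<in> vertices (link D c)})"
    using finC by (simp add: card_SigmaI)
  also have "\<dots> = (\<Sum>c\<in>C. if c = w then 1 else 2)"
    using deg by (rule sum.cong[OF refl])
  also have "\<dots> = 1 + (\<Sum>c\<in>C - {w}. 2)"
    using finC wC by (subst sum.remove[of C w]) (auto intro: sum.cong)
  finally have "odd (card P)"
    by simp
  moreover have "finite P" "sym P" "irrefl P"
    using finC sym finite_subset[of P "C \<times> C"] by (auto simp: P_def sym_def irrefl_def lk)
  ultimately show False
    using even_card_symmetric_relation by blast
qed

text \<open>For \<open>d >= 2\<close> the facet has a third vertex \<open>v\<close>. The vertex
  \<open>z\<close> beyond the ridge \<open>F - {v}\<close> is adjacent to both \<open>u\<close> and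
  \<open>u'\<close> and serves as a common stop for paths in the two links.\<close>

lemma boundary_neighbors_connected:
  assumes F: "F \<in> D" "card F = d + 1" and u: "u \<in> F" "u' \<in> F"
    and w: "w \<in> vertices (link D u) - F" "w' \<in> vertices (link D u') - F"
  shows "(w, w') \<in> (adj D (vertices D - F))\<^sup>*"
proof (cases "u = u'")
  case True
  then show ?thesis
    using neighbors_outside_facet_connected[OF F u(1)] w by blast
next
  case False
  show ?thesis
  proof (cases "d = 1")
    case True
    have "{u, u'} = F"
      using u False F finite_face[OF F(1)] True by (intro card_subset_eq) auto
    then show ?thesis
      using one_dimensional_connected_minus_edge[OF True] F(1) False w by blast
  next
    case d1: False
    have "card {u, u'} < card F"
      using False F(2) d d1 by simp
    then have "\<not> F \<subseteq> {u, u'}"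
      by (metis card_mono finite.emptyI finite.insertI not_le)
    then obtain v where v: "v \<in> F" "v \<noteq> u" "v \<noteq> u'"
      by blast
    obtain z where z: "z \<notin> F" "insert z (F - {v}) \<in> D"
      using ex_adjacent_facet[OF F v(1)] .
    have "{u, z} \<subseteq> insert z (F - {v})" "{u', z} \<subseteq> insert z (F - {v})"
      using u v by auto
    then have "{u, z} \<in> D" "{u', z} \<in> D"
      using subface[OF z(2)] by blast+
    then have "z \<in> vertices (link D u) - F" "z \<in> vertices (link D u') - F"
      using z(1) u by (auto simp: vertices_link[OF complex])
    then have "(w, z) \<in> (adj D (vertices D - F))\<^sup>*" "(z, w') \<in> (adj D (vertices D - F))\<^sup>*"
      using neighbors_outside_facet_connected[OF F] u w by blast+
    then show ?thesis
      by (rule rtrancl_trans)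
  qed
qed

text \<open>If \<open>a\<close> and \<open>b\<close> were in different components off
  \<open>F\<close>, connectedness of the complex would provide an edge out of each component,
  necessarily into \<open>F\<close>. Thus both components contain neighbours of vertices of
  \<open>F\<close>, and \<open>boundary_neighbors_connected\<close> joins these.\<close>

lemma graph_connected_minus_facet:
  assumes F: "F \<in> D" "card F = d + 1"
  shows "graph_connected D (vertices D - F)"
  unfolding graph_connected_def
proof (intro ballI)
  define r where "r = adj D (vertices D - F)"
  have symr: "sym (r\<^sup>*)"
    unfolding r_def by (intro sym_rtrancl sym_adj)
  fix a b assume a: "a \<in> vertices D - F" and b: "b \<in> vertices D - F"
  show "(a, b) \<in> (adj D (vertices D - F))\<^sup>*"
  proof -
    have exit: "\<exists>u\<in>F. \<exists>w\<in>vertices (link D u) - F. (x, w) \<in> r\<^sup>*"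
      if x: "x \<in> vertices D - F" and y: "y \<in> vertices D - F" "(x, y) \<notin> r\<^sup>*" for x y
    proof -
      define B where "B = {z \<in> vertices D - F. (x, z) \<in> r\<^sup>*}"
      have "B \<subseteq> vertices D" "x \<in> B" "y \<in> vertices D - B"
        using x y by (auto simp: B_def)
      then obtain w u where wu: "w \<in> B" "u \<in> vertices D - B" "{w, u} \<in> D"
        using graph_connectedD[OF connected] by blast
      have "u \<in> F"
      proof (rule ccontr)
        assume "u \<notin> F"
        then have "(w, u) \<in> r"
          using wu by (auto simp: r_def adj_def B_def)
        then have "u \<in> B"
          using wu \<open>u \<notin> F\<close> by (auto simp: B_def intro: rtrancl.rtrancl_into_rtrancl)
        then show False
          using wu by blast
      qed
      moreover have "w \<in> vertices (link D u) - F"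
        using wu \<open>u \<in> F\<close> by (auto simp: vertices_link[OF complex] B_def insert_commute)
      ultimately show ?thesis
        using wu(1) by (auto simp: B_def)
    qed
    show ?thesis
    proof (rule ccontr)
      assume no: "(a, b) \<notin> (adj D (vertices D - F))\<^sup>*"
      then have no: "(a, b) \<notin> r\<^sup>*" "(b, a) \<notin> r\<^sup>*"
        using symr by (auto simp: r_def sym_def)
      obtain u w where uw: "u \<in> F" "w \<in> vertices (link D u) - F" "(a, w) \<in> r\<^sup>*"
        using exit[OF a b no(1)] by blast
      obtain u' w' where uw': "u' \<in> F" "w' \<in> vertices (link D u') - F" "(b, w') \<in> r\<^sup>*"
        using exit[OF b a no(2)] by blast
      have "(w, w') \<in> r\<^sup>*"
        using boundary_neighbors_connected[OF F uw(1) uw'(1) uw(2) uw'(2)] by (simp add: r_def)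
      moreover have "(w', b) \<in> r\<^sup>*"
        using uw'(3) symr by (auto simp: sym_def)
      ultimately have "(a, b) \<in> r\<^sup>*"
        using uw(3) by (meson rtrancl_trans)
      then show False
        using no by blast
    qed
  qed
qed

lemma ex_strongly_connected_map: "\<exists>\<phi>. strongly_connected_map D (simplicial_sphere d) \<phi>"
proof -
  obtain F where F: "F \<in> D" "card F = d + 1"
    using ex_facet by blast
  have finF: "finite F"
    using finite_face[OF F(1)] .
  obtain b where b: "bij_betw b F {1..d + 1}"
    using ex_bij_betw_nat_finite_1[OF finF] F(2) bij_betw_inv_into by metis
  define \<phi> where "\<phi> v = (if v \<in> F then b v else d + 2)" for v
  have \<phi>F: "\<phi> v \<in> {1..d + 1}" if "v \<in> F" for v
    using that b by (auto simp: \<phi>_def bij_betw_def)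
  have \<phi>out: "\<phi> v = d + 2 \<longleftrightarrow> v \<notin> F" for v
    using \<phi>F[of v] by (auto simp: \<phi>_def)
  have \<phi>inj: "v = v'" if "v \<in> F" "v' \<in> F" "\<phi> v = \<phi> v'" for v v'
    using that b by (auto simp: \<phi>_def bij_betw_def inj_on_def)
  have \<phi>surj: "\<exists>v\<in>F. \<phi> v = j" if "j \<in> {1..d + 1}" for j
  proof -
    have "j \<in> b ` F"
      using that b by (simp add: bij_betw_def)
    then show ?thesis
      by (auto simp: \<phi>_def)
  qed
  have range: "\<phi> v \<in> {1..d + 2}" for v
    using \<phi>F[of v] by (cases "v \<in> F") (auto simp: \<phi>_def)
  have simplicial: "simplicial_map D (simplicial_sphere d) \<phi>"
    unfolding simplicial_map_def
  proof (intro conjI ballI)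
    show "\<phi> ` vertices D \<subseteq> vertices (simplicial_sphere d)"
    proof
      fix j assume "j \<in> \<phi> ` vertices D"
      then have "{j} \<in> simplicial_sphere d"
        using range by (auto simp: simplicial_sphere_def)
      then show "j \<in> vertices (simplicial_sphere d)"
        by (auto simp: vertices_def)
    qed
    fix T assume T: "T \<in> D"
    have "card (\<phi> ` T) \<le> d + 1"
      using card_face_le[OF T] card_image_le[OF finite_face[OF T], of \<phi>] by simp
    then show "\<phi> ` T \<in> simplicial_sphere d"
      using range by (auto simp: simplicial_sphere_def)
  qed
  have surjective: "\<exists>T\<in>D. \<phi> ` T = S" if S: "S \<in> simplicial_sphere d" for S
  proof -
    have S: "S \<subseteq> {1..d + 2}" "card S \<le> d + 1" "finite S"
      using S finite_subset by (auto simp: simplicial_sphere_def)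
    define S' where "S' = S - {d + 2}"
    define T where "T = {v \<in> F. \<phi> v \<in> S'}"
    have "S' \<subseteq> {1..d + 1}"
      using S(1) by (force simp: S'_def)
    then have imgT: "\<phi> ` T = S'"
      using \<phi>surj by (force simp: T_def image_iff)
    have "T \<subseteq> F"
      by (auto simp: T_def)
    show ?thesis
    proof (cases "d + 2 \<in> S")
      case False
      then have "\<phi> ` T = S"
        using imgT by (simp add: S'_def)
      then show ?thesis
        using subface[OF F(1) \<open>T \<subseteq> F\<close>] by blast
    next
      case True
      \<comment> \<open>Besides \<open>d + 2\<close>, the set \<open>S\<close> has at most
        \<open>d\<close> elements, so some \<open>j\<close> in \<open>1, ..., d + 1\<close> is
        missed. Dropping the vertex \<open>u\<close> over \<open>j\<close> from \<open>F\<close>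
        makes room for the vertex \<open>w\<close> beyond that ridge, which lies over
        \<open>d + 2\<close>.\<close>
      have "card S' \<le> d"
        using True S(2,3) by (simp add: S'_def)
      then have "S' \<noteq> {1..d + 1}"
        by auto
      then obtain j where j: "j \<in> {1..d + 1}" "j \<notin> S'"
        using \<open>S' \<subseteq> {1..d + 1}\<close> by blast
      then obtain u where u: "u \<in> F" "\<phi> u = j"
        using \<phi>surj by blast
      then have "T \<subseteq> F - {u}"
        using j by (auto simp: T_def)
      obtain w where w: "w \<notin> F" "insert w (F - {u}) \<in> D"
        using ex_adjacent_facet[OF F u(1)] .
      have "insert w T \<in> D"
        using \<open>T \<subseteq> F - {u}\<close> by (intro subface[OF w(2)]) auto
      moreover have "\<phi> ` insert w T = S"
        using imgT w(1) \<phi>out[of w] True by (auto simp: S'_def)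
      ultimately show ?thesis
        by blast
    qed
  qed
  have vertex_fibers: "\<exists>xs. xs \<noteq> [] \<and> hd xs = x \<and> last xs = y \<and> set xs \<subseteq> vertices D \<and>
      (\<forall>x\<in>set xs. \<phi> x = c) \<and> (\<forall>i. Suc i < length xs \<longrightarrow> {xs ! i, xs ! Suc i} \<in> D)"
    if xy: "x \<in> vertices D" "y \<in> vertices D" "\<phi> x = c" "\<phi> y = c" for x y c
  proof (cases "x \<in> F")
    case True
    then have "x = y"
      using xy \<phi>inj \<phi>out by metis
    then show ?thesis
      using xy by (intro exI[of _ "[x]"]) auto
  next
    case False
    then have out: "c = d + 2" "y \<notin> F"
      using xy \<phi>out by metis+
    have "(x, y) \<in> (adj D (vertices D - F))\<^sup>*"
      using graph_connected_minus_facet[OF F] xy False out by (auto simp: graph_connected_def)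
    from rtrancl_imp_path[OF this] obtain xs where xs: "xs \<noteq> []" "hd xs = x" "last xs = y"
        "\<forall>v\<in>set xs. (x, v) \<in> (adj D (vertices D - F))\<^sup>*"
        "\<forall>i. Suc i < length xs \<longrightarrow> (xs ! i, xs ! Suc i) \<in> adj D (vertices D - F)"
      by blast
    have "v \<in> vertices D - F" if "(x, v) \<in> (adj D (vertices D - F))\<^sup>*" for v
      using that xy False by (induction rule: rtrancl_induct) (auto simp: adj_def)
    then have "set xs \<subseteq> vertices D" "\<forall>v\<in>set xs. \<phi> v = c"
      using xs(4) \<phi>out out by auto
    moreover have "\<forall>i. Suc i < length xs \<longrightarrow> {xs ! i, xs ! Suc i} \<in> D"
      using xs(5) by (auto simp: adj_def)
    ultimately show ?thesis
      using xs by blast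
  qed
  \<comment> \<open>An edge over a pair within \<open>1, ..., d + 1\<close> lies in \<open>F\<close>
    and is unique. Edges over \<open>{d + 2, j}\<close> correspond to vertices off \<open>F\<close>
    in the link of the vertex \<open>u\<close> over \<open>j\<close>; neighbours along a path in the
    link form a face together with \<open>u\<close>, as the definition demands of consecutive
    edges.\<close>
  have edge_fibers: "\<exists>es. es \<noteq> [] \<and> hd es = e \<and> last es = e' \<and> set es \<subseteq> edges D \<and>
      (\<forall>e\<in>set es. \<phi> ` e = c) \<and> (\<forall>i. Suc i < length es \<longrightarrow>
        es ! i \<union> es ! Suc i \<in> D \<and> es ! i \<inter> es ! Suc i \<noteq> {})"
    if e: "e \<in> edges D" "e' \<in> edges D" "c \<in> edges (simplicial_sphere d)" "\<phi> ` e = c" "\<phi> ` e' = c"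
    for e e' c
  proof (cases "d + 2 \<in> c")
    case False
    have "e \<subseteq> F" "e' \<subseteq> F"
      using False e(4,5) \<phi>out by (metis imageI subsetI)+
    have "e = e'"
      using inj_on_image_eq_iff[of \<phi> F e e'] \<phi>inj \<open>e \<subseteq> F\<close> \<open>e' \<subseteq> F\<close> e(4,5)
      unfolding inj_on_def by blast
    then show ?thesis
      using e by (intro exI[of _ "[e]"]) auto
  next
    case True
    have "card c = 2"
      using e(3) by (simp add: edges_def)
    then obtain j where j: "c = {d + 2, j}" "j \<noteq> d + 2"
      using True by (auto simp: card_2_iff)
    have ends: "\<exists>u w. f = {u, w} \<and> u \<in> F \<and> \<phi> u = j \<and> w \<notin> F \<and> {u, w} \<in> D"
      if f: "f \<in> edges D" "\<phi> ` f = c" for f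
    proof -
      obtain u w where uw: "f = {u, w}" "f \<in> D"
        using f(1) by (auto simp: edges_def card_2_iff)
      have "(\<phi> u = j \<and> \<phi> w = d + 2) \<or> (\<phi> w = j \<and> \<phi> u = d + 2)"
        using f(2) j uw(1) by (auto simp: doubleton_eq_iff)
      then show ?thesis
        using uw j(2) \<phi>out by (metis insert_commute)
    qed
    obtain u w where uw: "e = {u, w}" "u \<in> F" "\<phi> u = j" "w \<notin> F" "{u, w} \<in> D"
      using ends[OF e(1,4)] by blast
    obtain u' w' where "e' = {u', w'}" "u' \<in> F" "\<phi> u' = j" "w' \<notin> F" "{u', w'} \<in> D"
      using ends[OF e(2,5)] by blast
    moreover have "u' = u"
      using calculation uw \<phi>inj by metis
    ultimately have uw': "e' = {u, w'}" "w' \<notin> F" "{u, w'} \<in> D"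
      by auto
    define N where "N = vertices (link D u) - F"
    have wN: "w \<in> N" "w' \<in> N"
      using uw uw' by (auto simp: N_def vertices_link[OF complex])
    have "(w, w') \<in> (adj (link D u) N)\<^sup>*"
      using link_graph_connected[OF F uw(2)] wN by (simp add: graph_connected_def N_def)
    from rtrancl_imp_path[OF this] obtain xs where xs: "xs \<noteq> []" "hd xs = w" "last xs = w'"
        "\<forall>v\<in>set xs. (w, v) \<in> (adj (link D u) N)\<^sup>*"
        "\<forall>i. Suc i < length xs \<longrightarrow> (xs ! i, xs ! Suc i) \<in> adj (link D u) N"
      by blast
    have inN: "v \<in> N" if "(w, v) \<in> (adj (link D u) N)\<^sup>*" for v
      using that wN by (induction rule: rtrancl_induct) (auto simp: adj_def)
    define es where "es = map (\<lambda>v. {u, v}) xs"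
    have "es \<noteq> []" "hd es = e" "last es = e'"
      using xs(1-3) uw(1) uw'(1) by (auto simp: es_def hd_map last_map)
    moreover have "{u, v} \<in> edges D \<and> \<phi> ` {u, v} = c" if "v \<in> set xs" for v
    proof -
      have "v \<in> N"
        using inN xs(4) that by blast
      then have "v \<noteq> u" "{u, v} \<in> D" "v \<notin> F"
        by (auto simp: N_def vertices_link[OF complex])
      then show ?thesis
        using uw(3) j(1) \<phi>out[of v] by (auto simp: edges_def)
    qed
    then have "set es \<subseteq> edges D" "\<forall>e\<in>set es. \<phi> ` e = c"
      by (auto simp: es_def)
    moreover have "es ! i \<union> es ! Suc i \<in> D \<and> es ! i \<inter> es ! Suc i \<noteq> {}" if "Suc i < length es" for i
    proof -
      have i: "Suc i < length xs" "i < length xs"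
        using that by (auto simp: es_def)
      then have "{xs ! i, xs ! Suc i} \<in> link D u"
        using xs(5) by (auto simp: adj_def)
      then have "{u, xs ! i, xs ! Suc i} \<in> D"
        by (simp add: link_def)
      moreover have "es ! i \<union> es ! Suc i = {u, xs ! i, xs ! Suc i}"
        using i by (auto simp: es_def)
      ultimately show ?thesis
        using i by (simp add: es_def)
    qed
    ultimately show ?thesis
      by blast
  qed
  have "strongly_connected_map D (simplicial_sphere d) \<phi>"
    unfolding strongly_connected_map_def surjective_simplicial_map_def
    by (intro conjI ballI impI simplicial;
        (elim conjE)?; (rule surjective | rule vertex_fibers | rule edge_fibers); assumption)
  then show ?thesis
    by blast
qed

end

section \<open>Chordal complexes\<close>

lemma relpow_function_segment:
  assumes "\<forall>i<n. (f i, f (Suc i)) \<in> r" "i \<le> j" "j \<le> n"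
  shows "(f i, f j) \<in> r ^^ (j - i)"
  unfolding relpow_fun_conv
  using assms by (intro exI[of _ "\<lambda>k. f (i + k)"]) auto

text \<open>The walk has minimal length, and a shortcut between \<open>f i\<close> and
  \<open>f j\<close> would shorten all of it. Later \<open>m = 0\<close> makes the points distinct
  and \<open>m = 1\<close> excludes chords.\<close>

lemma ex_geodesic:
  assumes "(s, t) \<in> r\<^sup>*"
  shows "\<exists>n f. f 0 = s \<and> f n = t \<and> (\<forall>i<n. (f i, f (Suc i)) \<in> r) \<and>
    (\<forall>i j m. i \<le> j \<longrightarrow> j \<le> n \<longrightarrow> (f i, f j) \<in> r ^^ m \<longrightarrow> j - i \<le> m)"
proof -
  define n where "n = (LEAST n. (s, t) \<in> r ^^ n)"
  obtain n' where "(s, t) \<in> r ^^ n'"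
    using assms rtrancl_power by blast
  then have "(s, t) \<in> r ^^ n"
    unfolding n_def by (rule LeastI)
  then obtain f where f: "f 0 = s" "f n = t" "\<forall>i<n. (f i, f (Suc i)) \<in> r"
    unfolding relpow_fun_conv by blast
  have "j - i \<le> m" if "i \<le> j" "j \<le> n" "(f i, f j) \<in> r ^^ m" for i j m
  proof -
    have "(s, f i) \<in> r ^^ i" "(f j, t) \<in> r ^^ (n - j)"
      using relpow_function_segment[OF f(3), of 0 i] relpow_function_segment[OF f(3), of j n] that f
      by auto
    then have "(s, t) \<in> r ^^ (i + m + (n - j))"
      using that(3) unfolding relpow_add by blast
    then have "n \<le> i + m + (n - j)"
      unfolding n_def by (rule Least_le)
    then show ?thesis
      using that by linarith
  qed
  then show ?thesis
    using f by blast
qed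

lemma graph_connected_insert:
  assumes A: "graph_connected E A" and y: "y \<in> A" "{s, y} \<in> E"
  shows "graph_connected E (insert s A)"
  unfolding graph_connected_def
proof (intro ballI)
  define r where "r = adj E (insert s A)"
  have symr: "sym (r\<^sup>*)"
    unfolding r_def by (intro sym_rtrancl sym_adj)
  have mono: "(adj E A)\<^sup>* \<subseteq> r\<^sup>*"
    by (intro rtrancl_mono) (auto simp: r_def adj_def)
  have y_to: "(y, x) \<in> r\<^sup>*" if "x \<in> insert s A" for x
  proof (cases "x \<in> A")
    case True
    then show ?thesis
      using A y(1) mono unfolding graph_connected_def by blast
  next
    case False
    then have "(y, x) \<in> r"
      using that y by (auto simp: r_def adj_def insert_commute)
    then show ?thesis
      by blast
  qed
  fix a b assume "a \<in> insert s A" "b \<in> insert s A"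
  then have "(a, y) \<in> r\<^sup>*" "(y, b) \<in> r\<^sup>*"
    using y_to symD[OF symr] by blast+
  then show "(a, b) \<in> (adj E (insert s A))\<^sup>*"
    unfolding r_def by (rule rtrancl_trans)
qed

text \<open>A shortest path from \<open>s\<close> to \<open>t\<close> through \<open>A\<close>, closed up by \<open>b\<close>, is an induced cycle.\<close>

lemma ex_induced_cycle:
  assumes A: "graph_connected E A" and y: "y \<in> A" "{s, y} \<in> E" and z: "z \<in> A" "{t, z} \<in> E"
    and st: "s \<noteq> t" "{s, t} \<notin> E"
    and b: "b \<notin> A" "b \<noteq> s" "b \<noteq> t" "{b, s} \<in> E" "{b, t} \<in> E"
    and bA: "\<And>a. a \<in> A \<Longrightarrow> {b, a} \<notin> E"
  shows "\<exists>vs. set vs \<subseteq> insert b (insert s (insert t A)) \<and> length vs \<ge> 4 \<and> induced_cycle E vs"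
proof -
  define X where "X = insert t (insert s A)"
  define r where "r = adj E X"
  have "graph_connected E (insert s A)"
    using graph_connected_insert[OF A y] .
  then have "graph_connected E X"
    unfolding X_def using graph_connected_insert[of E "insert s A" z t] z by blast
  then have "(s, t) \<in> r\<^sup>*"
    by (simp add: graph_connected_def r_def X_def)
  from ex_geodesic[OF this] obtain n f where f: "f 0 = s" "f n = t" "\<forall>i<n. (f i, f (Suc i)) \<in> r"
    and geo: "\<And>i j m. i \<le> j \<Longrightarrow> j \<le> n \<Longrightarrow> (f i, f j) \<in> r ^^ m \<Longrightarrow> j - i \<le> m"
    by blast
  have inj: "f i \<noteq> f j" if "i < j" "j \<le> n" for i j
    using geo[of i j 0] that by auto
  \<comment> \<open>As \<open>s\<close> and \<open>t\<close> are distinct and not adjacent,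
    \<open>n\<close> is at least \<open>2\<close>; the added vertex \<open>b\<close> then makes the
    cycle \<open>n + 2 >= 4\<close> long.\<close>
  have "n \<noteq> 0"
    using f st(1) by metis
  moreover have "n \<noteq> 1"
    using f st(2) by (auto simp: r_def adj_def)
  ultimately have n: "n \<ge> 2"
    by linarith
  have fX: "f i \<in> X" if "i \<le> n" for i
    using f(2,3) that by (cases "i = n") (auto simp: r_def adj_def X_def)
  have inner: "f i \<in> A" if "0 < i" "i < n" for i
    using fX[of i] inj[of 0 i] inj[of i n] f that by (auto simp: X_def)
  have chord: "{f i, f j} \<in> E \<longleftrightarrow> j = Suc i" if "i < j" "j \<le> n" for i j
  proof
    assume "{f i, f j} \<in> E"
    then have "(f i, f j) \<in> r ^^ 1"
      using fX that by (auto simp: r_def adj_def)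
    then show "j = Suc i"
      using geo[of i j 1] that by auto
  next
    assume "j = Suc i"
    then show "{f i, f j} \<in> E"
      using f(3) that by (auto simp: r_def adj_def)
  qed
  have bf: "{b, f i} \<in> E \<longleftrightarrow> i = 0 \<or> i = n" if "i \<le> n" for i
    using that inner[of i] f(1,2) b bA by (cases "i = 0 \<or> i = n") auto
  define vs where "vs = b # map f [0..<Suc n]"
  have nth_Suc: "vs ! Suc i = f i" if "i \<le> n" for i
    using that by (simp add: vs_def del: upt_Suc)
  have len: "length vs = n + 2"
    by (simp add: vs_def)
  have set_vs: "set vs \<subseteq> insert b X"
    using fX by (auto simp: vs_def)
  have "distinct vs"
  proof -
    have "inj_on f {0..<Suc n}"
      using inj by (intro linorder_inj_onI) auto
    moreover have "b \<notin> X"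
      using b by (simp add: X_def)
    ultimately show ?thesis
      using fX by (auto simp: vs_def distinct_map simp del: upt_Suc)
  qed
  moreover have "{vs ! i, vs ! j} \<in> E \<longleftrightarrow> j = Suc i \<or> i = 0 \<and> j = length vs - 1"
    if "i < j" "j < length vs" for i j
  proof -
    have "0 < j" "j < n + 2"
      using that len by auto
    then have j': "j = Suc (j - 1)" "j - 1 \<le> n"
      by auto
    define j' where "j' = j - 1"
    have j': "j = Suc j'" "j' \<le> n"
      using j' by (simp_all add: j'_def)
    show ?thesis
    proof (cases i)
      case 0
      then have "{vs ! i, vs ! j} = {b, f j'}"
        using nth_Suc[OF j'(2)] j'(1) by (simp add: vs_def)
      then show ?thesis
        using bf[OF j'(2)] 0 j'(1) len by auto
    next
      case (Suc i')
      then have "{vs ! i, vs ! j} = {f i', f j'}" "i' < j'"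
        using nth_Suc[of i'] nth_Suc[OF j'(2)] j' that(1) by simp_all
      then show ?thesis
        using chord[of i' j'] j' Suc by auto
    qed
  qed
  ultimately have "induced_cycle E vs"
    using len n by (auto simp: induced_cycle_def)
  then show ?thesis
    using set_vs len n by (intro exI[of _ vs]) (auto simp: X_def)
qed

text \<open>Dirac's theorem. For a maximal connected set \<open>A\<close> whose closed neighbourhood is not everything,
  the boundary of \<open>A\<close> is a clique that is completely joined to the complement \<open>B\<close> of the
  neighbourhood, so a simplicial vertex of \<open>B\<close> is simplicial in the whole graph.\<close>

lemma ex_simplicial_vertex:
  assumes "finite W" "W \<noteq> {}" "\<And>a. {a} \<notin> E"
    and "\<not> (\<exists>vs. set vs \<subseteq> W \<and> length vs \<ge> 4 \<and> induced_cycle E vs)"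
  shows "\<exists>v\<in>W. \<forall>a\<in>W. \<forall>b\<in>W. {v, a} \<in> E \<and> {v, b} \<in> E \<and> a \<noteq> b \<longrightarrow> {a, b} \<in> E"
  using assms
proof (induction W rule: finite_psubset_induct)
  case (psubset W)
  show ?case
  proof (cases "\<forall>a\<in>W. \<forall>b\<in>W. a \<noteq> b \<longrightarrow> {a, b} \<in> E")
    case True
    then show ?thesis
      using psubset.prems(1) by blast
  next
    case False
    then obtain p q where pq: "p \<in> W" "q \<in> W" "p \<noteq> q" "{p, q} \<notin> E"
      by blast
    define nb where "nb A = A \<union> {x \<in> W. \<exists>y\<in>A. {x, y} \<in> E}" for A
    define G where "G = {A. A \<subseteq> W \<and> A \<noteq> {} \<and> graph_connected E A \<and> nb A \<noteq> W}"
    have "finite G"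
      using psubset.hyps by (auto simp: G_def intro: finite_subset[of _ "Pow W"])
    moreover have "{p} \<in> G"
    proof -
      have "q \<notin> nb {p}"
        using pq by (auto simp: nb_def insert_commute)
      then show ?thesis
        using pq by (auto simp: G_def graph_connected_def)
    qed
    ultimately obtain A where A: "A \<in> G" "\<And>A'. A' \<in> G \<Longrightarrow> A \<subseteq> A' \<Longrightarrow> A' = A"
      using finite_has_maximal[of G] by (metis empty_iff)
    then have AW: "A \<subseteq> W" "A \<noteq> {}" "graph_connected E A" "nb A \<noteq> W"
      by (auto simp: G_def)
    define S where "S = nb A - A"
    define B where "B = W - nb A"
    have "nb A \<subseteq> W"
      using AW by (auto simp: nb_def)
    then have B: "B \<noteq> {}" "B \<subset> W"
      using AW by (auto simp: B_def nb_def)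
    have S_nbr: "\<exists>y\<in>A. {s, y} \<in> E" if "s \<in> S" for s
      using that by (auto simp: S_def nb_def)
    \<comment> \<open>\<open>insert s A\<close> is connected and strictly larger than
      \<open>A\<close>, so by maximality its closed neighbourhood is all of \<open>W\<close>. Since
      \<open>b\<close> is not in the closed neighbourhood of \<open>A\<close>, it must be adjacent
      to \<open>s\<close>.\<close>
    have SB: "{b, s} \<in> E" if s: "s \<in> S" and b: "b \<in> B" for s b
    proof -
      obtain y where "y \<in> A" "{s, y} \<in> E"
        using S_nbr[OF s] by blast
      then have "graph_connected E (insert s A)"
        using graph_connected_insert[OF AW(3)] by blast
      moreover have "insert s A \<subseteq> W" "insert s A \<noteq> A"
        using s \<open>nb A \<subseteq> W\<close> AW(1) by (auto simp: S_def)
      ultimately have "nb (insert s A) = W"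
        using A(2)[of "insert s A"] by (auto simp: G_def)
      then have "b \<in> nb (insert s A)" "b \<notin> nb A"
        using b by (auto simp: B_def)
      then show ?thesis
        using s by (auto simp: nb_def S_def)
    qed
    \<comment> \<open>Any \<open>b\<close> in \<open>B\<close> can close up a shortest path through
      \<open>A\<close>: it is adjacent to \<open>s\<close> and \<open>t\<close> by the preceding
      step, and to nothing in \<open>A\<close>.\<close>
    have SS: "{s, t} \<in> E" if s: "s \<in> S" and t: "t \<in> S" and st: "s \<noteq> t" for s t
    proof (rule ccontr)
      assume no: "{s, t} \<notin> E"
      obtain b where b: "b \<in> B"
        using B(1) by blast
      obtain y z where yz: "y \<in> A" "{s, y} \<in> E" "z \<in> A" "{t, z} \<in> E"
        using S_nbr s t by blast
      have "b \<notin> A" "b \<noteq> s" "b \<noteq> t"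
        using s t b by (auto simp: S_def B_def nb_def)
      moreover have "{b, a} \<notin> E" if "a \<in> A" for a
        using b that by (auto simp: B_def nb_def)
      ultimately have "\<exists>vs. set vs \<subseteq> insert b (insert s (insert t A)) \<and> length vs \<ge> 4 \<and> induced_cycle E vs"
        using ex_induced_cycle[OF AW(3) yz st no] SB[OF s b] SB[OF t b] by blast
      moreover have "insert b (insert s (insert t A)) \<subseteq> W"
        using b s t AW(1) \<open>nb A \<subseteq> W\<close> by (auto simp: B_def S_def)
      ultimately show False
        using psubset.prems(3) by (meson subset_trans)
    qed
    have "\<not> (\<exists>vs. set vs \<subseteq> B \<and> length vs \<ge> 4 \<and> induced_cycle E vs)"
      using psubset.prems(3) B(2) by (meson psubset_imp_subset subset_trans)
    then obtain v where v: "v \<in> B"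
        "\<And>a b. a \<in> B \<Longrightarrow> b \<in> B \<Longrightarrow> {v, a} \<in> E \<Longrightarrow> {v, b} \<in> E \<Longrightarrow> a \<noteq> b \<Longrightarrow> {a, b} \<in> E"
      using psubset.IH[OF B(2,1) psubset.prems(2)] by blast
    \<comment> \<open>A neighbour in \<open>A\<close> is impossible, because \<open>v\<close> is
      outside the closed neighbourhood of \<open>A\<close>.\<close>
    have SB_cases: "a \<in> S \<or> a \<in> B" if "a \<in> W" "{v, a} \<in> E" for a
      using that v(1) by (auto simp: S_def B_def nb_def)
    have "{a, b} \<in> E" if ab: "a \<in> W" "b \<in> W" "{v, a} \<in> E" "{v, b} \<in> E" "a \<noteq> b" for a b
    proof -
      consider "a \<in> S" "b \<in> S" | "a \<in> S" "b \<in> B" | "a \<in> B" "b \<in> S" | "a \<in> B" "b \<in> B"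
        using SB_cases ab by blast
      moreover have "{b, a} = {a, b}"
        by (rule insert_commute)
      ultimately show ?thesis
        using SS[of a b] SB[of a b] SB[of b a] v(2)[of a b] ab by cases simp_all
    qed
    then show ?thesis
      using v(1) B(2) by blast
  qed
qed

text \<open>For a simplicial vertex \<open>v\<close>, its closed neighbourhood \<open>F\<close> is a
  clique, hence a face, and it contains every face through \<open>v\<close>. But if \<open>F\<close>
  has at most \<open>d\<close> vertices it can be enlarged, and if it is a facet, then the facet
  across the ridge opposite some \<open>u\<close> other than \<open>v\<close> still contains
  \<open>v\<close> and leaves \<open>F\<close>.\<close>

lemma (in spherical_links) not_chordal: "\<not> chordal_complex D"
proof
  assume "chordal_complex D"
  then obtain E where E: "chordal_graph (vertices D) E" and D: "D = clique_complex (vertices D) E"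
    by (auto simp: chordal_complex_def)
  have "{a} \<notin> E" for a
    using E by (auto simp: chordal_graph_def)
  then obtain v where v: "v \<in> vertices D"
      "\<And>a b. a \<in> vertices D \<Longrightarrow> b \<in> vertices D \<Longrightarrow> {v, a} \<in> E \<Longrightarrow> {v, b} \<in> E \<Longrightarrow> a \<noteq> b \<Longrightarrow> {a, b} \<in> E"
    using ex_simplicial_vertex[OF finite_vertices nonempty, of E] E by (auto simp: chordal_graph_def)
  define F where "F = insert v {a \<in> vertices D. {v, a} \<in> E}"
  have "F \<in> clique_complex (vertices D) E"
    using v by (auto simp: clique_complex_def F_def insert_commute)
  then have F: "F \<in> D" "v \<in> F"
    using D by (auto simp: F_def)
  have nbr: "w \<in> F" if "T \<in> D" "v \<in> T" "w \<in> T" for w T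
  proof (cases "w = v")
    case False
    have "T \<in> clique_complex (vertices D) E"
      using that(1) D by simp
    then show ?thesis
      using that(2,3) False by (auto simp: clique_complex_def F_def)
  qed (use F in simp)
  show False
  proof (cases "card F \<le> d")
    case True
    then obtain w where "w \<notin> F" "insert w F \<in> D"
      using ex_face_insert[OF F, of v] by auto
    then show False
      using nbr[of "insert w F" w] F by blast
  next
    case False
    then have card: "card F = d + 1"
      using card_face_le[OF F(1)] by simp
    have "F \<noteq> {v}"
      using card d by auto
    then obtain u where u: "u \<in> F" "u \<noteq> v"
      using F(2) by blast
    obtain w where "w \<notin> F" "insert w (F - {u}) \<in> D"
      using ex_adjacent_facet[OF F(1) card u(1)] .
    then show False
      using nbr[of "insert w (F - {u})" w] F(2) u(2) by blast
  qed
qed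

section \<open>Quadratic forms\<close>

text \<open>Gaussian elimination: the last equation is solved for a variable \<open>p\<close> with
  nonzero coefficient, and \<open>a'\<close> holds the remaining equations after the substitution.
  If there is no such variable, the last equation is void.\<close>

lemma ex_nontrivial_solution:
  fixes a :: "nat \<Rightarrow> 'v \<Rightarrow> real"
  assumes "finite F" "n < card F"
  shows "\<exists>x\<in>coord_span F. (\<exists>i. x i \<noteq> 0) \<and> (\<forall>j<n. (\<Sum>i\<in>F. a j i * x i) = 0)"
  using assms
proof (induction n arbitrary: F a)
  case 0
  then obtain p where "p \<in> F"
    by fastforce
  then show ?case
    by (intro bexI[of _ "\<lambda>i. if i = p then 1 else 0"]) (auto simp: coord_span_def)
next
  case (Suc n)
  show ?case
  proof (cases "\<forall>i\<in>F. a n i = 0")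
    case True
    obtain x where "x \<in> coord_span F" "\<exists>i. x i \<noteq> 0" "\<forall>j<n. (\<Sum>i\<in>F. a j i * x i) = 0"
      using Suc.IH[OF Suc.prems(1), of a] Suc.prems(2) by auto
    then show ?thesis
      using True by (intro bexI[of _ x]) (auto simp: less_Suc_eq)
  next
    case False
    then obtain p where p: "p \<in> F" "a n p \<noteq> 0"
      by blast
    define F' where "F' = F - {p}"
    define a' where "a' j i = a j i - a j p * a n i / a n p" for j i
    have F': "finite F'" "n < card F'" "F = insert p F'" "p \<notin> F'"
      using Suc.prems p by (auto simp: F'_def)
    obtain x where x: "x \<in> coord_span F'" "\<exists>i. x i \<noteq> 0" "\<forall>j<n. (\<Sum>i\<in>F'. a' j i * x i) = 0"
      using Suc.IH[OF F'(1,2)] by blast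
    define s where "s = (\<Sum>i\<in>F'. a n i * x i)"
    define y where "y = x(p := - s / a n p)"
    have sum_y: "(\<Sum>i\<in>F. a j i * y i) = - a j p * s / a n p + (\<Sum>i\<in>F'. a j i * x i)" for j
    proof -
      have "(\<Sum>i\<in>F'. a j i * y i) = (\<Sum>i\<in>F'. a j i * x i)"
        using F'(4) by (intro sum.cong) (auto simp: y_def)
      then show ?thesis
        using F' by (simp add: y_def)
    qed
    have "(\<Sum>i\<in>F. a j i * y i) = 0" if "j < Suc n" for j
    proof (cases "j = n")
      case True
      then show ?thesis
        using p(2) sum_y[of n] by (simp add: s_def)
    next
      case False
      then have "0 = (\<Sum>i\<in>F'. a' j i * x i)"
        using x(3) that by simp
      also have "\<dots> = (\<Sum>i\<in>F'. a j i * x i - a j p / a n p * (a n i * x i))"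
        by (intro sum.cong) (auto simp: a'_def field_simps)
      also have "\<dots> = (\<Sum>i\<in>F'. a j i * x i) - a j p / a n p * s"
        by (simp add: sum_subtractf sum_distrib_left s_def)
      finally show ?thesis
        using sum_y[of j] by simp
    qed
    moreover have "y \<in> coord_span F" "\<exists>i. y i \<noteq> 0"
    proof -
      show "y \<in> coord_span F"
        using x(1) p(1) by (auto simp: y_def coord_span_def F'_def)
      obtain i where "x i \<noteq> 0"
        using x(2) by blast
      moreover have "i \<noteq> p"
        using calculation x(1) F'(4) by (auto simp: coord_span_def)
      ultimately show "\<exists>i. y i \<noteq> 0"
        by (auto simp: y_def)
    qed
    ultimately show ?thesis
      by blast
  qed
qed

definition quad_form :: "'v set \<Rightarrow> ('v \<Rightarrow> 'v \<Rightarrow> real) \<Rightarrow> ('v \<Rightarrow> real) \<Rightarrow> real" where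
  "quad_form F B x = (\<Sum>i\<in>F. \<Sum>j\<in>F. B i j * x i * x j)"

lemma quad_form_insert:
  assumes "finite F" "p \<notin> F" "\<And>i j. B i j = B j i"
  shows "quad_form (insert p F) B x =
    B p p * (x p)\<^sup>2 + 2 * x p * (\<Sum>i\<in>F. B p i * x i) + quad_form F B x"
proof -
  have "(\<Sum>i\<in>F. B i p * x i * x p) = x p * (\<Sum>i\<in>F. B p i * x i)"
    unfolding sum_distrib_left by (intro sum.cong) (auto simp: assms(3)[of _ p])
  moreover have "(\<Sum>j\<in>F. B p j * x p * x j) = x p * (\<Sum>i\<in>F. B p i * x i)"
    unfolding sum_distrib_left by (intro sum.cong) auto
  ultimately show ?thesis
    unfolding quad_form_def using assms(1,2)
    by (simp add: sum.distrib power2_eq_square algebra_simps)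
qed

lemma quad_form_cong: "(\<And>i. i \<in> F \<Longrightarrow> x i = y i) \<Longrightarrow> quad_form F B x = quad_form F B y"
  unfolding quad_form_def by (intro sum.cong) auto

lemma affine_nonneg_imp_zero:
  fixes b c :: real
  assumes "\<And>t. 0 \<le> t * b + c"
  shows "b = 0"
proof (rule ccontr)
  assume "b \<noteq> 0"
  then show False
    using assms[of "- (c + 1) / b"] by simp
qed

text \<open>The square is completed in one variable after the other, which accounts for the number
  \<open>card F\<close>. A variable whose diagonal entry is \<open>0\<close> drops out altogether
  and contributes a zero square.\<close>

lemma quad_form_sum_squares:
  assumes "finite F" "\<And>i j. B i j = B j i" "\<And>x. x \<in> coord_span F \<Longrightarrow> 0 \<le> quad_form F B x"
  shows "\<exists>a. \<forall>x. quad_form F B x = (\<Sum>j<card F. (\<Sum>i\<in>F. a j i * x i)\<^sup>2)"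
  using assms
proof (induction F arbitrary: B rule: finite_induct)
  case empty
  then show ?case
    by (simp add: quad_form_def)
next
  case (insert p F)
  note ins = quad_form_insert[OF insert.hyps(1,2) insert.prems(1)]
  define L where "L x = (\<Sum>i\<in>F. B p i * x i)" for x :: "'a \<Rightarrow> real"
  have L_upd: "L (x(p := t)) = L x" for x t
    unfolding L_def using insert.hyps(2) by (intro sum.cong) auto
  have q_upd: "quad_form F C (x(p := t)) = quad_form F C x" for C x t
    using insert.hyps(2) by (intro quad_form_cong) auto
  have nonneg: "0 \<le> B p p * t\<^sup>2 + 2 * t * L x + quad_form F B x" if "x \<in> coord_span F" for x t
  proof -
    have "x(p := t) \<in> coord_span (insert p F)"
      using that by (auto simp: coord_span_def)
    from insert.prems(2)[OF this]
    have "0 \<le> B p p * ((x(p := t)) p)\<^sup>2 + 2 * (x(p := t)) p * L (x(p := t)) +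
        quad_form F B (x(p := t))"
      unfolding ins L_def .
    then show ?thesis
      unfolding L_upd q_upd fun_upd_same .
  qed
  have zero: "(\<lambda>i. 0) \<in> coord_span F" "L (\<lambda>i. 0) = 0" "quad_form F B (\<lambda>i. 0) = 0"
    by (auto simp: coord_span_def L_def quad_form_def)
  have "0 \<le> B p p"
    using nonneg[OF zero(1), of 1] zero by simp
  then consider "B p p = 0" | "B p p > 0"
    by linarith
  then show ?case
  proof cases
    case 1
    \<comment> \<open>Without the quadratic term the nonnegative expression is affine in
      \<open>t\<close>, so its slope vanishes.\<close>
    have Lz: "L x = 0" if "x \<in> coord_span F" for x
      using nonneg[OF that] 1 affine_nonneg_imp_zero[of "2 * L x" "quad_form F B x"]
      by (simp add: algebra_simps)
    have "B p i = 0" if "i \<in> F" for i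
    proof -
      have "L (\<lambda>j. if j = i then 1 else 0) = B p i"
        using that insert.hyps(1) by (simp add: L_def if_distrib cong: if_cong)
      then show ?thesis
        using Lz[of "\<lambda>j. if j = i then 1 else 0"] that by (auto simp: coord_span_def)
    qed
    then have q: "quad_form (insert p F) B x = quad_form F B x" for x
      using 1 by (simp add: ins)
    have "0 \<le> quad_form F B x" if "x \<in> coord_span F" for x
      using nonneg[OF that, of 0] by simp
    then obtain a where a: "\<And>x. quad_form F B x = (\<Sum>j<card F. (\<Sum>i\<in>F. a j i * x i)\<^sup>2)"
      using insert.IH[of B] insert.prems(1) by blast
    define a' where "a' j i = (if j = card F \<or> i = p then 0 else a j i)" for j i
    have "quad_form (insert p F) B x = (\<Sum>j<card (insert p F). (\<Sum>i\<in>insert p F. a' j i * x i)\<^sup>2)" for x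
    proof -
      have "(\<Sum>i\<in>insert p F. a' j i * x i) = (\<Sum>i\<in>F. a j i * x i)" if "j < card F" for j
        using insert.hyps that by (auto simp: a'_def intro!: sum.cong)
      moreover have "(\<Sum>i\<in>insert p F. a' (card F) i * x i) = 0"
        by (simp add: a'_def)
      ultimately show ?thesis
        using insert.hyps by (simp add: q a)
    qed
    then show ?thesis
      by blast
  next
    case 2
    define c where "c = B p p"
    define B' where "B' i j = B i j - B p i * B p j / c" for i j
    have B'_form: "quad_form F B' x = quad_form F B x - (L x)\<^sup>2 / c" for x
    proof -
      have "(L x)\<^sup>2 / c = (\<Sum>i\<in>F. \<Sum>j\<in>F. (B p i * x i) * (B p j * x j) / c)"
        by (simp add: L_def power2_eq_square sum_product sum_divide_distrib)
      then show ?thesis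
        by (simp add: quad_form_def B'_def sum_subtractf[symmetric] algebra_simps)
    qed
    have complete: "quad_form (insert p F) B x = (c * x p + L x)\<^sup>2 / c + quad_form F B' x" for x
    proof -
      have "quad_form (insert p F) B x = c * (x p)\<^sup>2 + 2 * x p * L x + quad_form F B x"
        unfolding ins L_def c_def ..
      moreover have "(c * x p + L x)\<^sup>2 / c = c * (x p)\<^sup>2 + 2 * x p * L x + (L x)\<^sup>2 / c"
        using 2 by (simp add: c_def field_simps power2_eq_square)
      ultimately show ?thesis
        by (simp add: B'_form)
    qed
    \<comment> \<open>For fixed \<open>x\<close> on \<open>F\<close> the form is minimal when
      coordinate \<open>p\<close> is \<open>- L x / c\<close>; the minimum is the Schur complement
      \<open>B'\<close>.\<close>
    have "0 \<le> quad_form F B' x" if "x \<in> coord_span F" for x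
      using nonneg[OF that, of "- L x / c"] 2
      by (simp add: B'_form c_def power2_eq_square field_simps)
    moreover have "B' i j = B' j i" for i j
      by (simp add: B'_def insert.prems(1)[of i j])
    ultimately obtain a where a: "\<And>x. quad_form F B' x = (\<Sum>j<card F. (\<Sum>i\<in>F. a j i * x i)\<^sup>2)"
      using insert.IH[of B'] by blast
    define a' where "a' j i = (if j = card F then B p i / sqrt c else if i = p then 0 else a j i)" for j i
    have "quad_form (insert p F) B x = (\<Sum>j<card (insert p F). (\<Sum>i\<in>insert p F. a' j i * x i)\<^sup>2)" for x
    proof -
      have "(\<Sum>i\<in>insert p F. a' j i * x i) = (\<Sum>i\<in>F. a j i * x i)" if "j < card F" for j
        using insert.hyps that by (auto simp: a'_def intro!: sum.cong)
      moreover have "(\<Sum>i\<in>insert p F. a' (card F) i * x i) = (c * x p + L x) / sqrt c"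
        using insert.hyps by (simp add: a'_def L_def c_def add_divide_distrib sum_divide_distrib)
      moreover have "((c * x p + L x) / sqrt c)\<^sup>2 = (c * x p + L x)\<^sup>2 / c"
        using 2 by (simp add: power_divide c_def)
      ultimately show ?thesis
        using insert.hyps by (simp add: complete a)
    qed
    then show ?thesis
      by blast
  qed
qed

section \<open>The ring of a complex\<close>

definition monom_value :: "('v \<Rightarrow>\<^sub>0 nat) \<Rightarrow> ('v \<Rightarrow> real) \<Rightarrow> real" where
  "monom_value m x = (\<Prod>i\<in>Poly_Mapping.keys m. x i ^ Poly_Mapping.lookup m i)"

definition monom_degree :: "('v \<Rightarrow>\<^sub>0 nat) \<Rightarrow> nat" where
  "monom_degree m = (\<Sum>i\<in>Poly_Mapping.keys m. Poly_Mapping.lookup m i)"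

lemma monom_value_superset:
  assumes "finite K" "Poly_Mapping.keys m \<subseteq> K"
  shows "monom_value m x = (\<Prod>i\<in>K. x i ^ Poly_Mapping.lookup m i)"
  unfolding monom_value_def using assms
  by (intro prod.mono_neutral_left) (auto simp: in_keys_iff)

lemma monom_degree_superset:
  assumes "finite K" "Poly_Mapping.keys m \<subseteq> K"
  shows "monom_degree m = (\<Sum>i\<in>K. Poly_Mapping.lookup m i)"
  unfolding monom_degree_def using assms
  by (intro sum.mono_neutral_left) (auto simp: in_keys_iff)

lemma keys_add_nat:
  fixes m n :: "'v \<Rightarrow>\<^sub>0 nat"
  shows "Poly_Mapping.keys (m + n) = Poly_Mapping.keys m \<union> Poly_Mapping.keys n"
  by (auto simp: in_keys_iff lookup_add)

lemma monom_value_add: "monom_value (m + n) x = monom_value m x * monom_value n x"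
proof -
  define K where "K = Poly_Mapping.keys m \<union> Poly_Mapping.keys n"
  have K: "finite K" "Poly_Mapping.keys m \<subseteq> K" "Poly_Mapping.keys n \<subseteq> K"
    "Poly_Mapping.keys (m + n) \<subseteq> K"
    by (auto simp: K_def keys_add_nat)
  show ?thesis
    by (simp add: monom_value_superset[OF K(1)] K lookup_add power_add prod.distrib)
qed

lemma monom_degree_add: "monom_degree (m + n) = monom_degree m + monom_degree n"
proof -
  define K where "K = Poly_Mapping.keys m \<union> Poly_Mapping.keys n"
  have K: "finite K" "Poly_Mapping.keys m \<subseteq> K" "Poly_Mapping.keys n \<subseteq> K"
    "Poly_Mapping.keys (m + n) \<subseteq> K"
    by (auto simp: K_def keys_add_nat)
  show ?thesis
    by (simp add: monom_degree_superset[OF K(1)] K lookup_add sum.distrib)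
qed

lemma monom_single [simp]:
  "monom_value (Poly_Mapping.single i 1) x = x i"
  "monom_degree (Poly_Mapping.single i 1) = 1"
  by (simp_all add: monom_value_def monom_degree_def)

lemma monom_zero [simp]: "monom_value 0 x = 1" "monom_degree 0 = 0"
  by (simp_all add: monom_value_def monom_degree_def)

lemma monom_degree_eq_0: "monom_degree m = 0 \<longleftrightarrow> m = 0"
proof
  assume "monom_degree m = 0"
  then have "Poly_Mapping.lookup m i = 0" for i
    unfolding monom_degree_def by (cases "i \<in> Poly_Mapping.keys m") (auto simp: in_keys_iff)
  then show "m = 0"
    by (intro poly_mapping_eqI) simp
qed simp

lemma monom_split_variable:
  fixes m :: "'v \<Rightarrow>\<^sub>0 nat"
  assumes "i \<in> Poly_Mapping.keys m"
  shows "Poly_Mapping.single i 1 + (m - Poly_Mapping.single i 1) = m"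
proof (rule poly_mapping_eqI)
  fix k
  have "Poly_Mapping.lookup m i \<ge> 1"
    using assms by (simp add: in_keys_iff)
  then show "Poly_Mapping.lookup (Poly_Mapping.single i 1 + (m - Poly_Mapping.single i 1)) k =
      Poly_Mapping.lookup m k"
    by (cases "k = i") (simp_all add: lookup_add lookup_minus lookup_single when_def)
qed

lemma monom_degree_SucE:
  assumes "monom_degree m = Suc k"
  obtains i n where "m = Poly_Mapping.single i 1 + n" "monom_degree n = k"
proof -
  have "m \<noteq> 0"
    using assms by auto
  then have "Poly_Mapping.keys m \<noteq> {}"
    by (metis keys_eq_empty)
  then obtain i where "i \<in> Poly_Mapping.keys m"
    by blast
  from monom_split_variable[OF this, symmetric] show ?thesis
    using assms that[of i "m - Poly_Mapping.single i 1"]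
    by (metis add_left_cancel monom_degree_add monom_single(2) plus_1_eq_Suc)
qed

lemma monom_degree_1E:
  assumes "monom_degree m = 1"
  obtains i where "m = Poly_Mapping.single i 1"
  using assms monom_degree_SucE[of m 0] by (auto simp: monom_degree_eq_0)

lemma monom_degree_2E:
  assumes "monom_degree m = 2"
  obtains i j where "m = Poly_Mapping.single i 1 + Poly_Mapping.single j 1"
proof -
  obtain i n where "m = Poly_Mapping.single i 1 + n" "monom_degree n = 1"
    using assms monom_degree_SucE[of m 1] by (auto simp: numeral_2_eq_2)
  then show ?thesis
    using that monom_degree_1E by metis
qed

lemma poly_eval_superset:
  assumes "finite M" "Poly_Mapping.keys p \<subseteq> M"
  shows "poly_eval p x = (\<Sum>m\<in>M. Poly_Mapping.lookup p m * monom_value m x)"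
  unfolding poly_eval_def monom_value_def[symmetric] using assms
  by (intro sum.mono_neutral_left) (auto simp: in_keys_iff)

lemma poly_eval_eq:
  "poly_eval p x = (\<Sum>m\<in>Poly_Mapping.keys p. Poly_Mapping.lookup p m * monom_value m x)"
  by (rule poly_eval_superset) auto

lemma poly_eval_add: "poly_eval (p + q) x = poly_eval p x + poly_eval q x"
proof -
  define M where "M = Poly_Mapping.keys p \<union> Poly_Mapping.keys q"
  have M: "finite M" "Poly_Mapping.keys p \<subseteq> M" "Poly_Mapping.keys q \<subseteq> M"
    "Poly_Mapping.keys (p + q) \<subseteq> M"
    using keys_add[of p q] by (auto simp: M_def)
  show ?thesis
    by (simp add: poly_eval_superset[OF M(1)] M lookup_add sum.distrib algebra_simps)
qed

lemma poly_eval_zero [simp]: "poly_eval 0 x = 0"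
  by (simp add: poly_eval_def)

lemma poly_eval_sum: "poly_eval (\<Sum>a\<in>A. f a) x = (\<Sum>a\<in>A. poly_eval (f a) x)"
  by (induction A rule: infinite_finite_induct) (auto simp: poly_eval_add)

lemma poly_eval_single: "poly_eval (Poly_Mapping.single m c) x = c * monom_value m x"
  by (simp add: poly_eval_eq)

lemma poly_eq_sum_monomials:
  "p = (\<Sum>m\<in>Poly_Mapping.keys p. Poly_Mapping.single m (Poly_Mapping.lookup p m))"
proof (rule poly_mapping_eqI)
  fix k
  show "Poly_Mapping.lookup p k = Poly_Mapping.lookup
      (\<Sum>m\<in>Poly_Mapping.keys p. Poly_Mapping.single m (Poly_Mapping.lookup p m)) k"
    by (cases "k \<in> Poly_Mapping.keys p")
      (auto simp: lookup_sum lookup_single when_def in_keys_iff)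
qed

lemma poly_eval_mult: "poly_eval (p * q) x = poly_eval p x * poly_eval q x"
proof -
  define s where "s r m = Poly_Mapping.single m (Poly_Mapping.lookup r m)" for r :: "'a rpoly" and m
  have "p * q = (\<Sum>m\<in>Poly_Mapping.keys p. s p m) * (\<Sum>n\<in>Poly_Mapping.keys q. s q n)"
    unfolding s_def poly_eq_sum_monomials[symmetric] ..
  also have "\<dots> = (\<Sum>m\<in>Poly_Mapping.keys p. \<Sum>n\<in>Poly_Mapping.keys q. s p m * s q n)"
    by (rule sum_product)
  finally have "poly_eval (p * q) x =
      (\<Sum>m\<in>Poly_Mapping.keys p. \<Sum>n\<in>Poly_Mapping.keys q. poly_eval (s p m * s q n) x)"
    by (simp add: poly_eval_sum)
  also have "\<dots> = (\<Sum>m\<in>Poly_Mapping.keys p. \<Sum>n\<in>Poly_Mapping.keys q.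
      (Poly_Mapping.lookup p m * monom_value m x) * (Poly_Mapping.lookup q n * monom_value n x))"
    by (simp add: s_def mult_single poly_eval_single monom_value_add algebra_simps)
  also have "\<dots> = poly_eval p x * poly_eval q x"
    by (simp add: poly_eval_eq sum_product)
  finally show ?thesis .
qed

lemma homogeneous_iff: "homogeneous k p \<longleftrightarrow> (\<forall>m\<in>Poly_Mapping.keys p. monom_degree m = k)"
  by (simp add: homogeneous_def monom_degree_def)

lemma homogeneous_diff: "homogeneous k p \<Longrightarrow> homogeneous k q \<Longrightarrow> homogeneous k (p - q)"
  unfolding homogeneous_iff by (metis in_keys_iff lookup_minus diff_self)

lemma homogeneous_const_mult: "homogeneous k p \<Longrightarrow> homogeneous k (const_poly c * p)"
  unfolding homogeneous_iff const_poly_def using keys_mult[of "Poly_Mapping.single 0 c" p]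
  by (auto split: if_splits)

lemma poly_eval_const_mult: "poly_eval (const_poly c * p) x = c * poly_eval p x"
  by (simp add: poly_eval_mult const_poly_def poly_eval_single)

lemma poly_eval_diff: "poly_eval (p - q) x = poly_eval p x - poly_eval q x"
  using poly_eval_add[of "p - q" q x] by simp

lemma linear_form_exists:
  assumes p: "homogeneous 1 p" "p \<in> carrier (poly_ring V)" and V: "finite V"
  shows "\<exists>a. \<forall>x. poly_eval p x = (\<Sum>i\<in>V. a i * x i)"
proof -
  have "\<exists>i. m = Poly_Mapping.single i 1 \<and> i \<in> V" if "m \<in> Poly_Mapping.keys p" for m
  proof -
    obtain i where "m = Poly_Mapping.single i 1"
      using p(1) \<open>m \<in> Poly_Mapping.keys p\<close> monom_degree_1E unfolding homogeneous_iff by blast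
    then show ?thesis
      using p(2) that by (force simp: poly_ring_def)
  qed
  then obtain \<alpha> where \<alpha>: "\<And>m. m \<in> Poly_Mapping.keys p \<Longrightarrow> m = Poly_Mapping.single (\<alpha> m) 1 \<and> \<alpha> m \<in> V"
    by metis
  define a where "a i = (\<Sum>m\<in>Poly_Mapping.keys p. if \<alpha> m = i then Poly_Mapping.lookup p m else 0)" for i
  have "poly_eval p x = (\<Sum>i\<in>V. a i * x i)" for x
  proof -
    have "(\<Sum>i\<in>V. a i * x i) =
        (\<Sum>m\<in>Poly_Mapping.keys p. \<Sum>i\<in>V. (if \<alpha> m = i then Poly_Mapping.lookup p m else 0) * x i)"
      unfolding a_def sum_distrib_right by (rule sum.swap)
    also have "\<dots> = (\<Sum>m\<in>Poly_Mapping.keys p. Poly_Mapping.lookup p m * x (\<alpha> m))"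
      using \<alpha> V by (intro sum.cong refl) (simp add: if_distrib[of "\<lambda>c. c * _"] cong: if_cong)
    also have "\<dots> = poly_eval p x"
      unfolding poly_eval_eq by (intro sum.cong refl) (metis \<alpha> monom_single(1))
    finally show ?thesis ..
  qed
  then show ?thesis
    by blast
qed

text \<open>The coefficient of a monomial is split evenly between the two entries of the matrix that
  belong to it; for a square both halves fall on the same diagonal entry. The matrix depends on
  \<open>p\<close> only, so one matrix serves all faces.\<close>

lemma quadratic_form_exists:
  assumes p: "homogeneous 2 p"
  shows "\<exists>B. (\<forall>i j. B i j = B j i) \<and> (\<forall>F. \<forall>x\<in>coord_span F. finite F \<longrightarrow> poly_eval p x = quad_form F B x)"
proof -
  have "\<exists>i j. m = Poly_Mapping.single i 1 + Poly_Mapping.single j 1" if "m \<in> Poly_Mapping.keys p" for m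
    using p that monom_degree_2E unfolding homogeneous_iff by metis
  then obtain \<alpha> \<beta> where \<alpha>\<beta>: "\<And>m. m \<in> Poly_Mapping.keys p \<Longrightarrow>
      m = Poly_Mapping.single (\<alpha> m) 1 + Poly_Mapping.single (\<beta> m) 1"
    by metis
  define c where "c m = Poly_Mapping.lookup p m" for m
  define B where "B i j = (\<Sum>m\<in>Poly_Mapping.keys p. c m *
    ((if \<alpha> m = i then 1 else 0) * (if \<beta> m = j then 1 else 0) +
     (if \<alpha> m = j then 1 else 0) * (if \<beta> m = i then 1 else 0)) / 2)" for i j
  have "B i j = B j i" for i j
    unfolding B_def by (intro sum.cong) auto
  moreover have "poly_eval p x = quad_form F B x" if x: "x \<in> coord_span F" and F: "finite F" for x F
  proof -
    have \<delta>: "(\<Sum>i\<in>F. (if k = i then 1 else 0) * x i) = x k" for k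
      using x F by (cases "k \<in> F") (auto simp: coord_span_def if_distrib[of "\<lambda>c. c * _"] cong: if_cong)
    have "quad_form F B x = (\<Sum>i\<in>F. \<Sum>j\<in>F. \<Sum>m\<in>Poly_Mapping.keys p. c m *
        ((if \<alpha> m = i then 1 else 0) * (if \<beta> m = j then 1 else 0) +
         (if \<alpha> m = j then 1 else 0) * (if \<beta> m = i then 1 else 0)) / 2 * x i * x j)"
      by (simp add: quad_form_def B_def sum_distrib_right)
    also have "\<dots> = (\<Sum>i\<in>F. \<Sum>m\<in>Poly_Mapping.keys p. \<Sum>j\<in>F. c m *
        ((if \<alpha> m = i then 1 else 0) * (if \<beta> m = j then 1 else 0) +
         (if \<alpha> m = j then 1 else 0) * (if \<beta> m = i then 1 else 0)) / 2 * x i * x j)"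
      by (intro sum.cong refl sum.swap)
    also have "\<dots> = (\<Sum>m\<in>Poly_Mapping.keys p. \<Sum>i\<in>F. \<Sum>j\<in>F. c m *
        ((if \<alpha> m = i then 1 else 0) * (if \<beta> m = j then 1 else 0) +
         (if \<alpha> m = j then 1 else 0) * (if \<beta> m = i then 1 else 0)) / 2 * x i * x j)"
      by (rule sum.swap)
    also have "\<dots> = (\<Sum>m\<in>Poly_Mapping.keys p. c m * (x (\<alpha> m) * x (\<beta> m)))"
    proof (intro sum.cong refl)
      fix m
      define f g where "f i = (if \<alpha> m = i then 1 else 0 :: real)" "g i = (if \<beta> m = i then 1 else 0 :: real)" for i
      have fg: "(\<Sum>i\<in>F. f i * x i) = x (\<alpha> m)" "(\<Sum>i\<in>F. g i * x i) = x (\<beta> m)"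
        unfolding f_g_def by (rule \<delta>)+
      have "(\<Sum>i\<in>F. \<Sum>j\<in>F. c m * (f i * g j + f j * g i) / 2 * x i * x j) =
          c m / 2 * (\<Sum>i\<in>F. \<Sum>j\<in>F. (f i * x i) * (g j * x j) + (g i * x i) * (f j * x j))"
        unfolding sum_distrib_left by (intro sum.cong refl) (simp add: algebra_simps)
      also have "\<dots> = c m * (x (\<alpha> m) * x (\<beta> m))"
        by (simp add: sum.distrib fg flip: sum_product)
      finally show "(\<Sum>i\<in>F. \<Sum>j\<in>F. c m *
          ((if \<alpha> m = i then 1 else 0) * (if \<beta> m = j then 1 else 0) +
           (if \<alpha> m = j then 1 else 0) * (if \<beta> m = i then 1 else 0)) / 2 * x i * x j) =
          c m * (x (\<alpha> m) * x (\<beta> m))"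
        unfolding f_g_def .
    qed
    also have "\<dots> = poly_eval p x"
      unfolding poly_eval_eq c_def
      by (intro sum.cong refl) (metis \<alpha>\<beta> monom_single(1) monom_value_add)
    finally show ?thesis ..
  qed
  ultimately show ?thesis
    by blast
qed

lemma monom_value_indicator:
  "monom_value m (\<lambda>i. if i \<in> S then 1 else 0) = (if Poly_Mapping.keys m \<subseteq> S then 1 else 0)"
proof (cases "Poly_Mapping.keys m \<subseteq> S")
  case True
  then show ?thesis
    unfolding monom_value_def by (auto intro!: prod.neutral)
next
  case False
  then obtain i where "i \<in> Poly_Mapping.keys m" "i \<notin> S"
    by blast
  then show ?thesis
    using False unfolding monom_value_def by (auto simp: in_keys_iff intro!: prod_zero bexI[of _ i])
qed

text \<open>The coefficients of a quadratic form are recovered from its values at the indicator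
  functions of vertices and of edges.\<close>

lemma quadratic_form_vanishing:
  assumes p: "homogeneous 2 p" and D: "\<And>F G. F \<in> D \<Longrightarrow> G \<subseteq> F \<Longrightarrow> G \<in> D"
    and zero: "\<And>F x. F \<in> D \<Longrightarrow> x \<in> coord_span F \<Longrightarrow> poly_eval p x = 0"
    and m: "m \<in> Poly_Mapping.keys p"
  shows "Poly_Mapping.keys m \<notin> D"
proof
  assume mD: "Poly_Mapping.keys m \<in> D"
  define e where "e i = Poly_Mapping.single i (1::nat)" for i :: 'a
  have keys_e: "Poly_Mapping.keys (e i + e j) = {i, j}" for i j
    by (auto simp: e_def keys_add_nat)
  have deg2: "\<exists>i j. n = e i + e j" if "n \<in> Poly_Mapping.keys p" for n
    using p that monom_degree_2E unfolding homogeneous_iff e_def by metis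
  have sum0: "(\<Sum>n\<in>{n \<in> Poly_Mapping.keys p. Poly_Mapping.keys n \<subseteq> S}. Poly_Mapping.lookup p n) = 0"
    if "S \<in> D" for S
  proof -
    have "poly_eval p (\<lambda>i. if i \<in> S then 1 else 0) = 0"
      using zero[OF that] by (auto simp: coord_span_def)
    then show ?thesis
      by (simp add: poly_eval_eq monom_value_indicator sum.If_cases Int_def if_distrib cong: if_cong)
  qed
  \<comment> \<open>Squares come first: they also contribute to the value at the indicator of
    \<open>{i, j}\<close>, and only without them does the mixed coefficient stand alone.\<close>
  have square: "e i + e i \<notin> Poly_Mapping.keys p" if "{i} \<in> D" for i
  proof
    assume i: "e i + e i \<in> Poly_Mapping.keys p"
    have "{n \<in> Poly_Mapping.keys p. Poly_Mapping.keys n \<subseteq> {i}} = {e i + e i}"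
      using deg2 i keys_e by fastforce
    then show False
      using sum0[OF that] i by (simp add: in_keys_iff)
  qed
  obtain i j where ij: "m = e i + e j"
    using deg2[OF m] by blast
  then have D2: "{i, j} \<in> D"
    using mD keys_e by simp
  have "{n \<in> Poly_Mapping.keys p. Poly_Mapping.keys n \<subseteq> {i, j}} = {m}"
  proof
    show "{n \<in> Poly_Mapping.keys p. Poly_Mapping.keys n \<subseteq> {i, j}} \<subseteq> {m}"
    proof
      fix n assume n: "n \<in> {n \<in> Poly_Mapping.keys p. Poly_Mapping.keys n \<subseteq> {i, j}}"
      then obtain k l where kl: "n = e k + e l"
        using deg2 by blast
      then have "k \<in> {i, j}" "l \<in> {i, j}"
        using n keys_e[of k l] by auto
      moreover have "n \<noteq> e i + e i" "n \<noteq> e j + e j"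
        using n square D[OF D2] by auto
      ultimately show "n \<in> {m}"
        using kl ij by (auto simp: add.commute)
    qed
    show "{m} \<subseteq> {n \<in> Poly_Mapping.keys p. Poly_Mapping.keys n \<subseteq> {i, j}}"
      using m ij keys_e by simp
  qed
  then show False
    using sum0[OF D2] m by (simp add: in_keys_iff)
qed

section \<open>The ideal of nonface monomials and its quotient\<close>

lemma poly_ring_simps [simp]:
  "p \<otimes>\<^bsub>poly_ring V\<^esub> q = p * q" "p \<oplus>\<^bsub>poly_ring V\<^esub> q = p + q"
  "\<zero>\<^bsub>poly_ring V\<^esub> = 0" "\<one>\<^bsub>poly_ring V\<^esub> = 1"
  by (simp_all add: poly_ring_def)

lemma carrier_poly_ring:
  "p \<in> carrier (poly_ring V) \<longleftrightarrow> (\<forall>m\<in>Poly_Mapping.keys p. Poly_Mapping.keys m \<subseteq> V)"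
  by (simp add: poly_ring_def)

lemma poly_ring_closed:
  assumes "p \<in> carrier (poly_ring V)" "q \<in> carrier (poly_ring V)"
  shows "p + q \<in> carrier (poly_ring V)" "p * q \<in> carrier (poly_ring V)"
    "- p \<in> carrier (poly_ring V)" "p - q \<in> carrier (poly_ring V)"
proof -
  show "p + q \<in> carrier (poly_ring V)"
    using assms keys_add[of p q] unfolding carrier_poly_ring by blast
  show "p * q \<in> carrier (poly_ring V)"
    unfolding carrier_poly_ring
  proof
    fix m assume "m \<in> Poly_Mapping.keys (p * q)"
    then obtain a b where "m = a + b" "a \<in> Poly_Mapping.keys p" "b \<in> Poly_Mapping.keys q"
      using keys_mult[of p q] by blast
    then show "Poly_Mapping.keys m \<subseteq> V"
      using assms by (auto simp: carrier_poly_ring keys_add_nat)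
  qed
  have neg: "- r \<in> carrier (poly_ring V)" if "r \<in> carrier (poly_ring V)" for r
    using that by (auto simp: carrier_poly_ring in_keys_iff)
  then show "- p \<in> carrier (poly_ring V)"
    using assms(1) .
  show "p - q \<in> carrier (poly_ring V)"
    using assms(1) neg[OF assms(2)] keys_add[of p "- q"] unfolding carrier_poly_ring by auto
qed

lemma poly_ring_const_one:
  "0 \<in> carrier (poly_ring V)" "1 \<in> carrier (poly_ring V)" "const_poly c \<in> carrier (poly_ring V)"
  by (auto simp: carrier_poly_ring const_poly_def)

lemma cring_poly_ring: "cring (poly_ring V)"
proof (rule cringI)
  show "abelian_group (poly_ring V)"
  proof (rule abelian_groupI)
    show "\<exists>y\<in>carrier (poly_ring V). y \<oplus>\<^bsub>poly_ring V\<^esub> x = \<zero>\<^bsub>poly_ring V\<^esub>"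
      if "x \<in> carrier (poly_ring V)" for x
      using poly_ring_closed(3)[OF that that] by (intro bexI[of _ "- x"]) auto
  qed (auto simp: poly_ring_closed poly_ring_const_one algebra_simps)
  show "Group.comm_monoid (poly_ring V)"
    by (rule comm_monoidI) (auto simp: poly_ring_closed poly_ring_const_one algebra_simps)
qed (auto simp: algebra_simps)

lemma a_minus_poly_ring:
  assumes "p \<in> carrier (poly_ring V)" "q \<in> carrier (poly_ring V)"
  shows "p \<ominus>\<^bsub>poly_ring V\<^esub> q = p - q"
proof -
  interpret cring "poly_ring V"
    by (rule cring_poly_ring)
  have "\<ominus>\<^bsub>poly_ring V\<^esub> q = - q"
    using poly_ring_closed(3)[OF assms(2,2)] assms(2) by (intro minus_equality) auto
  then show ?thesis
    by (simp add: a_minus_def)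
qed

lemma prod_var:
  assumes "finite S"
  shows "(\<Prod>i\<in>S. var i) = Poly_Mapping.single (\<Sum>i\<in>S. Poly_Mapping.single i 1) 1"
  using assms by (induction S rule: finite_induct) (auto simp: var_def mult_single)

lemma lookup_sum_single:
  "finite S \<Longrightarrow> Poly_Mapping.lookup (\<Sum>i\<in>S. Poly_Mapping.single i (1::nat)) k = (if k \<in> S then 1 else 0)"
  by (auto simp: lookup_sum lookup_single when_def)

text \<open>Subtraction of exponents is truncated, but exact here because every exponent on the
  support is at least \<open>1\<close>.\<close>

lemma monom_split_support:
  "(m - (\<Sum>i\<in>Poly_Mapping.keys m. Poly_Mapping.single i 1)) +
    (\<Sum>i\<in>Poly_Mapping.keys m. Poly_Mapping.single i 1) = m" for m :: "'v \<Rightarrow>\<^sub>0 nat"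
proof (rule poly_mapping_eqI)
  fix k
  have ge: "k \<in> Poly_Mapping.keys m \<Longrightarrow> Poly_Mapping.lookup m k \<ge> 1"
    by (simp add: in_keys_iff)
  show "Poly_Mapping.lookup ((m - (\<Sum>i\<in>Poly_Mapping.keys m. Poly_Mapping.single i 1)) +
      (\<Sum>i\<in>Poly_Mapping.keys m. Poly_Mapping.single i 1)) k = Poly_Mapping.lookup m k"
    unfolding lookup_add lookup_minus lookup_sum_single[OF finite_keys] using ge by simp
qed

context finite_complex
begin

abbreviation R where "R \<equiv> poly_ring (vertices D)"

definition nonface_polys :: "'v rpoly set" where
  "nonface_polys = {p \<in> carrier R. \<forall>m\<in>Poly_Mapping.keys p. Poly_Mapping.keys m \<notin> D}"

text \<open>Multiplication enlarges the support of a monomial, and a set that contains a nonface is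
  a nonface.\<close>

lemma ideal_nonface_polys: "ideal nonface_polys R"
proof (rule idealI)
  interpret cring R
    by (rule cring_poly_ring)
  show "ring R"
    by (rule ring_axioms)
  have add: "p + q \<in> nonface_polys" if "p \<in> nonface_polys" "q \<in> nonface_polys" for p q
    using that poly_ring_closed(1)[of p "vertices D" q] keys_add[of p q]
    unfolding nonface_polys_def by blast
  have neg: "- p \<in> nonface_polys" if "p \<in> nonface_polys" for p
    using that poly_ring_closed(3)[of p "vertices D" p] unfolding nonface_polys_def
    by (auto simp: in_keys_iff)
  show "subgroup nonface_polys (add_monoid R)"
  proof (rule group.subgroupI[OF a_group])
    show "nonface_polys \<subseteq> carrier (add_monoid R)"
      by (auto simp: nonface_polys_def)
    have "0 \<in> nonface_polys"
      by (simp add: nonface_polys_def poly_ring_const_one)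
    then show "nonface_polys \<noteq> {}"
      by blast
    show "inv\<^bsub>add_monoid R\<^esub> p \<in> nonface_polys" if "p \<in> nonface_polys" for p
    proof -
      have p: "p \<in> carrier R"
        using that by (simp add: nonface_polys_def)
      have "\<ominus>\<^bsub>R\<^esub> p = - p"
        using a_minus_poly_ring[OF zero_closed p] p by (simp add: a_minus_def)
      then show ?thesis
        using neg[OF that] by (simp add: a_inv_def)
    qed
    show "p \<otimes>\<^bsub>add_monoid R\<^esub> q \<in> nonface_polys" if "p \<in> nonface_polys" "q \<in> nonface_polys" for p q
      using add[OF that] by simp
  qed
  have mult: "q * p \<in> nonface_polys" if p: "p \<in> nonface_polys" and q: "q \<in> carrier R" for p q
  proof -
    have "Poly_Mapping.keys m \<notin> D" if m: "m \<in> Poly_Mapping.keys (q * p)" for m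
    proof -
      obtain a b where "m = a + b" "b \<in> Poly_Mapping.keys p"
        using m keys_mult[of q p] by blast
      then show ?thesis
        using p subface[of "Poly_Mapping.keys m" "Poly_Mapping.keys b"]
        by (auto simp: nonface_polys_def keys_add_nat)
    qed
    then show ?thesis
      using p q poly_ring_closed(2)[of q "vertices D" p] by (auto simp: nonface_polys_def)
  qed
  show "q \<otimes>\<^bsub>R\<^esub> p \<in> nonface_polys" "p \<otimes>\<^bsub>R\<^esub> q \<in> nonface_polys"
    if "p \<in> nonface_polys" "q \<in> carrier R" for p q
    using mult[OF that] by (simp_all add: mult.commute)
qed

text \<open>This replaces generation by a test on supports. A monomial whose support is not a face
  is a multiple of the generator that belongs to this support; the cofactor has each exponent on the
  support lowered by one.\<close>

lemma sr_ideal_eq: "sr_ideal D = nonface_polys"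
proof
  interpret cring R
    by (rule cring_poly_ring)
  define G where "G = {(\<Prod>i\<in>S. var i) | S. S \<subseteq> vertices D \<and> S \<notin> D}"
  have "(\<Prod>i\<in>S. var i) \<in> nonface_polys" if "S \<subseteq> vertices D" "S \<notin> D" for S
  proof -
    have fin: "finite S"
      using that(1) finite_vertices finite_subset by blast
    have "Poly_Mapping.keys (\<Sum>i\<in>S. Poly_Mapping.single i (1::nat)) = S"
      by (auto simp: in_keys_iff lookup_sum_single[OF fin, unfolded One_nat_def] split: if_splits)
    then show ?thesis
      using that by (simp add: nonface_polys_def carrier_poly_ring prod_var[OF fin])
  qed
  then have G: "G \<subseteq> nonface_polys"
    by (auto simp: G_def)
  then have GR: "G \<subseteq> carrier R"
    by (auto simp: nonface_polys_def)
  show "sr_ideal D \<subseteq> nonface_polys"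
    unfolding sr_ideal_def using genideal_minimal[OF ideal_nonface_polys G] by (simp add: G_def)
  interpret I: ideal "genideal R G" R
    by (rule genideal_ideal[OF GR])
  have monomial: "Poly_Mapping.single m c \<in> genideal R G"
    if m: "Poly_Mapping.keys m \<subseteq> vertices D" "Poly_Mapping.keys m \<notin> D" for m c
  proof -
    define \<sigma> where "\<sigma> = (\<Sum>i\<in>Poly_Mapping.keys m. Poly_Mapping.single i (1::nat))"
    have "(\<Prod>i\<in>Poly_Mapping.keys m. var i) \<in> genideal R G"
      using m genideal_self[OF GR] by (auto simp: G_def)
    moreover have "Poly_Mapping.keys (m - \<sigma>) \<subseteq> Poly_Mapping.keys m"
      by (auto simp: in_keys_iff lookup_minus)
    then have "Poly_Mapping.single (m - \<sigma>) c \<in> carrier R"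
      using m(1) by (auto simp: carrier_poly_ring)
    ultimately have "Poly_Mapping.single (m - \<sigma>) c * (\<Prod>i\<in>Poly_Mapping.keys m. var i) \<in> genideal R G"
      using I.I_l_closed by force
    then show ?thesis
      using monom_split_support[of m] by (simp add: prod_var mult_single \<sigma>_def)
  qed
  have sum_closed: "sum f A \<in> genideal R G" if "finite A" "\<And>a. a \<in> A \<Longrightarrow> f a \<in> genideal R G"
    for A and f :: "('v \<Rightarrow>\<^sub>0 nat) \<Rightarrow> 'v rpoly"
    using that
  proof (induction A rule: finite_induct)
    case empty
    then show ?case
      using I.zero_closed by simp
  next
    case (insert a A)
    then show ?case
      using I.a_closed[of "f a" "sum f A"] by simp
  qed
  show "nonface_polys \<subseteq> sr_ideal D"
  proof
    fix p assume p: "p \<in> nonface_polys"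
    have "(\<Sum>m\<in>Poly_Mapping.keys p. Poly_Mapping.single m (Poly_Mapping.lookup p m)) \<in> genideal R G"
      using p by (intro sum_closed monomial) (auto simp: nonface_polys_def carrier_poly_ring)
    then show "p \<in> sr_ideal D"
      unfolding sr_ideal_def G_def poly_eq_sum_monomials[symmetric] .
  qed
qed

lemma sr_ring_hom: "ring_hom_cring R (sr_ring D) (sr_class D)"
proof -
  interpret ideal nonface_polys R
    by (rule ideal_nonface_polys)
  have "ring_hom_cring R (R Quot nonface_polys) ((+>\<^bsub>R\<^esub>) nonface_polys)"
    using rcos_ring_hom_cring cring_poly_ring by blast
  moreover have "sr_class D = (+>\<^bsub>R\<^esub>) nonface_polys"
    by (rule ext) (simp add: sr_class_def sr_ideal_eq)
  ultimately show ?thesis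
    by (simp add: sr_ring_def sr_ideal_eq)
qed

lemma sr_class_eq_iff:
  assumes "p \<in> carrier R" "q \<in> carrier R"
  shows "sr_class D p = sr_class D q \<longleftrightarrow> p - q \<in> nonface_polys"
  using ring.quotient_eq_iff_same_a_r_cos[OF cring.axioms(1)[OF cring_poly_ring] ideal_nonface_polys assms]
  by (simp add: sr_class_def sr_ideal_eq a_minus_poly_ring[OF assms])

lemma poly_eval_nonface:
  assumes "p \<in> nonface_polys" "F \<in> D" "x \<in> coord_span F"
  shows "poly_eval p x = 0"
  unfolding poly_eval_eq
proof (rule sum.neutral, intro ballI)
  fix m assume "m \<in> Poly_Mapping.keys p"
  then have "\<not> Poly_Mapping.keys m \<subseteq> F"
    using assms(1,2) subface by (auto simp: nonface_polys_def)
  then obtain i where i: "i \<in> Poly_Mapping.keys m" "i \<notin> F"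
    by blast
  then have "x i ^ Poly_Mapping.lookup m i = 0"
    using assms(3) by (auto simp: coord_span_def in_keys_iff)
  then have "monom_value m x = 0"
    unfolding monom_value_def using i(1) by (intro prod_zero) auto
  then show "Poly_Mapping.lookup p m * monom_value m x = 0"
    by simp
qed

lemma sr_eval_class:
  assumes p: "p \<in> carrier R" and F: "F \<in> D" "x \<in> coord_span F"
  shows "sr_eval (sr_class D p) x = poly_eval p x"
proof -
  interpret cring R
    by (rule cring_poly_ring)
  interpret I: ideal nonface_polys R
    by (rule ideal_nonface_polys)
  have cls: "sr_class D p = {h + p | h. h \<in> nonface_polys}"
    by (auto simp: sr_class_def sr_ideal_eq a_r_coset_def')
  then have "p \<in> sr_class D p"
    using I.zero_closed by force
  then have "(SOME q. q \<in> sr_class D p) \<in> sr_class D p"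
    by (rule someI)
  then obtain h where h: "h \<in> nonface_polys" "(SOME q. q \<in> sr_class D p) = h + p"
    using cls by blast
  then show ?thesis
    using poly_eval_nonface[OF h(1) F] by (simp add: sr_eval_def poly_eval_add)
qed

lemma sr_partE:
  assumes "q \<in> sr_part k D"
  obtains p where "p \<in> carrier R" "homogeneous k p" "q = sr_class D p"
    "\<And>F x. F \<in> D \<Longrightarrow> x \<in> coord_span F \<Longrightarrow> sr_eval q x = poly_eval p x"
  using assms sr_eval_class unfolding sr_part_def by blast

lemma sr_zero: "\<zero>\<^bsub>sr_ring D\<^esub> = sr_class D 0"
  using ring_hom_cring.hom_zero[OF sr_ring_hom] by simp

lemma sr_eval_zero:
  assumes "F \<in> D" "x \<in> coord_span F"
  shows "sr_eval \<zero>\<^bsub>sr_ring D\<^esub> x = 0"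
  using sr_eval_class[OF poly_ring_const_one(1) assms] by (simp add: sr_zero)

lemma sr_eval_add:
  assumes "q \<in> sr_part k D" "r \<in> sr_part k D" "F \<in> D" "x \<in> coord_span F"
  shows "sr_eval (q \<oplus>\<^bsub>sr_ring D\<^esub> r) x = sr_eval q x + sr_eval r x"
proof -
  interpret ring_hom_cring R "sr_ring D" "sr_class D"
    by (rule sr_ring_hom)
  obtain p where p: "p \<in> carrier R" "q = sr_class D p" "sr_eval q x = poly_eval p x"
    using sr_partE[OF assms(1)] assms(3,4) by metis
  obtain s where s: "s \<in> carrier R" "r = sr_class D s" "sr_eval r x = poly_eval s x"
    using sr_partE[OF assms(2)] assms(3,4) by metis
  have "q \<oplus>\<^bsub>sr_ring D\<^esub> r = sr_class D (p + s)"
    using p s hom_add[of p s] by simp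
  then show ?thesis
    using p s sr_eval_class[OF poly_ring_closed(1)[OF p(1) s(1)] assms(3,4)]
    by (simp add: poly_eval_add)
qed

text \<open>The bridge from values back to the ring: the combination \<open>t\<close> is quadratic
  and vanishes on all faces, so its monomials have nonface supports and its class is zero.\<close>

lemma not_sr_lin_indep:
  assumes q: "q \<in> sr_part 2 D" and r: "r \<in> sr_part 2 D"
    and eq: "\<And>F x. F \<in> D \<Longrightarrow> x \<in> coord_span F \<Longrightarrow> a * sr_eval q x = b * sr_eval r x"
    and nz: "a \<noteq> 0 \<or> b \<noteq> 0"
  shows "\<not> sr_lin_indep D q r"
proof -
  interpret ring_hom_cring R "sr_ring D" "sr_class D"
    by (rule sr_ring_hom)
  obtain p where p: "p \<in> carrier R" "homogeneous 2 p" "q = sr_class D p"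
      "\<And>F x. F \<in> D \<Longrightarrow> x \<in> coord_span F \<Longrightarrow> sr_eval q x = poly_eval p x"
    using sr_partE[OF q] by blast
  obtain s where s: "s \<in> carrier R" "homogeneous 2 s" "r = sr_class D s"
      "\<And>F x. F \<in> D \<Longrightarrow> x \<in> coord_span F \<Longrightarrow> sr_eval r x = poly_eval s x"
    using sr_partE[OF r] by blast
  define t where "t = const_poly a * p - const_poly b * s"
  have cs: "const_poly a * p \<in> carrier R" "const_poly b * s \<in> carrier R"
    using p(1) s(1) by (simp_all add: poly_ring_closed poly_ring_const_one)
  have t: "t \<in> carrier R" "homogeneous 2 t"
    unfolding t_def using p s cs by (auto intro: poly_ring_closed homogeneous_diff homogeneous_const_mult)
  have "poly_eval t x = 0" if "F \<in> D" "x \<in> coord_span F" for F x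
    using eq[OF that] p(4)[OF that] s(4)[OF that] by (simp add: t_def poly_eval_diff poly_eval_const_mult)
  then have "Poly_Mapping.keys m \<notin> D" if "m \<in> Poly_Mapping.keys t" for m
    using quadratic_form_vanishing[OF t(2) _ _ that, of D] subface by blast
  then have "t - 0 \<in> nonface_polys"
    using t(1) by (simp add: nonface_polys_def)
  then have "sr_class D t = sr_class D 0"
    using sr_class_eq_iff[OF t(1) poly_ring_const_one(1)] by blast
  moreover have "sr_scale D a q \<oplus>\<^bsub>sr_ring D\<^esub> sr_scale D (- b) r =
      sr_class D (const_poly a * p + const_poly (- b) * s)"
  proof -
    have "sr_scale D a q = sr_class D (const_poly a * p)"
      using hom_mult[OF poly_ring_const_one(3) p(1)] by (simp add: sr_scale_def p(3))
    moreover have "sr_scale D (- b) r = sr_class D (const_poly (- b) * s)"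
      using hom_mult[OF poly_ring_const_one(3) s(1)] by (simp add: sr_scale_def s(3))
    ultimately show ?thesis
      using hom_add[OF poly_ring_closed(2)[OF poly_ring_const_one(3) p(1)]
          poly_ring_closed(2)[OF poly_ring_const_one(3) s(1)]] by simp
  qed
  moreover have "const_poly a * p + const_poly (- b) * s = t"
    by (simp add: t_def const_poly_def single_uminus)
  ultimately show ?thesis
    unfolding sr_lin_indep_def sr_zero[symmetric] using nz by (metis neg_equal_0_iff_equal)
qed

text \<open>The sum in the quotient ring is lifted summand by summand to a sum of squares of linear
  polynomials, whose values on the faces can be read off.\<close>

lemma sos_eval:
  assumes "q \<in> sos_cone D"
  shows "\<exists>k a. \<forall>F\<in>D. \<forall>x\<in>coord_span F. sr_eval q x = (\<Sum>j<(k::nat). (\<Sum>i\<in>vertices D. a j i * x i)\<^sup>2)"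
proof -
  interpret ring_hom_cring R "sr_ring D" "sr_class D"
    by (rule sr_ring_hom)
  obtain k :: nat and l where q: "q = (\<Oplus>\<^bsub>sr_ring D\<^esub> j\<in>{..<k}. l j \<otimes>\<^bsub>sr_ring D\<^esub> l j)"
      "\<forall>j<k. l j \<in> sr_part 1 D"
    using assms unfolding sos_cone_def by blast
  have "\<forall>j<k. \<exists>p. p \<in> carrier R \<and> homogeneous 1 p \<and> l j = sr_class D p"
    using q(2) by (auto simp: sr_part_def)
  then obtain p where p: "\<And>j. j < k \<Longrightarrow> p j \<in> carrier R \<and> homogeneous 1 (p j) \<and> l j = sr_class D (p j)"
    by metis
  have "(\<Sum>j<n. p j * p j) \<in> carrier R \<and>
      (\<Oplus>\<^bsub>sr_ring D\<^esub> j\<in>{..<n}. l j \<otimes>\<^bsub>sr_ring D\<^esub> l j) = sr_class D (\<Sum>j<n. p j * p j)" if "n \<le> k" for n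
    using that
  proof (induction n)
    case 0
    then show ?case
      by (simp add: poly_ring_const_one sr_zero)
  next
    case (Suc n)
    have pn: "p n \<in> carrier R" "l n = sr_class D (p n)"
      using p[of n] Suc.prems by auto
    have pp: "p n * p n \<in> carrier R" "l n \<otimes>\<^bsub>sr_ring D\<^esub> l n = sr_class D (p n * p n)"
      using pn poly_ring_closed(2)[OF pn(1,1)] hom_mult[of "p n" "p n"] by auto
    have IH: "(\<Sum>j<n. p j * p j) \<in> carrier R"
        "(\<Oplus>\<^bsub>sr_ring D\<^esub> j\<in>{..<n}. l j \<otimes>\<^bsub>sr_ring D\<^esub> l j) = sr_class D (\<Sum>j<n. p j * p j)"
      using Suc by auto
    have closed: "l j \<otimes>\<^bsub>sr_ring D\<^esub> l j \<in> carrier (sr_ring D)" if "j < k" for j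
      using p[OF that] by (auto intro: S.m_closed)
    have "(\<Oplus>\<^bsub>sr_ring D\<^esub> j\<in>{..<Suc n}. l j \<otimes>\<^bsub>sr_ring D\<^esub> l j) =
        l n \<otimes>\<^bsub>sr_ring D\<^esub> l n \<oplus>\<^bsub>sr_ring D\<^esub> (\<Oplus>\<^bsub>sr_ring D\<^esub> j\<in>{..<n}. l j \<otimes>\<^bsub>sr_ring D\<^esub> l j)"
      unfolding lessThan_Suc using closed Suc.prems by (intro S.finsum_insert) auto
    also have "\<dots> = sr_class D (p n * p n + (\<Sum>j<n. p j * p j))"
      using pp IH hom_add[OF pp(1) IH(1)] by simp
    finally show ?case
      using poly_ring_closed(1)[OF pp(1) IH(1)] by (simp add: add.commute)
  qed
  then have q_class: "(\<Sum>j<k. p j * p j) \<in> carrier R" "q = sr_class D (\<Sum>j<k. p j * p j)"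
    using q(1) by auto
  have "\<forall>j<k. \<exists>a. \<forall>x. poly_eval (p j) x = (\<Sum>i\<in>vertices D. a i * x i)"
    using p linear_form_exists finite_vertices by blast
  then obtain a where a: "\<And>j x. j < k \<Longrightarrow> poly_eval (p j) x = (\<Sum>i\<in>vertices D. a j i * x i)"
    by metis
  have "sr_eval q x = (\<Sum>j<k. (\<Sum>i\<in>vertices D. a j i * x i)\<^sup>2)" if "F \<in> D" "x \<in> coord_span F" for F x
    using sr_eval_class[OF q_class(1) that] a
    by (simp add: q_class(2) poly_eval_sum poly_eval_mult power2_eq_square)
  then show ?thesis
    by blast
qed

lemma quad_form_in_sr_part:
  "\<exists>q\<in>sr_part 2 D. \<forall>F\<in>D. \<forall>x\<in>coord_span F. sr_eval q x = quad_form (vertices D) B x"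
proof -
  define p where "p = (\<Sum>i\<in>vertices D. \<Sum>j\<in>vertices D.
    Poly_Mapping.single (Poly_Mapping.single i 1 + Poly_Mapping.single j (1::nat)) (B i j))"
  have keys: "\<exists>i\<in>vertices D. \<exists>j\<in>vertices D. m = Poly_Mapping.single i 1 + Poly_Mapping.single j 1"
    if "m \<in> Poly_Mapping.keys p" for m
  proof (rule ccontr)
    assume "\<not> ?thesis"
    then have "Poly_Mapping.lookup p m = 0"
      unfolding p_def lookup_sum lookup_single by (intro sum.neutral ballI) (auto simp: when_def)
    then show False
      using that by (simp add: in_keys_iff)
  qed
  have "Poly_Mapping.keys m \<subseteq> vertices D \<and> monom_degree m = 2" if "m \<in> Poly_Mapping.keys p" for m
    using keys[OF that]
    by (auto simp: keys_add_nat monom_degree_add monom_single(2)[unfolded One_nat_def])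
  then have "p \<in> carrier R" "homogeneous 2 p"
    by (simp_all add: carrier_poly_ring homogeneous_iff)
  moreover have "poly_eval p x = quad_form (vertices D) B x" for x
    by (simp add: p_def quad_form_def poly_eval_sum poly_eval_single monom_value_add
        monom_single(1)[unfolded One_nat_def] algebra_simps)
  ultimately show ?thesis
    using sr_eval_class unfolding sr_part_def by (intro bexI[of _ "sr_class D p"]) auto
qed

end

section \<open>The pulled back form\<close>

text \<open>When \<open>card J = d + 1\<close>, the right-hand side is twice the form of
  \<open>sphere_matrix d\<close>, which is therefore nonnegative there and vanishes only at constant
  vectors.\<close>

lemma sum_pairwise_diff_squares:
  fixes y :: "'a \<Rightarrow> real"
  shows "(\<Sum>i\<in>J. \<Sum>j\<in>J. (y i - y j)\<^sup>2) = 2 * (real (card J) * (\<Sum>i\<in>J. (y i)\<^sup>2) - (\<Sum>i\<in>J. y i)\<^sup>2)"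
proof -
  have "(\<Sum>i\<in>J. \<Sum>j\<in>J. (y i - y j)\<^sup>2) =
      (\<Sum>i\<in>J. \<Sum>j\<in>J. (y i)\<^sup>2 + (y j)\<^sup>2 - 2 * (y i * y j))"
    by (intro sum.cong refl) (simp add: power2_eq_square algebra_simps)
  also have "\<dots> = 2 * (real (card J) * (\<Sum>i\<in>J. (y i)\<^sup>2)) - 2 * (\<Sum>i\<in>J. \<Sum>j\<in>J. y i * y j)"
    by (simp add: sum.distrib sum_subtractf sum_distrib_left)
  also have "(\<Sum>i\<in>J. \<Sum>j\<in>J. y i * y j) = (\<Sum>i\<in>J. y i)\<^sup>2"
    by (simp add: power2_eq_square sum_product)
  finally show ?thesis
    by simp
qed

lemma quad_form_coord_span:
  assumes "finite V" "F \<subseteq> V" "x \<in> coord_span F"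
  shows "quad_form V B x = quad_form F B x"
proof -
  have "(\<Sum>i\<in>V. \<Sum>j\<in>V. B i j * x i * x j) = (\<Sum>i\<in>V. \<Sum>j\<in>F. B i j * x i * x j)"
    using assms by (intro sum.cong refl sum.mono_neutral_right) (auto simp: coord_span_def)
  also have "\<dots> = (\<Sum>i\<in>F. \<Sum>j\<in>F. B i j * x i * x j)"
    using assms by (intro sum.mono_neutral_right) (auto simp: coord_span_def)
  finally show ?thesis
    by (simp add: quad_form_def)
qed

lemma quad_form_add:
  assumes "\<And>i j. C i j = C j i"
  shows "quad_form T C (\<lambda>i. w i + t * z i) =
    quad_form T C w + 2 * t * (\<Sum>i\<in>T. \<Sum>j\<in>T. C i j * z i * w j) + t\<^sup>2 * quad_form T C z"
proof -
  have swap: "(\<Sum>i\<in>T. \<Sum>j\<in>T. C i j * w i * z j) = (\<Sum>i\<in>T. \<Sum>j\<in>T. C i j * z i * w j)"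
    by (subst sum.swap, intro sum.cong refl) (simp add: assms mult_ac)
  have "quad_form T C (\<lambda>i. w i + t * z i) = (\<Sum>i\<in>T. \<Sum>j\<in>T. C i j * w i * w j +
      t * (C i j * w i * z j) + t * (C i j * z i * w j) + t\<^sup>2 * (C i j * z i * z j))"
    unfolding quad_form_def by (intro sum.cong refl) (simp add: power2_eq_square algebra_simps)
  also have "\<dots> = quad_form T C w + t * (\<Sum>i\<in>T. \<Sum>j\<in>T. C i j * w i * z j) +
      t * (\<Sum>i\<in>T. \<Sum>j\<in>T. C i j * z i * w j) + t\<^sup>2 * quad_form T C z"
    by (simp add: quad_form_def sum.distrib sum_distrib_left)
  finally show ?thesis
    by (simp add: swap)
qed

lemma constant_along_path:
  assumes "xs \<noteq> []" "\<forall>i. Suc i < length xs \<longrightarrow> f (xs ! i) = f (xs ! Suc i)"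
  shows "f (hd xs) = f (last xs)"
proof -
  have *: "f (xs ! i) = f (xs ! 0)" if "i < length xs" for i
    using that
  proof (induction i)
    case (Suc i)
    have "f (xs ! Suc i) = f (xs ! i)"
      by (rule assms(2)[rule_format, OF Suc.prems, symmetric])
    also have "\<dots> = f (xs ! 0)"
      by (rule Suc.IH[OF Suc_lessD[OF Suc.prems]])
    finally show ?case .
  qed simp
  show ?thesis
    using *[of "length xs - 1"] assms(1) by (simp add: hd_conv_nth last_conv_nth)
qed

text \<open>The matrix of \<open>(d + 1) \<Sum> y\<^sub>i\<^sup>2 - (\<Sum> y\<^sub>i)\<^sup>2\<close>. On \<open>d + 2\<close> variables it has a negative eigenvalue,
  on every \<open>d + 1\<close> of them it is positive semidefinite with kernel spanned by the all-one vector.\<close>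

definition sphere_matrix :: "nat \<Rightarrow> nat \<Rightarrow> nat \<Rightarrow> real" where
  "sphere_matrix d i j = (if i = j then real d else - 1)"

lemma quad_form_sphere_matrix:
  assumes "finite J"
  shows "quad_form J (sphere_matrix d) y = real (d + 1) * (\<Sum>i\<in>J. (y i)\<^sup>2) - (\<Sum>i\<in>J. y i)\<^sup>2"
proof -
  have "quad_form J (sphere_matrix d) y =
      (\<Sum>i\<in>J. \<Sum>j\<in>J. (if i = j then real (d + 1) * (y i)\<^sup>2 else 0) - y i * y j)"
    unfolding quad_form_def
    by (intro sum.cong refl) (auto simp: sphere_matrix_def power2_eq_square algebra_simps)
  also have "\<dots> = (\<Sum>i\<in>J. real (d + 1) * (y i)\<^sup>2) - (\<Sum>i\<in>J. \<Sum>j\<in>J. y i * y j)"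
    using assms by (simp add: sum_subtractf)
  also have "(\<Sum>i\<in>J. \<Sum>j\<in>J. y i * y j) = (\<Sum>i\<in>J. y i)\<^sup>2"
    by (simp add: power2_eq_square sum_product)
  finally show ?thesis
    by (simp add: sum_distrib_left)
qed

section \<open>Pulling the sphere form back along a strongly connected map\<close>

locale sphere_map = finite_complex D for D :: "'v set set" +
  fixes d :: nat and \<phi> :: "'v \<Rightarrow> nat"
  assumes d: "d \<ge> 1" and strong: "strongly_connected_map D (simplicial_sphere d) \<phi>"
begin

definition J :: "nat set" where
  "J = {1..d + 2}"

lemma finite_J [simp]: "finite J" and card_J [simp]: "card J = d + 2"
  by (simp_all add: J_def)

lemma surj: "S \<subseteq> J \<Longrightarrow> card S \<le> d + 1 \<Longrightarrow> \<exists>T\<in>D. \<phi> ` T = S"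
  using strong
  by (simp add: J_def strongly_connected_map_def surjective_simplicial_map_def simplicial_sphere_def)

lemma image_face:
  assumes "F \<in> D"
  shows "\<phi> ` F \<subseteq> J" "card (\<phi> ` F) \<le> d + 1"
  using strong assms
  by (auto simp: strongly_connected_map_def surjective_simplicial_map_def simplicial_map_def
      simplicial_sphere_def J_def)

lemma image_vertex: "v \<in> vertices D \<Longrightarrow> \<phi> v \<in> J"
  using image_face(1) unfolding vertices_def by blast

text \<open>Paths inside a fibre turn a condition on adjacent vertices into a global one, and
  \<open>constant_on_edge_fibers\<close> does the same with chains of edges. The path conditions of
  \<open>strongly_connected_map\<close> enter only through these two lemmas.\<close>

lemma constant_on_vertex_fibers:
  assumes step: "\<And>u v. {u, v} \<in> D \<Longrightarrow> \<phi> u = \<phi> v \<Longrightarrow> f u = f v"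
    and ab: "a \<in> vertices D" "b \<in> vertices D" "\<phi> a = \<phi> b"
  shows "f a = f b"
proof -
  have "{\<phi> b} \<in> simplicial_sphere d"
    using image_vertex[OF ab(2)] by (auto simp: simplicial_sphere_def J_def)
  then have "\<phi> b \<in> vertices (simplicial_sphere d)"
    by (auto simp: vertices_def)
  then obtain xs where xs: "xs \<noteq> []" "hd xs = a" "last xs = b" "\<forall>x\<in>set xs. \<phi> x = \<phi> b"
      "\<forall>i. Suc i < length xs \<longrightarrow> {xs ! i, xs ! Suc i} \<in> D"
    using strong ab unfolding strongly_connected_map_def by metis
  have "f (xs ! i) = f (xs ! Suc i)" if "Suc i < length xs" for i
    using that xs(4,5) by (intro step) auto
  then show ?thesis
    using constant_along_path[OF xs(1), of f] xs(2,3) by simp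
qed

lemma constant_on_edge_fibers:
  assumes step: "\<And>e e'. e \<in> edges D \<Longrightarrow> e' \<in> edges D \<Longrightarrow> \<phi> ` e = \<phi> ` e' \<Longrightarrow> card (\<phi> ` e) = 2 \<Longrightarrow>
      e \<union> e' \<in> D \<Longrightarrow> e \<inter> e' \<noteq> {} \<Longrightarrow> f e = f e'"
    and ab: "a \<in> edges D" "b \<in> edges D" "\<phi> ` a = \<phi> ` b" "card (\<phi> ` b) = 2"
  shows "f a = f b"
proof -
  have "b \<in> D"
    using ab(2) by (simp add: edges_def)
  then have "\<phi> ` b \<in> edges (simplicial_sphere d)"
    using image_face[of b] ab(4) by (auto simp: simplicial_sphere_def edges_def J_def)
  then obtain es where es: "es \<noteq> []" "hd es = a" "last es = b" "set es \<subseteq> edges D"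
      "\<forall>e\<in>set es. \<phi> ` e = \<phi> ` b"
      "\<forall>i. Suc i < length es \<longrightarrow> es ! i \<union> es ! Suc i \<in> D \<and> es ! i \<inter> es ! Suc i \<noteq> {}"
    using strong ab unfolding strongly_connected_map_def by metis
  have "f (es ! i) = f (es ! Suc i)" if i: "Suc i < length es" for i
  proof -
    have "es ! i \<in> set es" "es ! Suc i \<in> set es"
      using i by auto
    then show ?thesis
      using i es(4,5,6) ab(4) by (intro step) auto
  qed
  then show ?thesis
    using constant_along_path[OF es(1), of f] es(2,3) by simp
qed

definition B :: "'v \<Rightarrow> 'v \<Rightarrow> real" where
  "B a b = sphere_matrix d (\<phi> a) (\<phi> b)"

text \<open>The linear map that sends the basis vector of a vertex \<open>a\<close> to that of
  \<open>\<phi> a\<close>; by \<open>Q_push\<close>, \<open>Q\<close> is the sphere form composed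
  with it.\<close>

definition push :: "('v \<Rightarrow> real) \<Rightarrow> nat \<Rightarrow> real" where
  "push x i = (\<Sum>a\<in>{a \<in> vertices D. \<phi> a = i}. x a)"

definition Q :: "('v \<Rightarrow> real) \<Rightarrow> real" where
  "Q x = quad_form (vertices D) B x"

lemma B_sym: "B a b = B b a"
  by (simp add: B_def sphere_matrix_def)

lemma sum_push: "(\<Sum>i\<in>J. g i * push x i) = (\<Sum>a\<in>vertices D. g (\<phi> a) * x a)"
proof -
  have "(\<Sum>i\<in>J. g i * push x i) = (\<Sum>i\<in>J. \<Sum>a\<in>{a \<in> vertices D. \<phi> a = i}. g (\<phi> a) * x a)"
    by (intro sum.cong refl) (simp add: push_def sum_distrib_left)
  also have "\<dots> = (\<Sum>a\<in>vertices D. g (\<phi> a) * x a)"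
    using finite_vertices image_vertex by (intro sum.group) auto
  finally show ?thesis .
qed

lemma Q_push: "Q x = quad_form J (sphere_matrix d) (push x)"
proof -
  have "quad_form J (sphere_matrix d) (push x) =
      (\<Sum>i\<in>J. (\<Sum>j\<in>J. sphere_matrix d i j * push x j) * push x i)"
    unfolding quad_form_def sum_distrib_right by (intro sum.cong refl) (simp add: mult_ac)
  also have "\<dots> = (\<Sum>a\<in>vertices D. (\<Sum>j\<in>J. sphere_matrix d (\<phi> a) j * push x j) * x a)"
    by (rule sum_push)
  also have "\<dots> = (\<Sum>a\<in>vertices D. (\<Sum>b\<in>vertices D. sphere_matrix d (\<phi> a) (\<phi> b) * x b) * x a)"
    by (simp add: sum_push)
  also have "\<dots> = Q x"
    unfolding Q_def quad_form_def B_def sum_distrib_right by (intro sum.cong refl) (simp add: mult_ac)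
  finally show ?thesis ..
qed

text \<open>Without coordinate \<open>t\<close> just \<open>d + 1\<close> variables remain, the
  number for which the form is a sum of squared differences. By \<open>ex_missing\<close> this
  situation occurs on every face.\<close>

lemma Q_missing:
  assumes t: "t \<in> J" "push x t = 0"
  shows "Q x = (\<Sum>i\<in>J - {t}. \<Sum>j\<in>J - {t}. (push x i - push x j)\<^sup>2) / 2"
proof -
  have "card (J - {t}) = d + 1"
    using t(1) by simp
  moreover have "(\<Sum>i\<in>J. (push x i)\<^sup>2) = (\<Sum>i\<in>J - {t}. (push x i)\<^sup>2)"
    "(\<Sum>i\<in>J. push x i) = (\<Sum>i\<in>J - {t}. push x i)"
    using t by (simp_all add: sum.remove[of J t])
  ultimately show ?thesis
    unfolding Q_push by (simp add: quad_form_sphere_matrix sum_pairwise_diff_squares)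
qed

lemma push_zero:
  assumes "x \<in> coord_span F" "i \<notin> \<phi> ` F"
  shows "push x i = 0"
  unfolding push_def using assms by (intro sum.neutral) (auto simp: coord_span_def)

lemma ex_missing:
  assumes "F \<in> D"
  obtains t where "t \<in> J" "t \<notin> \<phi> ` F"
proof -
  have "\<not> J \<subseteq> \<phi> ` F"
    using card_mono[of "\<phi> ` F" J] finite_face[OF assms] image_face(2)[OF assms] by auto
  then show ?thesis
    using that by blast
qed

lemma Q_nonneg:
  assumes F: "F \<in> D" "x \<in> coord_span F"
  shows "0 \<le> Q x"
proof -
  obtain t where t: "t \<in> J" "t \<notin> \<phi> ` F"
    using ex_missing[OF F(1)] .
  show ?thesis
    unfolding Q_missing[OF t(1) push_zero[OF F(2) t(2)]]
    by (intro divide_nonneg_pos sum_nonneg) auto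
qed

lemma Q_face:
  assumes "F \<in> D" "x \<in> coord_span F"
  shows "Q x = quad_form F B x"
  unfolding Q_def using quad_form_coord_span[OF finite_vertices face_subset] assms by blast

text \<open>Such a face has exactly one vertex over each element of \<open>J - {t}\<close>, so on
  its span \<open>push\<close> merely renames coordinates and the zeros of \<open>Q\<close> become
  visible.\<close>

lemma ex_transversal:
  assumes "t \<in> J"
  obtains s where "\<And>i. i \<in> J - {t} \<Longrightarrow> \<phi> (s i) = i" "s ` (J - {t}) \<in> D" "inj_on s (J - {t})"
proof -
  obtain T where T: "T \<in> D" "\<phi> ` T = J - {t}"
    using surj[of "J - {t}"] assms by auto
  then have "\<forall>i\<in>J - {t}. \<exists>a\<in>T. \<phi> a = i"
    by (metis imageE)
  then obtain s where s: "\<And>i. i \<in> J - {t} \<Longrightarrow> s i \<in> T \<and> \<phi> (s i) = i"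
    by metis
  have "inj_on s (J - {t})"
    using s by (metis inj_onI)
  moreover have "s ` (J - {t}) \<in> D"
    using s by (intro subface[OF T(1)]) auto
  ultimately show ?thesis
    using that s by blast
qed

lemma push_transversal:
  assumes s: "\<And>i. i \<in> S \<Longrightarrow> \<phi> (s i) = i" "s ` S \<in> D" and x: "x \<in> coord_span (s ` S)" and i: "i \<in> S"
  shows "push x i = x (s i)"
proof -
  have "s i \<in> vertices D"
    using s(2) i by (auto simp: vertices_def)
  moreover have "x a = 0" if a: "\<phi> a = i" "a \<noteq> s i" for a
  proof -
    have "a \<notin> s ` S"
      using a s(1) by auto
    then show ?thesis
      using x by (auto simp: coord_span_def)
  qed
  ultimately have "push x i = (\<Sum>a\<in>{s i}. x a)"
    unfolding push_def using finite_vertices s(1)[OF i] by (intro sum.mono_neutral_right) auto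
  then show ?thesis
    by simp
qed

lemma Q_transversal_zero:
  assumes t: "t \<in> J" and s: "\<And>i. i \<in> J - {t} \<Longrightarrow> \<phi> (s i) = i" "s ` (J - {t}) \<in> D"
    and x: "x \<in> coord_span (s ` (J - {t}))"
  shows "Q x = 0 \<longleftrightarrow> (\<forall>i\<in>J - {t}. \<forall>j\<in>J - {t}. x (s i) = x (s j))"
proof -
  have "\<phi> ` s ` (J - {t}) = J - {t}"
    using s(1) by (force simp: image_iff)
  then have "push x t = 0"
    using push_zero[OF x] by auto
  then have "Q x = (\<Sum>i\<in>J - {t}. \<Sum>j\<in>J - {t}. (push x i - push x j)\<^sup>2) / 2"
    by (rule Q_missing[OF t])
  also have "\<dots> = (\<Sum>i\<in>J - {t}. \<Sum>j\<in>J - {t}. (x (s i) - x (s j))\<^sup>2) / 2"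
    using push_transversal[OF s x] by simp
  finally have eq: "Q x = (\<Sum>i\<in>J - {t}. \<Sum>j\<in>J - {t}. (x (s i) - x (s j))\<^sup>2) / 2" .
  show ?thesis
    unfolding eq by (simp add: sum_nonneg_eq_0_iff sum_nonneg)
qed

lemma Q_fiber_zero:
  assumes "{u, v} \<in> D" "\<phi> u = \<phi> v"
  shows "Q (\<lambda>i. (if i = u then 1 else 0) - (if i = v then 1 else 0)) = 0"
proof -
  have uv: "u \<in> vertices D" "v \<in> vertices D"
    using assms(1) by (auto simp: vertices_def)
  have "push (\<lambda>i. (if i = u then 1 else 0) - (if i = v then 1 else 0)) j = 0" for j
    using uv finite_vertices assms(2) by (simp add: push_def sum_subtractf)
  then show ?thesis
    by (simp add: Q_push quad_form_def)
qed

end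

text \<open>\<open>C\<close> represents one summand of a decomposition of \<open>Q\<close> into two
  nonnegative forms; the upper bound expresses that the other summand is nonnegative. Entries at
  pairs that are not contained in a face are left unconstrained.\<close>

locale dominated_form = sphere_map D d \<phi> for D :: "'v set set" and d \<phi> +
  fixes C :: "'v \<Rightarrow> 'v \<Rightarrow> real"
  assumes C_sym: "\<And>a b. C a b = C b a"
    and C_nonneg: "\<And>T x. T \<in> D \<Longrightarrow> x \<in> coord_span T \<Longrightarrow> 0 \<le> quad_form T C x"
    and C_le: "\<And>T x. T \<in> D \<Longrightarrow> x \<in> coord_span T \<Longrightarrow> quad_form T C x \<le> Q x"
begin

text \<open>On a face \<open>C\<close> lies between \<open>0\<close> and \<open>Q\<close>, so a zero of \<open>Q\<close> is a minimum of \<open>C\<close>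
  and belongs to its kernel.\<close>

lemma kernel:
  assumes T: "T \<in> D" and z: "z \<in> coord_span T" "Q z = 0" and w: "w \<in> coord_span T"
  shows "(\<Sum>i\<in>T. \<Sum>j\<in>T. C i j * z i * w j) = 0"
proof -
  have z0: "quad_form T C z = 0"
    using C_nonneg[OF T z(1)] C_le[OF T z(1)] z(2) by simp
  have "0 \<le> t * (2 * (\<Sum>i\<in>T. \<Sum>j\<in>T. C i j * z i * w j)) + quad_form T C w" for t
  proof -
    have "(\<lambda>i. w i + t * z i) \<in> coord_span T"
      using z(1) w by (simp add: coord_span_def)
    from C_nonneg[OF T this] show ?thesis
      unfolding quad_form_add[OF C_sym] z0 by (simp add: algebra_simps)
  qed
  then have "2 * (\<Sum>i\<in>T. \<Sum>j\<in>T. C i j * z i * w j) = 0"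
    by (rule affine_nonneg_imp_zero)
  then show ?thesis
    by simp
qed

lemma kernel_vertex:
  assumes T: "T \<in> D" and z: "z \<in> coord_span T" "Q z = 0" and s: "s \<in> T"
  shows "(\<Sum>i\<in>T. C i s * z i) = 0"
proof -
  define w where "w j = (if j = s then 1 else 0 :: real)" for j
  have "(\<Sum>j\<in>T. C i j * z i * w j) = C i s * z i" for i
    using s finite_face[OF T] by (simp add: w_def if_distrib cong: if_cong)
  moreover have "w \<in> coord_span T"
    using s by (auto simp: w_def coord_span_def)
  ultimately show ?thesis
    using kernel[OF T z, of w] by simp
qed

text \<open>The difference of the basis vectors of \<open>u\<close> and \<open>v\<close> is sent to
  \<open>0\<close> by \<open>push\<close>, so it is a zero of \<open>Q\<close> and lies in the
  kernel of \<open>C\<close> on \<open>T\<close>.\<close>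

lemma fiber_rows:
  assumes T: "T \<in> D" "u \<in> T" "v \<in> T" "s \<in> T" and eq: "\<phi> u = \<phi> v"
  shows "C u s = C v s"
proof -
  define z where "z = (\<lambda>i. (if i = u then 1 else 0) - (if i = v then 1 else 0) :: real)"
  have "z \<in> coord_span T"
    using T by (auto simp: z_def coord_span_def)
  moreover have "Q z = 0"
    unfolding z_def using T subface[OF T(1), of "{u, v}"] by (intro Q_fiber_zero eq) auto
  ultimately have "0 = (\<Sum>i\<in>T. C i s * z i)"
    using kernel_vertex[OF T(1) _ _ T(4)] by simp
  also have "\<dots> = (\<Sum>i\<in>T. if i = u then C i s else 0) - (\<Sum>i\<in>T. if i = v then C i s else 0)"
    unfolding z_def sum_subtractf[symmetric] by (intro sum.cong refl) auto
  also have "\<dots> = C u s - C v s"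
    using T finite_face[OF T(1)] by simp
  finally show ?thesis
    by simp
qed

text \<open>For adjacent \<open>u\<close> and \<open>v\<close> in a fibre, \<open>fiber_rows\<close>
  yields \<open>C u u = C v u\<close> and \<open>C u v = C v v\<close>.\<close>

lemma diagonal_constant:
  assumes "a \<in> vertices D" "b \<in> vertices D" "\<phi> a = \<phi> b"
  shows "C a a = C b b"
proof (rule constant_on_vertex_fibers[of "\<lambda>a. C a a", OF _ assms])
  show "C u u = C v v" if "{u, v} \<in> D" "\<phi> u = \<phi> v" for u v
    using fiber_rows[OF that(1), of u v u] fiber_rows[OF that(1), of u v v] that(2) C_sym[of u v]
    by simp
qed

lemma edge_ends:
  assumes "e \<in> edges D" "t \<in> e"
  obtains p where "e = {t, p}" "t \<noteq> p"
proof -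
  have "card e = 2"
    using assms(1) by (simp add: edges_def)
  then obtain x y where "e = {x, y}" "x \<noteq> y"
    by (auto simp: card_2_iff)
  then show ?thesis
    using assms(2) that by (metis insertE insert_commute singletonD)
qed

text \<open>Transport along chains needs a function of the unordered edge, hence the sum of all
  entries instead of \<open>C a b\<close>; the diagonal part is already under control. Consecutive
  edges share an end \<open>t\<close>, their other ends lie in one fibre, and all three are in a
  common face, so \<open>fiber_rows\<close> applies.\<close>

lemma edge_sum_constant:
  assumes "e \<in> edges D" "e' \<in> edges D" "\<phi> ` e = \<phi> ` e'" "card (\<phi> ` e') = 2"
  shows "(\<Sum>i\<in>e. \<Sum>j\<in>e. C i j) = (\<Sum>i\<in>e'. \<Sum>j\<in>e'. C i j)"
proof (rule constant_on_edge_fibers[of "\<lambda>e. \<Sum>i\<in>e. \<Sum>j\<in>e. C i j", OF _ assms])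
  fix e e'
  assume e: "e \<in> edges D" "e' \<in> edges D" "\<phi> ` e = \<phi> ` e'" "card (\<phi> ` e) = 2" "e \<union> e' \<in> D" "e \<inter> e' \<noteq> {}"
  obtain t where t: "t \<in> e" "t \<in> e'"
    using e(6) by blast
  obtain p where p: "e = {t, p}" "t \<noteq> p"
    using edge_ends[OF e(1) t(1)] .
  obtain p' where p': "e' = {t, p'}" "t \<noteq> p'"
    using edge_ends[OF e(2) t(2)] .
  have "\<phi> t \<noteq> \<phi> p"
    using e(4) p(1) by auto
  then have eq: "\<phi> p = \<phi> p'"
    using e(3) p(1) p'(1) by (auto simp: doubleton_eq_iff)
  have "p \<in> vertices D" "p' \<in> vertices D"
    using face_subset[OF e(5)] p(1) p'(1) by auto
  then have "C p p = C p' p'"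
    using diagonal_constant eq by blast
  moreover have "C p t = C p' t"
    using fiber_rows[OF e(5), of p p' t] eq p(1) p'(1) by blast
  ultimately show "(\<Sum>i\<in>e. \<Sum>j\<in>e. C i j) = (\<Sum>i\<in>e'. \<Sum>j\<in>e'. C i j)"
    using p p' C_sym[of t p] C_sym[of t p'] by simp
qed

lemma fiber_constant:
  assumes "{a, b} \<in> D" "{a', b'} \<in> D" and eq: "\<phi> a = \<phi> a'" "\<phi> b = \<phi> b'"
  shows "C a b = C a' b'"
proof -
  have V: "a \<in> vertices D" "b \<in> vertices D" "a' \<in> vertices D" "b' \<in> vertices D"
    using assms(1,2) by (auto simp: vertices_def)
  have diag: "C a a = C a' a'" "C b b = C b' b'"
    using diagonal_constant V eq by blast+
  show ?thesis
  proof (cases "\<phi> a = \<phi> b")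
    case True
    then have "C a b = C b b" "C a' b' = C b' b'"
      using fiber_rows[OF assms(1), of a b b] fiber_rows[OF assms(2), of a' b' b'] eq by auto
    then show ?thesis
      using diag by simp
  next
    case False
    then have ne: "a \<noteq> b" "a' \<noteq> b'"
      using eq by auto
    then have "{a, b} \<in> edges D" "{a', b'} \<in> edges D" "card (\<phi> ` {a', b'}) = 2"
      using assms(1,2) False eq by (auto simp: edges_def)
    then have "(\<Sum>i\<in>{a, b}. \<Sum>j\<in>{a, b}. C i j) = (\<Sum>i\<in>{a', b'}. \<Sum>j\<in>{a', b'}. C i j)"
      using eq by (intro edge_sum_constant) auto
    then show ?thesis
      using diag ne C_sym[of a b] C_sym[of a' b'] by simp
  qed
qed

lemma ex_edge_over:
  assumes "i \<in> J" "j \<in> J"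
  obtains a b where "{a, b} \<in> D" "\<phi> a = i" "\<phi> b = j"
proof -
  have "card {i, j} \<le> d + 1"
    using d card_insert_le_m1[of 2 "{j}" i] by simp
  then obtain T where T: "T \<in> D" "\<phi> ` T = {i, j}"
    using surj[of "{i, j}"] assms by auto
  then obtain a b where "a \<in> T" "b \<in> T" "\<phi> a = i" "\<phi> b = j"
    by (metis imageE insertI1 insertI2)
  then show ?thesis
    using that subface[OF T(1), of "{a, b}"] by auto
qed

text \<open>\<open>C\<close> descends to a matrix \<open>\<beta>\<close> on \<open>J\<close>. The
  all-one vector on a transversal that misses \<open>t\<close> makes the entries of column
  \<open>i\<close> outside row \<open>t\<close> sum to \<open>0\<close>, so every off-diagonal entry
  equals the sum of its column. By symmetry these sums are one number \<open>r\<close>, and the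
  diagonal entries are then \<open>- d * r\<close>: a multiple of
  \<open>sphere_matrix d\<close>.\<close>

lemma proportional: "\<exists>c. \<forall>T\<in>D. \<forall>x\<in>coord_span T. quad_form T C x = c * Q x"
proof -
  \<comment> \<open>The choice is immaterial by \<open>fiber_constant\<close>; for
    \<open>i = j\<close> the pair may be a single vertex.\<close>
  define \<beta> where "\<beta> i j = (SOME c. \<exists>a b. {a, b} \<in> D \<and> \<phi> a = i \<and> \<phi> b = j \<and> c = C a b)" for i j
  have \<beta>: "C a b = \<beta> (\<phi> a) (\<phi> b)" if ab: "{a, b} \<in> D" for a b
  proof -
    have "\<exists>a' b'. {a', b'} \<in> D \<and> \<phi> a' = \<phi> a \<and> \<phi> b' = \<phi> b \<and> \<beta> (\<phi> a) (\<phi> b) = C a' b'"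
      unfolding \<beta>_def by (rule someI[of _ "C a b"]) (use ab in blast)
    then show ?thesis
      using fiber_constant[OF ab] by metis
  qed
  have \<beta>_sym: "\<beta> i j = \<beta> j i" if ij: "i \<in> J" "j \<in> J" for i j
  proof -
    obtain a b where "{a, b} \<in> D" "\<phi> a = i" "\<phi> b = j"
      using ex_edge_over[OF ij] .
    then show ?thesis
      using \<beta>[of a b] \<beta>[of b a] C_sym[of a b] by (simp add: insert_commute)
  qed
  have row: "(\<Sum>j\<in>J - {t}. \<beta> j i) = 0" if t: "t \<in> J" and i: "i \<in> J - {t}" for t i
  proof -
    obtain s where s: "\<And>i. i \<in> J - {t} \<Longrightarrow> \<phi> (s i) = i" "s ` (J - {t}) \<in> D" "inj_on s (J - {t})"
      using ex_transversal[OF t] by blast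
    define T where "T = s ` (J - {t})"
    define z where "z a = (if a \<in> T then 1 else 0 :: real)" for a
    have z: "z \<in> coord_span T"
      by (auto simp: z_def coord_span_def)
    then have "Q z = 0"
      using Q_transversal_zero[OF t s(1,2)] by (auto simp: T_def z_def)
    then have "0 = (\<Sum>a\<in>T. C a (s i) * z a)"
      using kernel_vertex[of T z "s i"] z s(2) i by (simp add: T_def)
    also have "\<dots> = (\<Sum>a\<in>T. C a (s i))"
      by (intro sum.cong refl) (simp add: z_def)
    also have "\<dots> = (\<Sum>j\<in>J - {t}. C (s j) (s i))"
      unfolding T_def using s(3) by (simp add: sum.reindex)
    also have "\<dots> = (\<Sum>j\<in>J - {t}. \<beta> j i)"
    proof (intro sum.cong refl)
      fix j assume j: "j \<in> J - {t}"
      have "{s j, s i} \<in> D"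
        using i j by (intro subface[OF s(2)]) auto
      then show "C (s j) (s i) = \<beta> j i"
        using \<beta> s(1)[OF i] s(1)[OF j] by metis
    qed
    finally show ?thesis ..
  qed
  define \<rho> where "\<rho> i = (\<Sum>j\<in>J. \<beta> j i)" for i
  have off: "\<beta> t i = \<rho> i" if "t \<in> J" "i \<in> J" "t \<noteq> i" for t i
    using row[OF that(1), of i] that by (simp add: \<rho>_def sum.remove[of J t])
  have "1 \<in> J"
    by (simp add: J_def)
  define r where "r = \<rho> 1"
  have \<rho>: "\<rho> i = r" if i: "i \<in> J" for i
  proof (cases "i = 1")
    case False
    then show ?thesis
      using off[OF i \<open>1 \<in> J\<close>] off[OF \<open>1 \<in> J\<close> i] \<beta>_sym[OF i \<open>1 \<in> J\<close>] by (simp add: r_def)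
  qed (simp add: r_def)
  have diag: "\<beta> i i = - real d * r" if i: "i \<in> J" for i
  proof -
    have "card (J - {i}) = d + 1"
      using i by simp
    then have "J - {i} \<noteq> {}"
      by (metis card.empty add_is_0 one_neq_zero)
    then obtain t where t: "t \<in> J" "t \<noteq> i"
      by blast
    have "0 = (\<Sum>j\<in>J - {t}. \<beta> j i)"
      using row[OF t(1), of i] i t(2) by simp
    also have "\<dots> = \<beta> i i + (\<Sum>j\<in>J - {t} - {i}. \<beta> j i)"
      using i t(2) by (intro sum.remove) auto
    also have "(\<Sum>j\<in>J - {t} - {i}. \<beta> j i) = (\<Sum>j\<in>J - {t} - {i}. r)"
      using off i \<rho>[OF i] by (intro sum.cong refl) auto
    \<comment> \<open>Of the \<open>d + 2\<close> indices, \<open>t\<close> and \<open>i\<close>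
      have been removed.\<close>
    also have "\<dots> = real d * r"
      using i t by simp
    finally show ?thesis
      by simp
  qed
  have C_B: "C a b = - r * B a b" if ab: "{a, b} \<in> D" for a b
  proof -
    have "a \<in> vertices D" "b \<in> vertices D"
      using ab by (auto simp: vertices_def)
    then have "\<phi> a \<in> J" "\<phi> b \<in> J"
      using image_vertex by blast+
    then have "\<beta> (\<phi> a) (\<phi> b) = - r * sphere_matrix d (\<phi> a) (\<phi> b)"
      using diag off \<rho> by (auto simp: sphere_matrix_def)
    then show ?thesis
      using \<beta>[OF ab] by (simp add: B_def)
  qed
  have "quad_form T C x = - r * Q x" if T: "T \<in> D" "x \<in> coord_span T" for T x
  proof -
    have "quad_form T C x = (\<Sum>i\<in>T. \<Sum>j\<in>T. - r * (B i j * x i * x j))"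
      unfolding quad_form_def using C_B subface[OF T(1)] by (intro sum.cong refl) simp
    also have "\<dots> = - r * quad_form T B x"
      by (simp only: quad_form_def sum_distrib_left)
    finally show ?thesis
      using Q_face[OF T] by simp
  qed
  then show ?thesis
    by blast
qed

end

section \<open>The pulled back form is not a sum of squares\<close>

context sphere_map
begin

lemma not_sum_of_squares:
  assumes a: "\<And>F x. F \<in> D \<Longrightarrow> x \<in> coord_span F \<Longrightarrow> Q x = (\<Sum>j<(k::nat). (\<Sum>i\<in>vertices D. a j i * x i)\<^sup>2)"
  shows False
proof -
  \<comment> \<open>\<open>f v\<close> collects the coefficients of \<open>x v\<close> in the
    \<open>k\<close> linear forms. Padding with \<open>0\<close> turns agreement below
    \<open>k\<close> into equality of functions, as \<open>constant_on_vertex_fibers\<close>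
    requires.\<close>
  define f where "f v = (\<lambda>j. if j < k then a j v else 0)" for v
  have fV: "(\<Sum>j<k. f u j * f v j) = B u v" if uv: "{u, v} \<in> D" for u v
  proof -
    define x where "x p q = (\<lambda>i. (if i = u then p else 0) + (if i = v then q else 0) :: real)" for p q
    have V: "u \<in> vertices D" "v \<in> vertices D"
      using uv by (auto simp: vertices_def)
    have x: "x p q \<in> coord_span {u, v}" for p q
      by (auto simp: x_def coord_span_def)
    have lin: "(\<Sum>i\<in>vertices D. g i * x p q i) = g u * p + g v * q" for g p q
    proof -
      have "(\<Sum>i\<in>vertices D. g i * x p q i) =
          (\<Sum>i\<in>vertices D. if i = u then g i * p else 0) + (\<Sum>i\<in>vertices D. if i = v then g i * q else 0)"
        unfolding x_def sum.distrib[symmetric] by (intro sum.cong refl) (auto simp: algebra_simps)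
      then show ?thesis
        using V finite_vertices by simp
    qed
    have val: "Q (x p q) = B u u * p\<^sup>2 + 2 * B u v * p * q + B v v * q\<^sup>2" for p q
    proof -
      have "Q (x p q) = (\<Sum>i\<in>vertices D. (\<Sum>j\<in>vertices D. B i j * x p q j) * x p q i)"
        unfolding Q_def quad_form_def sum_distrib_right by (intro sum.cong refl) (simp add: mult_ac)
      also have "\<dots> = (B u u * p + B u v * q) * p + (B v u * p + B v v * q) * q"
        unfolding lin ..
      finally show ?thesis
        by (simp add: B_sym[of v u] power2_eq_square algebra_simps)
    qed
    have sq: "Q (x p q) = (\<Sum>j<k. (a j u * p + a j v * q)\<^sup>2)" for p q
      using a[OF uv x] by (simp add: lin)
    \<comment> \<open>Polarization on the span of the face \<open>{u, v}\<close>, with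
      \<open>u = v\<close> allowed.\<close>
    have "4 * B u v = Q (x 1 1) - Q (x 1 (- 1))"
      by (simp add: val)
    also have "\<dots> = (\<Sum>j<k. 4 * (a j u * a j v))"
      unfolding sq sum_subtractf[symmetric] by (intro sum.cong refl) (simp add: power2_eq_square algebra_simps)
    also have "\<dots> = 4 * (\<Sum>j<k. f u j * f v j)"
      by (simp add: f_def sum_distrib_left)
    finally show ?thesis
      by simp
  qed
  have fiber: "f u = f v" if uv: "{u, v} \<in> D" "\<phi> u = \<phi> v" for u v
  proof -
    have "{u} \<in> D" "{v} \<in> D"
      using uv subface by auto
    then have "(\<Sum>j<k. (f u j - f v j)\<^sup>2) = B u u - 2 * B u v + B v v"
      using fV[of u u] fV[of v v] fV[OF uv(1)]
      by (simp add: power2_eq_square algebra_simps sum.distrib sum_subtractf sum_distrib_left[symmetric])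
    \<comment> \<open>All three entries equal \<open>d\<close>, because \<open>u\<close> and
      \<open>v\<close> lie in one fibre.\<close>
    also have "\<dots> = 0"
      using uv(2) by (simp add: B_def)
    finally have "f u j = f v j" if "j < k" for j
      using that by (simp add: sum_nonneg_eq_0_iff)
    then show ?thesis
      by (auto simp: f_def)
  qed
  have const: "f u = f v" if "u \<in> vertices D" "v \<in> vertices D" "\<phi> u = \<phi> v" for u v
    using constant_on_vertex_fibers[of f, OF fiber that] .
  have "\<exists>v\<in>vertices D. \<phi> v = i" if "i \<in> J" for i
  proof -
    obtain T where "T \<in> D" "\<phi> ` T = {i}"
      using surj[of "{i}"] \<open>i \<in> J\<close> by auto
    then show ?thesis
      using face_subset by blast
  qed
  then obtain s where s: "\<And>i. i \<in> J \<Longrightarrow> s i \<in> vertices D \<and> \<phi> (s i) = i"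
    by metis
  have gram: "(\<Sum>j<k. f (s i) j * f (s i') j) = sphere_matrix d i i'" if ii': "i \<in> J" "i' \<in> J" for i i'
  proof -
    have "card {i, i'} \<le> d + 1"
      using d card_insert_le_m1[of 2 "{i'}" i] by simp
    then obtain T where T: "T \<in> D" "\<phi> ` T = {i, i'}"
      using surj[of "{i, i'}"] ii' by auto
    then obtain u v where uv: "u \<in> T" "v \<in> T" "\<phi> u = i" "\<phi> v = i'"
      by (metis imageE insertI1 insertI2)
    then have "f u = f (s i)" "f v = f (s i')"
      using const s ii' face_subset[OF T(1)] by (metis subsetD)+
    moreover have "{u, v} \<in> D"
      using uv by (intro subface[OF T(1)]) auto
    ultimately show ?thesis
      using fV[of u v] uv by (simp add: B_def)
  qed
  have "0 \<le> (\<Sum>j<k. (\<Sum>i\<in>J. f (s i) j)\<^sup>2)"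
    by (intro sum_nonneg) simp
  also have "\<dots> = (\<Sum>j<k. \<Sum>i\<in>J. \<Sum>i'\<in>J. f (s i) j * f (s i') j)"
    by (simp add: power2_eq_square sum_product)
  also have "\<dots> = (\<Sum>i\<in>J. \<Sum>j<k. \<Sum>i'\<in>J. f (s i) j * f (s i') j)"
    by (rule sum.swap)
  also have "\<dots> = (\<Sum>i\<in>J. \<Sum>i'\<in>J. \<Sum>j<k. f (s i) j * f (s i') j)"
    by (intro sum.cong refl sum.swap)
  also have "\<dots> = quad_form J (sphere_matrix d) (\<lambda>i. 1)"
    unfolding quad_form_def by (intro sum.cong refl) (simp add: gram)
  also have "\<dots> < 0"
    by (simp add: quad_form_sphere_matrix power2_eq_square algebra_simps)
  finally show False
    by simp
qed

end

section \<open>Local rank and extremality\<close>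

context finite_complex
begin

lemma nonneg_cone_form:
  assumes "q \<in> nonneg_cone D"
  shows "\<exists>C. (\<forall>i j. C i j = C j i) \<and>
    (\<forall>F\<in>D. \<forall>x\<in>coord_span F. sr_eval q x = quad_form F C x \<and> 0 \<le> quad_form F C x)"
proof -
  have q: "q \<in> sr_part 2 D" "\<And>F x. F \<in> D \<Longrightarrow> x \<in> coord_span F \<Longrightarrow> 0 \<le> sr_eval q x"
    using assms by (auto simp: nonneg_cone_def)
  obtain p where p: "homogeneous 2 p" "\<And>F x. F \<in> D \<Longrightarrow> x \<in> coord_span F \<Longrightarrow> sr_eval q x = poly_eval p x"
    using sr_partE[OF q(1)] by metis
  obtain C where C: "\<forall>i j. C i j = C j i"
      "\<forall>F. \<forall>x\<in>coord_span F. finite F \<longrightarrow> poly_eval p x = quad_form F C x"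
    using quadratic_form_exists[OF p(1)] by blast
  have "sr_eval q x = quad_form F C x" if "F \<in> D" "x \<in> coord_span F" for F x
    using p(2)[OF that] C(2) that finite_face by simp
  then show ?thesis
    using C(1) q(2) by (intro exI[of _ C]) auto
qed

lemma sos_rank_witness:
  assumes q: "q \<in> nonneg_cone D" and F: "F \<in> D"
  shows "sos_rank F (sr_eval q) \<le> card F"
    "\<exists>a. \<forall>x\<in>coord_span F. sr_eval q x = (\<Sum>j<sos_rank F (sr_eval q). (\<Sum>i\<in>F. a j i * x i)\<^sup>2)"
proof -
  define P where "P k \<longleftrightarrow> (\<exists>a :: nat \<Rightarrow> 'v \<Rightarrow> real. \<forall>x\<in>coord_span F.
    sr_eval q x = (\<Sum>j<k. (\<Sum>i\<in>F. a j i * x i)\<^sup>2))" for k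
  have rank: "sos_rank F (sr_eval q) = (LEAST k. P k)"
    by (simp add: sos_rank_def P_def)
  obtain C where "\<forall>i j. C i j = C j i"
      "\<forall>x\<in>coord_span F. sr_eval q x = quad_form F C x \<and> 0 \<le> quad_form F C x"
    using nonneg_cone_form[OF q] F by blast
  then have P: "P (card F)"
    unfolding P_def using quad_form_sum_squares[OF finite_face[OF F], of C] by auto
  show "sos_rank F (sr_eval q) \<le> card F"
    unfolding rank using P by (rule Least_le)
  have "P (sos_rank F (sr_eval q))"
    unfolding rank using P by (rule LeastI)
  then show "\<exists>a. \<forall>x\<in>coord_span F. sr_eval q x = (\<Sum>j<sos_rank F (sr_eval q). (\<Sum>i\<in>F. a j i * x i)\<^sup>2)"
    by (simp add: P_def)
qed

text \<open>A uniform bound, so that the set of local ranks whose \<open>Max\<close> defines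
  \<open>elocr\<close> is finite.\<close>

lemma locr_le:
  assumes "q \<in> nonneg_cone D" "D \<noteq> {}"
  shows "locr D q \<le> card (vertices D)"
proof -
  have "sos_rank F (sr_eval q) \<le> card (vertices D)" if "F \<in> D" for F
    using sos_rank_witness(1)[OF assms(1) that] card_mono[OF finite_vertices face_subset[OF that]] by simp
  then show ?thesis
    unfolding locr_def using finite_faces assms(2) by (intro Max.boundedI) auto
qed

end

context sphere_map
begin

text \<open>On a transversal face with \<open>d + 1\<close> vertices only constant vectors are zeros
  of \<open>Q\<close>. With \<open>k < d\<close> squares, the vanishing of all their linear forms
  and of one coordinate would be at most \<open>d\<close> equations in \<open>d + 1\<close>
  unknowns, and a nonzero solution would be a constant vector with a zero coordinate.\<close>

lemma le_locr:
  assumes q: "q \<in> nonneg_cone D"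
    and ev: "\<And>F x. F \<in> D \<Longrightarrow> x \<in> coord_span F \<Longrightarrow> sr_eval q x = Q x"
  shows "d \<le> locr D q"
proof -
  have t: "d + 2 \<in> J" and one: "1 \<in> J - {d + 2}"
    by (auto simp: J_def)
  obtain s where s: "\<And>i. i \<in> J - {d + 2} \<Longrightarrow> \<phi> (s i) = i" "s ` (J - {d + 2}) \<in> D"
      "inj_on s (J - {d + 2})"
    using ex_transversal[OF t] by blast
  define T where "T = s ` (J - {d + 2})"
  have T: "T \<in> D" "card T = d + 1" "s 1 \<in> T"
    using s(2,3) t one by (auto simp: T_def card_image)
  define k where "k = sos_rank T (sr_eval q)"
  obtain a where a: "\<And>x. x \<in> coord_span T \<Longrightarrow> sr_eval q x = (\<Sum>j<k. (\<Sum>i\<in>T. a j i * x i)\<^sup>2)"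
    using sos_rank_witness(2)[OF q T(1)] unfolding k_def by blast
  have "d \<le> k"
  proof (rule ccontr)
    assume "\<not> d \<le> k"
    then have "Suc k < card T"
      using T(2) by simp
    \<comment> \<open>Row \<open>k\<close> is the additional equation
      \<open>x (s 1) = 0\<close>.\<close>
    define b where "b j i = (if j < k then a j i else if i = s 1 then 1 else 0)" for j i
    obtain x where x: "x \<in> coord_span T" "\<exists>i. x i \<noteq> 0" "\<forall>j<Suc k. (\<Sum>i\<in>T. b j i * x i) = 0"
      using ex_nontrivial_solution[OF finite_face[OF T(1)] \<open>Suc k < card T\<close>, of b] by blast
    have "(\<Sum>i\<in>T. b k i * x i) = x (s 1)"
      using T(3) finite_face[OF T(1)] by (simp add: b_def if_distrib[of "\<lambda>c. c * _"] cong: if_cong)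
    then have x1: "x (s 1) = 0"
      using x(3) by simp
    have "(\<Sum>i\<in>T. a j i * x i) = 0" if "j < k" for j
    proof -
      have "(\<Sum>i\<in>T. a j i * x i) = (\<Sum>i\<in>T. b j i * x i)"
        using that by (simp add: b_def)
      then show ?thesis
        using x(3) that by simp
    qed
    then have "Q x = 0"
      using a[OF x(1)] ev[OF T(1) x(1)] by simp
    then have "\<forall>i\<in>J - {d + 2}. \<forall>j\<in>J - {d + 2}. x (s i) = x (s j)"
      using Q_transversal_zero[OF t s(1,2)] x(1) unfolding T_def by blast
    then have "x (s i) = 0" if "i \<in> J - {d + 2}" for i
      using that one x1 by metis
    then have "x a = 0" for a
      using x(1) by (cases "a \<in> T") (auto simp: T_def coord_span_def)
    then show False
      using x(2) by blast
  qed
  also have "k \<le> locr D q"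
    unfolding locr_def k_def using finite_faces T(1) by (intro Max_ge) auto
  finally show ?thesis .
qed

lemma Q_nonzero: "\<exists>F\<in>D. \<exists>x\<in>coord_span F. Q x \<noteq> 0"
proof -
  \<comment> \<open>The bound \<open>d >= 1\<close> keeps the index \<open>2\<close> apart from the
    omitted \<open>d + 2\<close>.\<close>
  have t: "d + 2 \<in> J" and ij: "1 \<in> J - {d + 2}" "2 \<in> J - {d + 2}"
    using d by (auto simp: J_def)
  obtain s where s: "\<And>i. i \<in> J - {d + 2} \<Longrightarrow> \<phi> (s i) = i" "s ` (J - {d + 2}) \<in> D"
      "inj_on s (J - {d + 2})"
    using ex_transversal[OF t] by blast
  define x where "x v = (if v = s 1 then 1 else 0 :: real)" for v
  have x: "x \<in> coord_span (s ` (J - {d + 2}))"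
    using ij(1) by (auto simp: x_def coord_span_def)
  have "s 1 \<noteq> s 2"
    using s(1)[OF ij(1)] s(1)[OF ij(2)] by auto
  then have "x (s 1) \<noteq> x (s 2)"
    by (simp add: x_def)
  then have "Q x \<noteq> 0"
    using Q_transversal_zero[OF t s(1,2) x] ij by blast
  then show ?thesis
    using s(2) x by blast
qed

lemma extreme:
  assumes q: "q \<in> nonneg_cone D"
    and ev: "\<And>F x. F \<in> D \<Longrightarrow> x \<in> coord_span F \<Longrightarrow> sr_eval q x = Q x"
  shows "spans_extreme_ray D (nonneg_cone D) q"
  unfolding spans_extreme_ray_def
proof (intro conjI q notI)
  assume "q = \<zero>\<^bsub>sr_ring D\<^esub>"
  then show False
    using Q_nonzero ev sr_eval_zero by metis
next
  assume "\<exists>y\<in>nonneg_cone D. \<exists>z\<in>nonneg_cone D. sr_lin_indep D y z \<and> q = y \<oplus>\<^bsub>sr_ring D\<^esub> z"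
  then obtain y z where yz: "y \<in> nonneg_cone D" "z \<in> nonneg_cone D" "sr_lin_indep D y z"
      "q = y \<oplus>\<^bsub>sr_ring D\<^esub> z"
    by blast
  have part: "y \<in> sr_part 2 D" "z \<in> sr_part 2 D"
    using yz by (auto simp: nonneg_cone_def)
  have sum: "Q x = sr_eval y x + sr_eval z x" if "F \<in> D" "x \<in> coord_span F" for F x
    using ev[OF that] sr_eval_add[OF part that] yz(4) by simp
  have z_nonneg: "0 \<le> sr_eval z x" if "F \<in> D" "x \<in> coord_span F" for F x
    using yz(2) that by (auto simp: nonneg_cone_def)
  obtain C where C: "\<forall>i j. C i j = C j i"
      "\<forall>F\<in>D. \<forall>x\<in>coord_span F. sr_eval y x = quad_form F C x \<and> 0 \<le> quad_form F C x"
    using nonneg_cone_form[OF yz(1)] by blast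
  interpret dominated_form D d \<phi> C
  proof
    show "C a b = C b a" for a b
      using C(1) by blast
    fix T x assume T: "T \<in> D" "x \<in> coord_span T"
    show "0 \<le> quad_form T C x"
      using C(2) T by blast
    show "quad_form T C x \<le> Q x"
      using sum[OF T] z_nonneg[OF T] C(2) T by simp
  qed
  obtain c where "\<forall>T\<in>D. \<forall>x\<in>coord_span T. quad_form T C x = c * Q x"
    using proportional by blast
  then have y: "sr_eval y x = c * Q x" if "F \<in> D" "x \<in> coord_span F" for F x
    using C(2) that by simp
  \<comment> \<open>On the faces the summands are \<open>c * Q\<close> and
    \<open>(1 - c) * Q\<close>. In this relation the coefficients \<open>1 - c\<close> and
    \<open>c\<close> are never both zero, so it also covers the cases in which one summand
    vanishes.\<close>
  have "(1 - c) * sr_eval y x = c * sr_eval z x" if "F \<in> D" "x \<in> coord_span F" for F x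
  proof -
    have "sr_eval z x = (1 - c) * Q x"
      using sum[OF that] y[OF that] by (simp add: algebra_simps)
    then show ?thesis
      using y[OF that] by simp
  qed
  then have "\<not> sr_lin_indep D y z"
    by (rule not_sr_lin_indep[OF part]) auto
  then show False
    using yz(3) by blast
qed

lemma le_elocr:
  assumes "\<not> chordal_complex D"
  shows "d \<le> elocr D"
proof -
  obtain q where q: "q \<in> sr_part 2 D"
      "\<forall>F\<in>D. \<forall>x\<in>coord_span F. sr_eval q x = quad_form (vertices D) B x"
    using quad_form_in_sr_part by blast
  then have ev: "sr_eval q x = Q x" if "F \<in> D" "x \<in> coord_span F" for F x
    using that by (simp add: Q_def)
  have nonneg: "q \<in> nonneg_cone D"
    using q(1) ev Q_nonneg by (auto simp: nonneg_cone_def)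
  have "q \<notin> sos_cone D"
  proof
    assume "q \<in> sos_cone D"
    then obtain k :: nat and a where
      "\<forall>F\<in>D. \<forall>x\<in>coord_span F. sr_eval q x = (\<Sum>j<k. (\<Sum>i\<in>vertices D. a j i * x i)\<^sup>2)"
      using sos_eval by blast
    then show False
      using ev by (intro not_sum_of_squares[where k = k and a = a]) metis
  qed
  define S where "S = {locr D q | q. q \<in> nonneg_cone D - sos_cone D \<and> spans_extreme_ray D (nonneg_cone D) q}"
  have "spans_extreme_ray D (nonneg_cone D) q"
    by (rule extreme[OF nonneg]) (rule ev)
  then have "locr D q \<in> S"
    using nonneg \<open>q \<notin> sos_cone D\<close> by (auto simp: S_def)
  moreover have "S \<subseteq> {..card (vertices D)}"
    using locr_le Q_nonzero by (auto simp: S_def)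
  then have "finite S"
    using finite_subset by blast
  ultimately have "locr D q \<le> Max S"
    by (intro Max_ge)
  moreover have "elocr D = Max S"
    using assms by (simp add: elocr_def S_def)
  moreover have "d \<le> locr D q"
    by (rule le_locr[OF nonneg]) (rule ev)
  ultimately show ?thesis
    by simp
qed

end

theorem corollary3p15:
  fixes \<Delta> :: "'v set set" and d :: nat
  assumes "d \<ge> 1"
    and "combinatorial_manifold d \<Delta>"
    and "connected_complex \<Delta>"
  shows "(\<exists>\<phi>. strongly_connected_map \<Delta> (simplicial_sphere d) \<phi>) \<and> elocr \<Delta> \<ge> d"
proof -
  have complex: "is_complex \<Delta>"
    using assms(2) by (simp add: combinatorial_manifold_def)
  have "graph_connected \<Delta> (vertices \<Delta>)" "vertices \<Delta> \<noteq> {}"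
    using graph_connected_vertices[OF complex] assms(3) by (simp_all add: connected_complex_def)
  then interpret M: spherical_links \<Delta> d
    using complex assms(1) Euclidean_cone_link[OF assms(1,2)]
    by (intro spherical_links.intro spherical_links_axioms.intro finite_complex.intro) auto
  obtain \<phi> where \<phi>: "strongly_connected_map \<Delta> (simplicial_sphere d) \<phi>"
    using M.ex_strongly_connected_map by blast
  interpret S: sphere_map \<Delta> d \<phi>
    by unfold_locales (use complex assms(1) \<phi> in auto)
  show ?thesis
    using \<phi> S.le_elocr[OF M.not_chordal] by blast
qed

end
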